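(* Let $\mathbb{S}\subset\mathbb{R}^3$ be the unit sphere. Let $\overrightarrow{l}^1,\overrightarrow{l}^2,\overrightarrow{l}^3,\overrightarrow{q},\overrightarrow{c}$ be the Hamiltonian vector fields on $\mathbb{S}$ corresponding to three linearly independent linear harmonics $\langle l^i,x\rangle$ ($l^i\in\mathbb{R}^3$, $i=1,2,3$), a nonzero quadratic spherical harmonic $q$ and a nonzero cubic spherical harmonic $c$. Let $\tilde l(x)=\langle l,x\rangle$ and $\tilde q(x)$ be a nonzero linear and a nonzero quadratic spherical harmonic, and let $\tilde l'=\nabla_{\mathbb{S}}\tilde l$, $\tilde q'=\nabla_{\mathbb{S}}\tilde q$ be the corresponding gradient vector fields. Then the control system on $\mathbb{S}$ $$\dot x=\sum_{i=1}^3\overrightarrow{l}^i(x)u_i(t)+\overrightarrow{q}(x)v_2(t)+\overrightarrow{c}(x)v_3(t)+\tilde l'(x)w_1(t)+\tilde q'(x)w_2(t)$$ is controllable in the space of finite ensembles on $\mathbb{S}$ and approximately controllable in the group $\mathrm{Diff}_0(\mathbb{S})$ of the diffeomorphisms of $\mathbb{S}$.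
   Context: A spherical harmonic of degree $n$ (linear, quadratic, cubic for $n=1,2,3$) is the restriction to $\mathbb{S}$ of a homogeneous harmonic polynomial of degree $n$ on $\mathbb{R}^3$. For a smooth function $\varphi$ on $\mathbb{R}^3$ restricted to $\mathbb{S}$, its Hamiltonian vector field (with respect to the area form) is $\overrightarrow{\varphi}(x)=x\times\nabla\varphi(x)$, $x\in\mathbb{S}$, and its spherical gradient is $\nabla_{\mathbb{S}}\varphi(x)=\nabla\varphi(x)-\langle\nabla\varphi(x),x\rangle x$, $x\in\mathbb{S}$. Controllable in the space of finite ensembles: for each $N\ge1$, each $T>0$ and any two $N$-tuples $(x^1_\alpha,\ldots,x^N_\alpha)$, $(x^1_\omega,\ldots,x^N_\omega)$ of pairwise distinct points of $\mathbb{S}$ there is a control on $[0,T]$ such that for each $k$ the trajectory starting at $x^k_\alpha$ at time $0$ is at $x^k_\omega$ at time $T$. Approximately controllable in $\mathrm{Diff}_0(\mathbb{S})$: for each $\hat P\in\mathrm{Diff}_0(\mathbb{S})$ (the connected component of the identity in the group of smooth diffeomorphisms of $\mathbb{S}$) and each $\varepsilon>0$ there is a control on $[0,T]$ such that the corresponding flow $P_t$, $P_0=I$, satisfies $\sup_{x\in\mathbb{S}}|\hat P(x)-P_T(x)|<\varepsilon$. Controls are integrable functions of $t$; the length $T>0$ is irrelevant, since rescaling time and control replaces $T$ by any $T'>0$. *)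

theory Defs
  imports "HOL-Analysis.Analysis"
begin

abbreviation S2 :: "(real ^ 3) set" where
  "S2 \<equiv> sphere 0 1"


section \<open>Spherical harmonics and their vector fields\<close>

definition homogeneous_polynomial :: "nat \<Rightarrow> (real ^ 3 \<Rightarrow> real) \<Rightarrow> bool" where
  "homogeneous_polynomial n p \<longleftrightarrow>
     (\<exists>a :: nat \<Rightarrow> nat \<Rightarrow> nat \<Rightarrow> real. \<forall>x.
        p x = (\<Sum>(i, j, k) \<in> {(i, j, k). i + j + k = n}. a i j k * x $ 1 ^ i * x $ 2 ^ j * x $ 3 ^ k))"

definition partial_deriv :: "'a::euclidean_space \<Rightarrow> ('a \<Rightarrow> 'b::real_normed_vector) \<Rightarrow> 'a \<Rightarrow> 'b" where
  "partial_deriv b f = (\<lambda>x. frechet_derivative f (at x) b)"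

definition laplacian :: "('a::euclidean_space \<Rightarrow> real) \<Rightarrow> 'a \<Rightarrow> real" where
  "laplacian f x = (\<Sum>b\<in>Basis. partial_deriv b (partial_deriv b f) x)"

text \<open>
  A spherical harmonic of degree \<open>n\<close> is the restriction to the sphere of a function \<open>p\<close> with
  \<open>homogeneous_harmonic n p\<close>. By homogeneity \<open>p\<close> is determined by its restriction, so a spherical
  harmonic is represented by \<open>p\<close> itself; the zero polynomial is allowed for every \<open>n\<close>.
\<close>

definition homogeneous_harmonic :: "nat \<Rightarrow> (real ^ 3 \<Rightarrow> real) \<Rightarrow> bool" where
  "homogeneous_harmonic n p \<longleftrightarrow> homogeneous_polynomial n p \<and> (\<forall>x. laplacian p x = 0)"

definition nonzero_spherical_harmonic :: "nat \<Rightarrow> (real ^ 3 \<Rightarrow> real) \<Rightarrow> bool" where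
  "nonzero_spherical_harmonic n p \<longleftrightarrow> homogeneous_harmonic n p \<and> (\<exists>x\<in>S2. p x \<noteq> 0)"

definition linearly_independent_on :: "'a set \<Rightarrow> ('i::finite \<Rightarrow> 'a \<Rightarrow> real) \<Rightarrow> bool" where
  "linearly_independent_on A f \<longleftrightarrow>
     (\<forall>a :: 'i \<Rightarrow> real. (\<forall>x\<in>A. (\<Sum>i\<in>UNIV. a i * f i x) = 0) \<longrightarrow> (\<forall>i. a i = 0))"

definition gradient :: "('a::real_inner \<Rightarrow> real) \<Rightarrow> 'a \<Rightarrow> 'a" where
  "gradient f x = (THE D. GDERIV f x :> D)"

definition hamiltonian_field :: "(real ^ 3 \<Rightarrow> real) \<Rightarrow> real ^ 3 \<Rightarrow> real ^ 3" where
  "hamiltonian_field \<phi> x = cross3 x (gradient \<phi> x)"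

definition spherical_gradient :: "(real ^ 3 \<Rightarrow> real) \<Rightarrow> real ^ 3 \<Rightarrow> real ^ 3" where
  "spherical_gradient \<phi> x = gradient \<phi> x - (gradient \<phi> x \<bullet> x) *\<^sub>R x"


section \<open>Control systems on the sphere\<close>

text \<open>
  \<open>F u x\<close> is the velocity at the point \<open>x\<close> under the control value \<open>u\<close>. Since controls are merely
  integrable, trajectories are absolutely continuous solutions in the sense of Caratheodory,
  expressed by the integral equation.
\<close>

definition trajectory ::
    "('c \<Rightarrow> real ^ 3 \<Rightarrow> real ^ 3) \<Rightarrow> real \<Rightarrow> (real \<Rightarrow> 'c) \<Rightarrow> (real \<Rightarrow> real ^ 3) \<Rightarrow> bool" where
  "trajectory F T u \<gamma> \<longleftrightarrow>
     (\<forall>t\<in>{0..T}. \<gamma> t \<in> S2) \<and>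
     (\<lambda>s. F (u s) (\<gamma> s)) absolutely_integrable_on {0..T} \<and>
     (\<forall>t\<in>{0..T}. ((\<lambda>s. F (u s) (\<gamma> s)) has_integral (\<gamma> t - \<gamma> 0)) {0..t})"

definition finite_ensemble_controllable ::
    "('c::euclidean_space \<Rightarrow> real ^ 3 \<Rightarrow> real ^ 3) \<Rightarrow> bool" where
  "finite_ensemble_controllable F \<longleftrightarrow>
     (\<forall>N::nat. \<forall>T::real. \<forall>x\<^sub>\<alpha> x\<^sub>\<omega> :: nat \<Rightarrow> real ^ 3.
        N \<ge> 1 \<longrightarrow> T > 0 \<longrightarrow>
        x\<^sub>\<alpha> ` {1..N} \<subseteq> S2 \<longrightarrow> inj_on x\<^sub>\<alpha> {1..N} \<longrightarrow>
        x\<^sub>\<omega> ` {1..N} \<subseteq> S2 \<longrightarrow> inj_on x\<^sub>\<omega> {1..N} \<longrightarrow>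
        (\<exists>u. u absolutely_integrable_on {0..T} \<and>
             (\<forall>k\<in>{1..N}. \<exists>\<gamma>. trajectory F T u \<gamma> \<and> \<gamma> 0 = x\<^sub>\<alpha> k \<and> \<gamma> T = x\<^sub>\<omega> k)))"


section \<open>The diffeomorphism group of the sphere\<close>

fun iterated_partial :: "'a::euclidean_space list \<Rightarrow> ('a \<Rightarrow> 'b::real_normed_vector) \<Rightarrow> 'a \<Rightarrow> 'b" where
  "iterated_partial [] f = f"
| "iterated_partial (b # bs) f = partial_deriv b (iterated_partial bs f)"

text \<open>For open \<open>U\<close> this is smoothness: all iterated partial derivatives exist and are differentiable.\<close>

definition smooth_on :: "'a::euclidean_space set \<Rightarrow> ('a \<Rightarrow> 'b::real_normed_vector) \<Rightarrow> bool" where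
  "smooth_on U f \<longleftrightarrow>
     (\<forall>bs\<in>lists Basis. \<forall>x\<in>U. iterated_partial bs f differentiable (at x))"

text \<open>
  A map on the sphere is extended to the punctured space by making it constant along rays
  (\<open>sgn x = x /\<^sub>R norm x\<close>). As \<open>sgn\<close> is a smooth retraction of the punctured space onto the sphere,
  the map is smooth on the sphere iff this extension is smooth, and the derivatives
  of the extension at points of the sphere encode those of the map.
\<close>

definition radial_extension :: "(real ^ 3 \<Rightarrow> real ^ 3) \<Rightarrow> real ^ 3 \<Rightarrow> real ^ 3" where
  "radial_extension f = (\<lambda>x. f (sgn x))"

definition smooth_on_sphere :: "(real ^ 3 \<Rightarrow> real ^ 3) \<Rightarrow> bool" where
  "smooth_on_sphere f \<longleftrightarrow> smooth_on (- {0}) (radial_extension f)"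

text \<open>Extensional functions are used so that each diffeomorphism is represented exactly once.\<close>

definition Diff :: "(real ^ 3 \<Rightarrow> real ^ 3) set" where
  "Diff = {P \<in> extensional S2. bij_betw P S2 S2 \<and>
             smooth_on_sphere P \<and> smooth_on_sphere (inv_into S2 P)}"

text \<open>
  The \<open>C\<^sup>\<infinity>\<close> topology (uniform convergence of the maps and of all their derivatives), given by
  the balls of the pseudometrics measuring one derivative each.
\<close>

definition Diff_dist ::
    "(real ^ 3) list \<Rightarrow> (real ^ 3 \<Rightarrow> real ^ 3) \<Rightarrow> (real ^ 3 \<Rightarrow> real ^ 3) \<Rightarrow> real" where
  "Diff_dist bs P Q =
     (SUP x\<in>S2. dist (iterated_partial bs (radial_extension P) x)
                     (iterated_partial bs (radial_extension Q) x))"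

definition Diff_topology :: "(real ^ 3 \<Rightarrow> real ^ 3) topology" where
  "Diff_topology = topology_generated_by
     {{Q \<in> Diff. Diff_dist bs P Q < e} | bs P e. bs \<in> lists Basis \<and> P \<in> Diff \<and> e > 0}"

definition Diff0 :: "(real ^ 3 \<Rightarrow> real ^ 3) set" where
  "Diff0 = connected_component_of_set Diff_topology (restrict id S2)"

definition approximately_controllable_Diff0 ::
    "('c::euclidean_space \<Rightarrow> real ^ 3 \<Rightarrow> real ^ 3) \<Rightarrow> bool" where
  "approximately_controllable_Diff0 F \<longleftrightarrow>
     (\<forall>Q\<in>Diff0. \<forall>\<epsilon>>0. \<forall>T>0.
        \<exists>u P. u absolutely_integrable_on {0..T} \<and>
              (\<forall>x\<in>S2. P 0 x = x \<and> trajectory F T u (\<lambda>t. P t x)) \<and>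
              (SUP x\<in>S2. norm (Q x - P T x)) < \<epsilon>)"

end

theory Submission
  imports Defs "HOL-Homology.Homology"
begin

text \<open>
  Call a tangent field \<open>V\<close> of the sphere accessible if for every \<open>\<eta> > 0\<close> there are reachable maps \<open>\<psi> h\<close>,
  continuous in \<open>h\<close>, with \<open>\<psi> h x = x + h V(x)\<close> up to \<open>\<eta> \<bar>h\<bar>\<close> for small \<open>h\<close>. Accessible fields form a vector space
  closed under uniform limits, and conjugating \<open>\<psi> h\<close> with the flow of a control field \<open>V\<close> shows that they are
  closed under brackets with \<open>V\<close>. Averaging the quadratic Hamiltonian field over half-turns gives the fields
  \<open>\<langle>e, x\<rangle> x \<times> e\<close>, which together with the rotations and the gradient of a linear function give all fields
  \<open>\<langle>a, x\<rangle> x \<times> b\<close>. Brackets with these produce \<open>\<langle>c, x\<rangle>\<^sup>n x \<times> b\<close> for all \<open>n\<close>, hence \<open>exp \<langle>c, x\<rangle> x \<times> b\<close>, and by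
  Stone--Weierstrass every continuous tangent field is accessible.

  For ensembles, compose the families of \<open>2N\<close> fields spanning the tangent spaces at the \<open>N\<close> points: the resulting
  map is close to the identity, so by Brouwer it is locally onto; connectedness of the sphere minus finitely
  many points then moves one point at a time. For diffeomorphisms, the approximable ones form a closed subset
  of \<open>Diff\<close>; it is open because a diffeomorphism \<open>C\<^sup>1\<close>-close to the identity is joined to it by normalised
  convex combinations, whose velocity fields are continuous and therefore accessible.
\<close>

text \<open>The obstacle is regularity. Accessible fields are realised by maps that are only
  uniformly close to \<open>x + h V(x)\<close>; nothing is known of their derivatives, so they
  cannot be used for conjugation, and accessible fields are not seen to form a Lie algebra.
  Conjugation is done with exact flows of control fields, so one factor of every bracket comes from
  a fixed supply. Being such a factor is a linear property, invariant under half-turns, which are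
  reachable involutions; this enlarges the supply to all fields with linear coefficients, and
  degrees are raised with one factor kept in it. Averages of the quadratic Hamiltonian field are
  again Hamiltonian: the gradient of a linear function supplies the antisymmetric half of
  \<open>\<langle>a, x\<rangle> x \<times> b\<close> and with it nonzero divergence. Uniform
  closeness suffices at the end, because ensembles are corrected topologically, and because errors
  along a path of diffeomorphisms are pulled back to the source, where a bi-Lipschitz path cannot
  amplify them.\<close>

section \<open>Flows on the sphere\<close>

text \<open>
  Homogeneous of degree one, so that a Lipschitz field on the sphere becomes globally Lipschitz and a tangent
  field stays orthogonal to the position vector: its integral curves remain on the sphere.
\<close>

definition homogeneous_extension :: "('a::real_normed_vector \<Rightarrow> 'b::real_normed_vector) \<Rightarrow> 'a \<Rightarrow> 'b" where
  "homogeneous_extension V x = norm x *\<^sub>R V (sgn x)"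

text \<open>The weight \<open>norm y\<close> compensates for the blow-up of the derivative of
  \<open>sgn\<close> at the origin, so the bound stays uniform there.\<close>

lemma norm_sgn_diff_le:
  fixes x y :: "'a::real_normed_vector"
  assumes "x \<noteq> 0" "y \<noteq> 0"
  shows "norm y * norm (sgn x - sgn y) \<le> 2 * norm (x - y)"
proof -
  have "norm y * norm (sgn x - sgn y) = norm (norm y *\<^sub>R (sgn x - sgn y))" by simp
  also have "norm y *\<^sub>R (sgn x - sgn y) = (x - y) - (norm x - norm y) *\<^sub>R sgn x"
    using assms by (simp add: sgn_div_norm algebra_simps)
  also have "norm \<dots> \<le> norm (x - y) + \<bar>norm x - norm y\<bar> * norm (sgn x)"
    by (metis norm_scaleR norm_triangle_ineq4)
  also have "\<dots> \<le> norm (x - y) + norm (x - y)"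
    using assms norm_triangle_ineq3[of x y] by (simp add: norm_sgn)
  finally show ?thesis by simp
qed

text \<open>A displacement splits into a radial part, which costs the size \<open>M\<close> of the
  field, and an angular part, which costs \<open>2 * L\<close> by
  \<open>norm_sgn_diff_le\<close>.\<close>

lemma homogeneous_extension_lipschitz:
  fixes V :: "'a::real_normed_vector \<Rightarrow> 'b::real_normed_vector"
  assumes L: "\<And>x y. x \<in> sphere 0 1 \<Longrightarrow> y \<in> sphere 0 1 \<Longrightarrow> norm (V x - V y) \<le> L * norm (x - y)"
    and M: "\<And>x. x \<in> sphere 0 1 \<Longrightarrow> norm (V x) \<le> M" and "L \<ge> 0" "M \<ge> 0"
  shows "norm (homogeneous_extension V x - homogeneous_extension V y) \<le> (M + 2 * L) * norm (x - y)"
proof -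
  have bnd: "norm (homogeneous_extension V x) \<le> (M + 2 * L) * norm x" for x
  proof (cases "x = 0")
    case False
    then have "norm (V (sgn x)) \<le> M" by (intro M) (simp add: norm_sgn)
    then have "norm x * norm (V (sgn x)) \<le> norm x * (M + 2 * L)"
      by (intro mult_left_mono) (use \<open>L \<ge> 0\<close> in auto)
    then show ?thesis by (simp add: homogeneous_extension_def mult.commute)
  qed (simp add: homogeneous_extension_def)
  consider "x = 0" | "y = 0" | "x \<noteq> 0" "y \<noteq> 0" by auto
  then show ?thesis
  proof cases
    case 1 then show ?thesis using bnd[of y] by (simp add: homogeneous_extension_def)
  next
    case 2 then show ?thesis using bnd[of x] by (simp add: homogeneous_extension_def)
  next
    case 3
    have s: "sgn x \<in> sphere 0 1" "sgn y \<in> sphere 0 1" using 3 by (auto simp: norm_sgn)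
    have "homogeneous_extension V x - homogeneous_extension V y = (norm x - norm y) *\<^sub>R V (sgn x) + norm y *\<^sub>R (V (sgn x) - V (sgn y))"
      by (simp add: homogeneous_extension_def algebra_simps)
    also have "norm \<dots> \<le> \<bar>norm x - norm y\<bar> * norm (V (sgn x)) + norm y * norm (V (sgn x) - V (sgn y))"
      by (metis norm_scaleR norm_triangle_ineq abs_norm_cancel)
    also have "\<dots> \<le> norm (x - y) * M + norm y * (L * norm (sgn x - sgn y))"
      using s norm_triangle_ineq3[of x y] by (intro add_mono mult_mono M L mult_left_mono) auto
    also have "norm y * (L * norm (sgn x - sgn y)) \<le> L * (2 * norm (x - y))"
      using mult_left_mono[OF norm_sgn_diff_le[OF 3] \<open>L \<ge> 0\<close>] by (simp add: algebra_simps)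
    finally show ?thesis by (simp add: algebra_simps)
  qed
qed

text \<open>Picard iteration on an interval around \<open>0\<close>. Its length depends on
  \<open>L\<close> alone and not on \<open>x\<close>, so that one \<open>\<tau>\<close> later serves
  all points of the sphere.\<close>

lemma local_ode_solution:
  fixes f :: "'a::banach \<Rightarrow> 'a"
  assumes lip: "\<And>x y. norm (f x - f y) \<le> L * norm (x - y)" and "L > 0"
    and \<tau>: "\<tau> > 0" "8 * L * \<tau> \<le> 1"
  shows "\<exists>\<gamma>. \<gamma> 0 = x \<and> (\<forall>t\<in>{-\<tau>..\<tau>}. (\<gamma> has_vector_derivative f (\<gamma> t)) (at t within {-\<tau>..\<tau>}))"
proof -
  have cf: "continuous_on UNIV f"
    by (rule lipschitz_on_continuous_on[of L]) (use lip \<open>L > 0\<close> in \<open>auto simp: lipschitz_on_def dist_norm\<close>)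
  \<comment> \<open>Integration starts at \<open>-\<tau>\<close> to avoid oriented integrals for
    negative times; subtracting \<open>I g 0\<close> in \<open>S\<close> restores the initial value
    at \<open>0\<close>.\<close>
  define I where "I g t = integral {-\<tau>..t} (\<lambda>s. f (apply_bcontfun g s))" for g :: "real \<Rightarrow>\<^sub>C 'a" and t
  \<comment> \<open>Clamping the time turns functions on the interval into bounded functions on the
    whole line.\<close>
  define cl where "cl t = max (-\<tau>) (min \<tau> t)" for t
  have cl: "cl t \<in> {-\<tau>..\<tau>}" for t using \<tau> by (auto simp: cl_def)
  have ccl: "continuous_on UNIV cl" unfolding cl_def by (intro continuous_intros)
  have cg: "continuous_on A (\<lambda>s. f (apply_bcontfun g s))" for A and g :: "real \<Rightarrow>\<^sub>C 'a"
    by (intro continuous_on_compose2[OF cf] continuous_on_apply_bcontfun) auto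
  have ing: "(\<lambda>s. f (apply_bcontfun g s)) integrable_on {a..b}" for a b and g :: "real \<Rightarrow>\<^sub>C 'a"
    by (intro integrable_continuous_interval cg)
  have cI: "continuous_on {-\<tau>..\<tau>} (I g)" for g
    unfolding I_def by (intro indefinite_integral_continuous_1 ing)
  define S where "S g t = x + I g (cl t) - I g 0" for g t
  have cS: "continuous_on UNIV (S g)" for g
    unfolding S_def using cl by (intro continuous_intros continuous_on_compose2[OF cI ccl]) auto
  have Sb: "S g \<in> bcontfun" for g
  proof -
    have "bounded (I g ` {-\<tau>..\<tau>})"
      by (intro compact_imp_bounded compact_continuous_image cI compact_Icc)
    then obtain B where "\<forall>t\<in>{-\<tau>..\<tau>}. norm (I g t) \<le> B" by (auto simp: bounded_iff)
    then have B: "norm (I g (cl t)) \<le> B" for t using cl[of t] by blast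
    have "norm (S g t) \<le> norm x + B + norm (I g 0)" for t
      unfolding S_def using B[of t] norm_triangle_ineq[of x "I g (cl t)"]
        norm_triangle_ineq4[of "x + I g (cl t)" "I g 0"] by linarith
    then show ?thesis using cS bcontfun_normI by blast
  qed
  define T where "T g = Bcontfun (S g)" for g
  have T: "apply_bcontfun (T g) = S g" for g
    unfolding T_def using Sb Bcontfun_inverse by blast
  have dI: "norm (I g t - I h t) \<le> (L * dist g h) * (2 * \<tau>)" if "t \<in> {-\<tau>..\<tau>}" for g h t
  proof -
    have "I g t - I h t = integral {-\<tau>..t} (\<lambda>s. f (apply_bcontfun g s) - f (apply_bcontfun h s))"
      unfolding I_def by (intro Henstock_Kurzweil_Integration.integral_diff[symmetric] ing)
    also have "norm \<dots> \<le> (L * dist g h) * (t - (-\<tau>))"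
    proof (rule integral_bound)
      show "norm (f (apply_bcontfun g s) - f (apply_bcontfun h s)) \<le> L * dist g h" for s
        using lip[of "apply_bcontfun g s" "apply_bcontfun h s"] dist_bounded[of g s h] \<open>L > 0\<close>
        by (smt (verit) dist_norm mult_left_mono)
    qed (use that in \<open>auto intro!: continuous_intros cg\<close>)
    also have "\<dots> \<le> (L * dist g h) * (2 * \<tau>)"
      using that \<open>L > 0\<close> by (intro mult_left_mono) auto
    finally show ?thesis .
  qed
  have contr: "dist (T g) (T h) \<le> (1/2) * dist g h" for g h
  proof (rule dist_bound)
    fix t
    have "dist (apply_bcontfun (T g) t) (apply_bcontfun (T h) t)
        = norm ((I g (cl t) - I h (cl t)) - (I g 0 - I h 0))"
      by (simp add: T S_def dist_norm algebra_simps)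
    also have "\<dots> \<le> norm (I g (cl t) - I h (cl t)) + norm (I g 0 - I h 0)" by (rule norm_triangle_ineq4)
    \<comment> \<open>Each of the two integrals contributes \<open>2 * L * \<tau>\<close>, so
      \<open>8 * L * \<tau> \<le> 1\<close> yields the contraction factor
      \<open>1/2\<close>.\<close>
    also have "\<dots> \<le> (L * dist g h) * (2 * \<tau>) + (L * dist g h) * (2 * \<tau>)"
      using cl[of t] \<tau> by (intro add_mono dI) auto
    also have "\<dots> = (4 * L * \<tau>) * dist g h" by simp
    also have "\<dots> \<le> 1/2 * dist g h"
      using \<tau> by (intro mult_right_mono) auto
    finally show "dist (apply_bcontfun (T g) t) (apply_bcontfun (T h) t) \<le> (1/2) * dist g h" .
  qed
  obtain g where g: "T g = g"
    using banach_fix_type[of "1/2" T] contr by auto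
  define \<gamma> where "\<gamma> = apply_bcontfun g"
  have \<gamma>: "\<gamma> t = x + I g t - I g 0" if "t \<in> {-\<tau>..\<tau>}" for t
    using that T[of g] g by (auto simp: \<gamma>_def S_def cl_def)
  have "(\<gamma> has_vector_derivative f (\<gamma> t)) (at t within {-\<tau>..\<tau>})" if t: "t \<in> {-\<tau>..\<tau>}" for t
  proof -
    have "((\<lambda>t. integral {-\<tau>..t} (\<lambda>s. f (apply_bcontfun g s))) has_vector_derivative f (apply_bcontfun g t)) (at t within {-\<tau>..\<tau>})"
      by (rule integral_has_vector_derivative[OF cg t])
    then have "((\<lambda>t. x + I g t - I g 0) has_vector_derivative f (\<gamma> t)) (at t within {-\<tau>..\<tau>})"
      unfolding I_def[symmetric] \<gamma>_def by (auto intro!: derivative_eq_intros)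
    then show ?thesis
      by (rule has_vector_derivative_transform[OF t, rotated]) (simp add: \<gamma>)
  qed
  moreover have "\<gamma> 0 = x" using \<gamma>[of 0] \<tau> by auto
  ultimately show ?thesis by blast
qed

text \<open>Both signs of \<open>t - s\<close> are covered, for flows run backwards: the bound makes
  \<open>f t * exp (- K * t)\<close> nonincreasing and \<open>f t * exp (K * t)\<close>
  nondecreasing.\<close>

lemma real_gronwall:
  fixes f f' :: "real \<Rightarrow> real"
  assumes deriv: "\<And>t. t \<in> {a..b} \<Longrightarrow> (f has_real_derivative f' t) (at t within {a..b})"
    and bound: "\<And>t. t \<in> {a..b} \<Longrightarrow> \<bar>f' t\<bar> \<le> K * f t"
    and "s \<in> {a..b}" "t \<in> {a..b}"
  shows "f t \<le> exp (K * \<bar>t - s\<bar>) * f s"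
proof -
  have deriv_at: "(f has_real_derivative f' x) (at x)" if "a < x" "x < b" for x
    using deriv[of x] that by (metis at_within_Icc_at atLeastAtMost_iff less_imp_le)
  have cont: "continuous_on {a..b} f"
    using deriv by (meson DERIV_continuous continuous_on_eq_continuous_within)
  show ?thesis
  proof (cases "s \<le> t")
    case True
    have "f t * exp (- K * t) \<le> f s * exp (- K * s)"
    proof (rule DERIV_nonpos_imp_decreasing_open[OF True])
      fix x assume x: "s < x" "x < t"
      then have x': "a < x" "x < b" using assms by auto
      have "((\<lambda>t. f t * exp (- K * t)) has_real_derivative (f' x - K * f x) * exp (- K * x)) (at x)"
        by (rule derivative_eq_intros deriv_at[OF x'] refl | simp add: algebra_simps)+
      moreover have "(f' x - K * f x) * exp (- K * x) \<le> 0"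
        using bound[of x] x' by (intro mult_nonpos_nonneg) auto
      ultimately show "\<exists>y. ((\<lambda>t. f t * exp (- K * t)) has_real_derivative y) (at x) \<and> y \<le> 0" by blast
    next
      show "continuous_on {s..t} (\<lambda>t. f t * exp (- K * t))"
        using assms by (intro continuous_intros continuous_on_subset[OF cont]) auto
    qed
    then show ?thesis using True by (simp add: exp_diff exp_minus field_simps)
  next
    case False
    then have ts: "t \<le> s" by simp
    have "f t * exp (K * t) \<le> f s * exp (K * s)"
    proof (rule DERIV_nonneg_imp_increasing_open[OF ts])
      fix x assume x: "t < x" "x < s"
      then have x': "a < x" "x < b" using assms by auto
      have "((\<lambda>t. f t * exp (K * t)) has_real_derivative (f' x + K * f x) * exp (K * x)) (at x)"
        by (rule derivative_eq_intros deriv_at[OF x'] refl | simp add: algebra_simps)+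
      moreover have "(f' x + K * f x) * exp (K * x) \<ge> 0"
        using bound[of x] x' by (intro mult_nonneg_nonneg) auto
      ultimately show "\<exists>y. ((\<lambda>t. f t * exp (K * t)) has_real_derivative y) (at x) \<and> 0 \<le> y" by blast
    next
      show "continuous_on {t..s} (\<lambda>t. f t * exp (K * t))"
        using assms by (intro continuous_intros continuous_on_subset[OF cont]) auto
    qed
    then show ?thesis using False by (simp add: exp_diff exp_minus field_simps)
  qed
qed

lemma ode_stability:
  fixes V :: "'a::real_inner \<Rightarrow> 'a"
  assumes lip: "\<And>x y. x \<in> X \<Longrightarrow> y \<in> X \<Longrightarrow> norm (V x - V y) \<le> L * norm (x - y)"
    and \<gamma>: "\<And>t. t \<in> {a..b} \<Longrightarrow> \<gamma> t \<in> X \<and> (\<gamma> has_vector_derivative V (\<gamma> t)) (at t within {a..b})"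
    and \<eta>: "\<And>t. t \<in> {a..b} \<Longrightarrow> \<eta> t \<in> X \<and> (\<eta> has_vector_derivative V (\<eta> t)) (at t within {a..b})"
    and st: "s \<in> {a..b}" "t \<in> {a..b}"
  shows "norm (\<gamma> t - \<eta> t) \<le> exp (L * \<bar>t - s\<bar>) * norm (\<gamma> s - \<eta> s)"
proof -
  let ?d = "\<lambda>t. \<gamma> t - \<eta> t"
  \<comment> \<open>The squared distance is used because the norm is not differentiable where the
    curves meet.\<close>
  have "(?d t \<bullet> ?d t) \<le> exp (2 * L * \<bar>t - s\<bar>) * (?d s \<bullet> ?d s)"
  proof (rule real_gronwall[OF _ _ st])
    fix r assume r: "r \<in> {a..b}"
    show "((\<lambda>t. ?d t \<bullet> ?d t) has_real_derivative 2 * (?d r \<bullet> (V (\<gamma> r) - V (\<eta> r)))) (at r within {a..b})"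
      using \<gamma>[OF r] \<eta>[OF r] unfolding has_real_derivative_iff_has_vector_derivative has_vector_derivative_def
      by (auto intro!: derivative_eq_intros simp: inner_commute algebra_simps fun_eq_iff)
    have "\<bar>?d r \<bullet> (V (\<gamma> r) - V (\<eta> r))\<bar> \<le> norm (?d r) * norm (V (\<gamma> r) - V (\<eta> r))"
      by (rule Cauchy_Schwarz_ineq2)
    also have "\<dots> \<le> norm (?d r) * (L * norm (?d r))"
      using \<gamma>[OF r] \<eta>[OF r] by (intro mult_left_mono lip) auto
    finally show "\<bar>2 * (?d r \<bullet> (V (\<gamma> r) - V (\<eta> r)))\<bar> \<le> 2 * L * (?d r \<bullet> ?d r)"
      by (simp add: power2_norm_eq_inner[symmetric] power2_eq_square abs_mult algebra_simps)
  qed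
  then have "(norm (?d t))\<^sup>2 \<le> (exp (L * \<bar>t - s\<bar>) * norm (?d s))\<^sup>2"
    by (simp add: power2_norm_eq_inner power_mult_distrib exp_double[symmetric] mult.assoc)
  then show ?thesis by (rule power2_le_imp_le) simp
qed

text \<open>The extended field is globally Lipschitz, which gives a common interval of existence; it
  is orthogonal to the position vector, so the norm is conserved, and on the sphere it coincides
  with \<open>V\<close>.\<close>

lemma sphere_local_flow:
  fixes V :: "'a::euclidean_space \<Rightarrow> 'a"
  assumes lip: "\<And>x y. x \<in> sphere 0 1 \<Longrightarrow> y \<in> sphere 0 1 \<Longrightarrow> norm (V x - V y) \<le> L * norm (x - y)"
    and tangent: "\<And>x. x \<in> sphere 0 1 \<Longrightarrow> x \<bullet> V x = 0"
  shows "\<exists>\<tau> \<Phi>. \<tau> > 0 \<and> (\<forall>x\<in>sphere 0 1. \<Phi> 0 x = x \<and> (\<forall>t\<in>{-\<tau>..\<tau>}. \<Phi> t x \<in> sphere 0 1 \<and>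
            ((\<lambda>t. \<Phi> t x) has_vector_derivative V (\<Phi> t x)) (at t within {-\<tau>..\<tau>})))"
proof -
  define L' where "L' = max L 0"
  have lip': "\<And>x y. x \<in> sphere 0 1 \<Longrightarrow> y \<in> sphere 0 1 \<Longrightarrow> norm (V x - V y) \<le> L' * norm (x - y)"
    using lip by (smt (verit) L'_def max.cobounded1 mult_right_mono norm_ge_zero)
  have "continuous_on (sphere 0 1) V"
    by (rule lipschitz_on_continuous_on[of L']) (use lip' in \<open>auto simp: lipschitz_on_def dist_norm L'_def\<close>)
  then have "bounded (V ` sphere 0 1)"
    by (intro compact_imp_bounded compact_continuous_image) auto
  then obtain M where M: "M > 0" "\<And>x. x \<in> sphere 0 1 \<Longrightarrow> norm (V x) \<le> M" unfolding bounded_pos by auto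
  define K where "K = M + 2 * L'"
  have K: "K > 0" using M by (auto simp: K_def L'_def)
  have hl: "norm (homogeneous_extension V x - homogeneous_extension V y) \<le> K * norm (x - y)" for x y
    unfolding K_def by (rule homogeneous_extension_lipschitz[OF lip' M(2)]) (use M in \<open>auto simp: L'_def\<close>)
  have ht: "x \<bullet> homogeneous_extension V x = 0" for x
  proof (cases "x = 0")
    case False
    then have "sgn x \<bullet> V (sgn x) = 0" by (intro tangent) (simp add: norm_sgn)
    then show ?thesis using False by (simp add: homogeneous_extension_def sgn_div_norm)
  qed simp
  define \<tau> where "\<tau> = 1 / (8 * K)"
  have \<tau>: "\<tau> > 0" "8 * K * \<tau> \<le> 1" using K by (auto simp: \<tau>_def)
  have "\<forall>x. \<exists>\<gamma>. \<gamma> 0 = x \<and> (\<forall>t\<in>{-\<tau>..\<tau>}. (\<gamma> has_vector_derivative homogeneous_extension V (\<gamma> t)) (at t within {-\<tau>..\<tau>}))"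
    using local_ode_solution[OF hl K \<tau>] by blast
  from choice[OF this] obtain \<Gamma> where \<Gamma>: "\<And>x. \<Gamma> x 0 = x"
    "\<And>x t. t \<in> {-\<tau>..\<tau>} \<Longrightarrow> (\<Gamma> x has_vector_derivative homogeneous_extension V (\<Gamma> x t)) (at t within {-\<tau>..\<tau>})"
    by blast
  have sph: "\<Gamma> x t \<in> sphere 0 1" if x: "x \<in> sphere 0 1" and t: "t \<in> {-\<tau>..\<tau>}" for x t
  proof -
    have "(\<Gamma> x t \<bullet> \<Gamma> x t) = (\<Gamma> x 0 \<bullet> \<Gamma> x 0)"
    proof (rule has_derivative_zero_unique[where s = "{-\<tau>..\<tau>}" and f = "\<lambda>t. \<Gamma> x t \<bullet> \<Gamma> x t" and x = t and y = 0])
      fix r assume r: "r \<in> {-\<tau>..\<tau>}"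
      note D = \<Gamma>(2)[OF r, of x, unfolded has_vector_derivative_def]
      have "((\<lambda>t. \<Gamma> x t \<bullet> \<Gamma> x t) has_derivative (\<lambda>h. \<Gamma> x r \<bullet> (h *\<^sub>R homogeneous_extension V (\<Gamma> x r))
          + (h *\<^sub>R homogeneous_extension V (\<Gamma> x r)) \<bullet> \<Gamma> x r)) (at r within {-\<tau>..\<tau>})"
        by (rule has_derivative_inner[OF D D])
      then show "((\<lambda>t. \<Gamma> x t \<bullet> \<Gamma> x t) has_derivative (\<lambda>h. 0)) (at r within {-\<tau>..\<tau>})"
        using ht[of "\<Gamma> x r"] by (simp add: inner_commute[of "homogeneous_extension V (\<Gamma> x r)"])
    qed (use t \<tau> in auto)
    then have "(norm (\<Gamma> x t))\<^sup>2 = 1" using x \<Gamma>(1)[of x] by (simp add: dot_square_norm)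
    then show ?thesis using norm_ge_zero[of "\<Gamma> x t"] by (auto simp: power2_eq_1_iff)
  qed
  have "((\<lambda>t. \<Gamma> x t) has_vector_derivative V (\<Gamma> x t)) (at t within {-\<tau>..\<tau>})"
    if x: "x \<in> sphere 0 1" and t: "t \<in> {-\<tau>..\<tau>}" for x t
    using \<Gamma>(2)[OF t, of x] sph[OF x t] by (simp add: homogeneous_extension_def sgn_div_norm)
  with \<tau> \<Gamma>(1) sph show ?thesis
    by (intro exI[of _ \<tau>] exI[of _ "\<lambda>t x. \<Gamma> x t"]) blast
qed

section \<open>Reachable maps\<close>

lemma has_integral_concat:
  fixes f g :: "real \<Rightarrow> 'a::banach"
  assumes f: "(f has_integral I) {0..a}" and g: "(g has_integral J) {0..b}" and "0 \<le> a" "0 \<le> b"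
  shows "((\<lambda>s. if s \<le> a then f s else g (s - a)) has_integral (I + J)) {0..a + b}"
proof (rule has_integral_combine[where c = a])
  show "((\<lambda>s. if s \<le> a then f s else g (s - a)) has_integral I) {0..a}"
    by (rule has_integral_eq[OF _ f]) auto
  have "((\<lambda>s. g (s - a)) has_integral J) {a..a + b}"
    using has_integral_affinity[of g J 0 b 1 "-a"] g by (simp add: add.commute)
  \<comment> \<open>At \<open>s = a\<close> the glued function takes its value from
    \<open>f\<close>, so it agrees with the shifted \<open>g\<close> only up to one point.\<close>
  then show "((\<lambda>s. if s \<le> a then f s else g (s - a)) has_integral J) {a..a + b}"
    by (rule has_integral_spike_finite[of "{a}", rotated 2]) auto
qed (use assms in auto)

lemma absolutely_integrable_concat:
  fixes f g :: "real \<Rightarrow> 'a::euclidean_space"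
  assumes f: "f absolutely_integrable_on {0..a}" and g: "g absolutely_integrable_on {0..b}"
    and "0 \<le> a" "0 \<le> b"
  shows "(\<lambda>s. if s \<le> a then f s else g (s - a)) absolutely_integrable_on {0..a + b}"
proof (rule absolutely_integrable_onI)
  obtain I J I' J' where "(f has_integral I) {0..a}" "(g has_integral J) {0..b}"
    "((\<lambda>s. norm (f s)) has_integral I') {0..a}" "((\<lambda>s. norm (g s)) has_integral J') {0..b}"
    using f g unfolding absolutely_integrable_on_def by (meson has_integral_integral)
  note IJ = this
  show "(\<lambda>s. if s \<le> a then f s else g (s - a)) integrable_on {0..a + b}"
    using has_integral_concat[OF IJ(1,2) assms(3,4)] by blast
  have "(\<lambda>s. norm (if s \<le> a then f s else g (s - a))) = (\<lambda>s. if s \<le> a then norm (f s) else norm (g (s - a)))"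
    by auto
  then show "(\<lambda>s. norm (if s \<le> a then f s else g (s - a))) integrable_on {0..a + b}"
    using has_integral_concat[OF IJ(3,4) assms(3,4)] by auto
qed

lemma trajectoryD:
  assumes "trajectory F T u \<gamma>" "t \<in> {0..T}"
  shows "\<gamma> t \<in> S2" "((\<lambda>s. F (u s) (\<gamma> s)) has_integral (\<gamma> t - \<gamma> 0)) {0..t}"
  using assms by (simp_all add: trajectory_def)

lemma trajectory_concat:
  assumes \<gamma>: "trajectory F a u \<gamma>" and \<eta>: "trajectory F b v \<eta>" and eq: "\<gamma> a = \<eta> 0"
    and "0 \<le> a" "0 \<le> b"
  shows "trajectory F (a + b) (\<lambda>s. if s \<le> a then u s else v (s - a)) (\<lambda>s. if s \<le> a then \<gamma> s else \<eta> (s - a))"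
proof -
  let ?u = "\<lambda>s. if s \<le> a then u s else v (s - a)" and ?\<gamma> = "\<lambda>s. if s \<le> a then \<gamma> s else \<eta> (s - a)"
  have F: "(\<lambda>s. F (?u s) (?\<gamma> s)) = (\<lambda>s. if s \<le> a then F (u s) (\<gamma> s) else F (v (s - a)) (\<eta> (s - a)))"
    by auto
  show ?thesis unfolding trajectory_def
  proof (intro conjI ballI)
    fix t assume "t \<in> {0..a + b}"
    then show "?\<gamma> t \<in> S2" using trajectoryD(1)[OF \<gamma>, of t] trajectoryD(1)[OF \<eta>, of "t - a"] by auto
  next
    show "(\<lambda>s. F (?u s) (?\<gamma> s)) absolutely_integrable_on {0..a + b}" unfolding F
      by (rule absolutely_integrable_concat) (use assms in \<open>simp_all add: trajectory_def\<close>)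
  next
    fix t assume t: "t \<in> {0..a + b}"
    show "((\<lambda>s. F (?u s) (?\<gamma> s)) has_integral ?\<gamma> t - ?\<gamma> 0) {0..t}"
    proof (cases "t \<le> a")
      case True
      then have "((\<lambda>s. F (u s) (\<gamma> s)) has_integral \<gamma> t - \<gamma> 0) {0..t}"
        using trajectoryD(2)[OF \<gamma>, of t] t by simp
      then have "((\<lambda>s. F (?u s) (?\<gamma> s)) has_integral \<gamma> t - \<gamma> 0) {0..t}"
        by (rule has_integral_eq[rotated]) (use True in auto)
      then show ?thesis using True \<open>0 \<le> a\<close> by simp
    next
      case False
      have "((\<lambda>s. F (u s) (\<gamma> s)) has_integral \<gamma> a - \<gamma> 0) {0..a}"
        "((\<lambda>s. F (v s) (\<eta> s)) has_integral \<eta> (t - a) - \<eta> 0) {0..t - a}"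
        using trajectoryD(2)[OF \<gamma>, of a] trajectoryD(2)[OF \<eta>, of "t - a"] t False \<open>0 \<le> a\<close> by auto
      from has_integral_concat[OF this] show ?thesis
        using False \<open>0 \<le> a\<close> eq unfolding F by simp
    qed
  qed
qed

text \<open>Quantifying over every horizon makes composition possible, each factor taking half of
  the time, and covers the arbitrary \<open>T\<close> of both controllability notions. One control
  has to serve all initial points at once.\<close>

definition reaches :: "('c::euclidean_space \<Rightarrow> real ^ 3 \<Rightarrow> real ^ 3) \<Rightarrow> (real ^ 3 \<Rightarrow> real ^ 3) \<Rightarrow> bool" where
  "reaches F g \<longleftrightarrow> (\<forall>T>0. \<exists>u P. u absolutely_integrable_on {0..T} \<and>
     (\<forall>x\<in>S2. P 0 x = x \<and> trajectory F T u (\<lambda>t. P t x) \<and> P T x = g x))"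

lemma reaches_sphere:
  assumes "reaches F g" "x \<in> S2"
  shows "g x \<in> S2"
proof -
  obtain u P where "trajectory F 1 u (\<lambda>t. P t x) \<and> P 1 x = g x"
    using assms unfolding reaches_def by (meson zero_less_one)
  then show ?thesis unfolding trajectory_def by (metis atLeastAtMost_iff order_refl zero_le_one)
qed

lemma reaches_comp:
  assumes f: "reaches F f" and g: "reaches F g"
  shows "reaches F (f \<circ> g)"
  unfolding reaches_def
proof (intro allI impI)
  fix T :: real assume "T > 0"
  then have T: "T/2 > 0" by simp
  have half: "T/2 + T/2 = T" by simp
  from g[unfolded reaches_def, rule_format, OF T]
  obtain u P where P: "u absolutely_integrable_on {0..T/2}"
     "\<And>x. x \<in> S2 \<Longrightarrow> P 0 x = x \<and> trajectory F (T/2) u (\<lambda>t. P t x) \<and> P (T/2) x = g x"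
    by blast
  from f[unfolded reaches_def, rule_format, OF T]
  obtain v Q where Q: "v absolutely_integrable_on {0..T/2}"
     "\<And>x. x \<in> S2 \<Longrightarrow> Q 0 x = x \<and> trajectory F (T/2) v (\<lambda>t. Q t x) \<and> Q (T/2) x = f x"
    by blast
  let ?w = "\<lambda>s. if s \<le> T/2 then u s else v (s - T/2)"
  let ?R = "\<lambda>s x. if s \<le> T/2 then P s x else Q (s - T/2) (g x)"
  have w: "?w absolutely_integrable_on {0..T}"
    using absolutely_integrable_concat[OF P(1) Q(1)] T unfolding half by simp
  have R: "?R 0 x = x \<and> trajectory F T ?w (\<lambda>t. ?R t x) \<and> ?R T x = (f \<circ> g) x"
    if x: "x \<in> S2" for x
  proof -
    have "g x \<in> S2" using reaches_sphere[OF g x] .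
    note Px = P(2)[OF x] and Qx = Q(2)[OF this]
    have "trajectory F (T/2 + T/2) ?w (\<lambda>t. ?R t x)"
      by (rule trajectory_concat) (use Px Qx T in simp_all)
    then show ?thesis using Px Qx T unfolding half by simp
  qed
  show "\<exists>u P. u absolutely_integrable_on {0..T} \<and>
     (\<forall>x\<in>S2. P 0 x = x \<and> trajectory F T u (\<lambda>t. P t x) \<and> P T x = (f \<circ> g) x)"
    by (rule exI[of _ ?w], rule exI[of _ ?R], intro conjI w ballI R)
qed

text \<open>Stretching the unit-time flow to the length \<open>T\<close> divides velocities by
  \<open>T\<close>, which homogeneity in the control value turns into the control
  \<open>(1/T) *\<^sub>R u\<close>.\<close>

lemma reaches_constant_control:
  assumes lin: "\<And>r x. F (r *\<^sub>R u) x = r *\<^sub>R F u x"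
    and cont: "continuous_on S2 (F u)"
    and \<Phi>: "\<And>x. x \<in> S2 \<Longrightarrow> \<Phi> 0 x = x"
      "\<And>x s. x \<in> S2 \<Longrightarrow> s \<in> {0..1} \<Longrightarrow> \<Phi> s x \<in> S2 \<and> ((\<lambda>s. \<Phi> s x) has_vector_derivative F u (\<Phi> s x)) (at s within {0..1})"
  shows "reaches F (\<Phi> 1)"
  unfolding reaches_def
proof (intro allI impI)
  fix T :: real assume T: "T > 0"
  let ?u = "\<lambda>s::real. (1/T) *\<^sub>R u" and ?P = "\<lambda>s. \<Phi> (s/T)"
  have "trajectory F T ?u (\<lambda>t. ?P t x)" if x: "x \<in> S2" for x
  proof -
    have unit: "s / T \<in> {0..1}" if "s \<in> {0..T}" for s using that T by auto
    have D: "((\<lambda>t. ?P t x) has_vector_derivative F (?u s) (?P s x)) (at s within {0..T})" if s: "s \<in> {0..T}" for s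
    proof -
      have 1: "((\<lambda>s. s / T) has_vector_derivative (1/T)) (at s within {0..T})"
        using T unfolding has_real_derivative_iff_has_vector_derivative[symmetric]
        by (auto intro!: derivative_eq_intros)
      have "((\<lambda>s. \<Phi> s x) has_vector_derivative F u (\<Phi> (s/T) x)) (at (s/T) within (\<lambda>s. s/T) ` {0..T})"
        by (rule has_vector_derivative_within_subset[OF conjunct2[OF \<Phi>(2)[OF x unit[OF s]]]]) (use unit in auto)
      from vector_diff_chain_within[OF 1 this] show ?thesis
        by (simp add: o_def lin)
    qed
    have S: "?P s x \<in> S2" if "s \<in> {0..T}" for s using \<Phi>(2)[OF x unit[OF that]] by blast
    have cP: "continuous_on {0..T} (\<lambda>s. ?P s x)"
      using D by (meson continuous_on_eq_continuous_within has_vector_derivative_continuous)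
    have "continuous_on {0..T} (\<lambda>s. F (?u s) (?P s x))"
      unfolding lin by (intro continuous_intros continuous_on_compose2[OF cont cP]) (use S in auto)
    then have "(\<lambda>s. F (?u s) (?P s x)) absolutely_integrable_on {0..T}"
      by (rule absolutely_integrable_continuous_real)
    moreover have "((\<lambda>s. F (?u s) (?P s x)) has_integral ?P t x - ?P 0 x) {0..t}" if t: "t \<in> {0..T}" for t
      by (rule fundamental_theorem_of_calculus)
        (use t in \<open>auto intro!: has_vector_derivative_within_subset[OF D]\<close>)
    ultimately show ?thesis unfolding trajectory_def using S by auto
  qed
  then show "\<exists>u P. u absolutely_integrable_on {0..T} \<and>
     (\<forall>x\<in>S2. P 0 x = x \<and> trajectory F T u (\<lambda>t. P t x) \<and> P T x = \<Phi> 1 x)"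
    using T \<Phi>(1) by (intro exI[of _ ?u] exI[of _ ?P]) (auto intro!: absolutely_integrable_continuous_real continuous_intros)
qed

section \<open>Second-order expansions along the sphere\<close>

text \<open>
  \<open>DW x\<close> need only be a derivative of \<open>W\<close> along the sphere, so fields may be replaced by any other extension
  from the sphere; only values on the sphere enter.
\<close>

definition taylor2 :: "(real ^ 3 \<Rightarrow> 'b::real_normed_vector) \<Rightarrow> (real ^ 3 \<Rightarrow> real ^ 3 \<Rightarrow> 'b) \<Rightarrow> real \<Rightarrow> bool" where
  "taylor2 W DW C \<longleftrightarrow> (\<forall>x. linear (DW x)) \<and> C \<ge> 0 \<and> (\<forall>x\<in>S2. \<forall>y\<in>S2. norm (W x) \<le> C \<and>
     (\<forall>v. norm (DW x v) \<le> C * norm v \<and> norm (DW x v - DW y v) \<le> C * norm (x - y) * norm v) \<and>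
     norm (W y - W x - DW x (y - x)) \<le> C * (norm (y - x))\<^sup>2)"

definition smooth_pair :: "(real ^ 3 \<Rightarrow> 'b::real_normed_vector) \<Rightarrow> (real ^ 3 \<Rightarrow> real ^ 3 \<Rightarrow> 'b) \<Rightarrow> bool" where
  "smooth_pair W DW \<longleftrightarrow> (\<exists>C. taylor2 W DW C)"

lemma taylor2D:
  assumes "taylor2 W DW C"
  shows "linear (DW x)" "C \<ge> 0" "x \<in> S2 \<Longrightarrow> norm (W x) \<le> C" "x \<in> S2 \<Longrightarrow> norm (DW x v) \<le> C * norm v"
    "x \<in> S2 \<Longrightarrow> y \<in> S2 \<Longrightarrow> norm (DW x v - DW y v) \<le> C * norm (x - y) * norm v"
    "x \<in> S2 \<Longrightarrow> y \<in> S2 \<Longrightarrow> norm (W y - W x - DW x (y - x)) \<le> C * (norm (y - x))\<^sup>2"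
  using assms by (auto simp: taylor2_def)

lemma norm_diff_S2: "x \<in> S2 \<Longrightarrow> y \<in> S2 \<Longrightarrow> norm (x - y) \<le> 2"
  using norm_triangle_ineq4[of x y] by simp

text \<open>Chords of the sphere have length at most 2, so the quadratic remainder contributes
  \<open>2 * C\<close> and the linear term \<open>C\<close>.\<close>

lemma taylor2_lipschitz:
  assumes W: "taylor2 W DW C" and x: "x \<in> S2" "y \<in> S2"
  shows "norm (W x - W y) \<le> 3 * C * norm (x - y)"
proof -
  have "norm (W x - W y) = norm ((W x - W y - DW y (x - y)) + DW y (x - y))" by simp
  also have "\<dots> \<le> C * (norm (x - y))\<^sup>2 + C * norm (x - y)"
    using taylor2D[OF W] x by (intro norm_triangle_le add_mono) auto
  also have "(norm (x - y))\<^sup>2 \<le> 2 * norm (x - y)"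
    using norm_diff_S2[OF x] by (simp add: power2_eq_square mult_right_mono)
  then have "C * (norm (x - y))\<^sup>2 \<le> C * (2 * norm (x - y))"
    using taylor2D(2)[OF W] by (rule mult_left_mono)
  finally show ?thesis by simp
qed

lemma taylor2_mono: "taylor2 W DW C \<Longrightarrow> C \<le> K \<Longrightarrow> taylor2 W DW K"
proof -
  assume W: "taylor2 W DW C" and CK: "C \<le> K"
  have "C * a \<le> K * a" if "a \<ge> 0" for a using CK that by (rule mult_right_mono)
  then show ?thesis
    using taylor2D[OF W] CK unfolding taylor2_def
    by (smt (verit, best) mult.assoc mult_nonneg_nonneg norm_ge_zero zero_le_power)
qed

lemma smooth_pair_const: "smooth_pair (\<lambda>x. w) (\<lambda>x v. 0)"
  unfolding smooth_pair_def taylor2_def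
  by (rule exI[of _ "norm w"]) (auto simp: linear_iff)

lemma smooth_pair_linear:
  assumes "bounded_linear L"
  shows "smooth_pair L (\<lambda>x. L)"
proof -
  interpret bounded_linear L by fact
  obtain K where "K \<ge> 0" "\<And>x. norm (L x) \<le> norm x * K" using nonneg_bounded by blast
  then have b: "norm (L x) \<le> K * norm x" for x by (simp add: mult.commute)
  have "norm (L x) \<le> K" if "x \<in> S2" for x using b[of x] that by simp
  then have "taylor2 L (\<lambda>x. L) K"
    using b \<open>K \<ge> 0\<close> unfolding taylor2_def by (auto simp: linear_axioms diff)
  then show ?thesis by (auto simp: smooth_pair_def)
qed

lemma smooth_pair_add:
  assumes "smooth_pair f Df" "smooth_pair g Dg"
  shows "smooth_pair (\<lambda>x. f x + g x) (\<lambda>x v. Df x v + Dg x v)"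
proof -
  obtain C D where C: "taylor2 f Df C" and D: "taylor2 g Dg D" using assms by (auto simp: smooth_pair_def)
  have "taylor2 (\<lambda>x. f x + g x) (\<lambda>x v. Df x v + Dg x v) (C + D)"
    unfolding taylor2_def distrib_right
  proof (intro conjI ballI allI)
    fix x show "linear (\<lambda>v. Df x v + Dg x v)" by (intro linear_compose_add taylor2D(1)[OF C] taylor2D(1)[OF D])
  next
    show "0 \<le> C + D" using taylor2D(2)[OF C] taylor2D(2)[OF D] by simp
  next
    fix x y v assume xy: "x \<in> S2" "y \<in> S2"
    show "norm (f x + g x) \<le> C + D"
      using taylor2D(3)[OF C xy(1)] taylor2D(3)[OF D xy(1)] by (rule norm_triangle_mono)
    show "norm (Df x v + Dg x v) \<le> C * norm v + D * norm v"
      using taylor2D(4)[OF C xy(1)] taylor2D(4)[OF D xy(1)] by (rule norm_triangle_mono)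
    have "Df x v + Dg x v - (Df y v + Dg y v) = (Df x v - Df y v) + (Dg x v - Dg y v)" by simp
    then show "norm (Df x v + Dg x v - (Df y v + Dg y v)) \<le> C * norm (x - y) * norm v + D * norm (x - y) * norm v"
      using norm_triangle_mono[OF taylor2D(5)[OF C xy] taylor2D(5)[OF D xy]] by metis
    have "f y + g y - (f x + g x) - (Df x (y - x) + Dg x (y - x))
        = (f y - f x - Df x (y - x)) + (g y - g x - Dg x (y - x))" by simp
    then show "norm (f y + g y - (f x + g x) - (Df x (y - x) + Dg x (y - x))) \<le> C * (norm (y - x))\<^sup>2 + D * (norm (y - x))\<^sup>2"
      using norm_triangle_mono[OF taylor2D(6)[OF C xy] taylor2D(6)[OF D xy]] by metis
  qed
  then show ?thesis by (auto simp: smooth_pair_def)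
qed

lemma smooth_pair_bilinear:
  assumes "bounded_bilinear pr" and "smooth_pair f Df" "smooth_pair g Dg"
  shows "smooth_pair (\<lambda>x. pr (f x) (g x)) (\<lambda>x v. pr (f x) (Dg x v) + pr (Df x v) (g x))"
proof -
  interpret pr: bounded_bilinear pr by fact
  obtain K where K: "K \<ge> 0" "\<And>a b. norm (pr a b) \<le> norm a * norm b * K" using pr.nonneg_bounded by blast
  obtain C D where C: "taylor2 f Df C" and D: "taylor2 g Dg D" using assms by (auto simp: smooth_pair_def)
  have C0: "C \<ge> 0" and D0: "D \<ge> 0" using taylor2D(2)[OF C] taylor2D(2)[OF D] by auto
  have pb: "norm (pr a b) \<le> r * s * K" if "norm a \<le> r" "norm b \<le> s" for a b r s
  proof -
    have "norm a * norm b \<le> r * s" using that by (intro mult_mono) (auto intro: order_trans[OF norm_ge_zero])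
    then show ?thesis using K(2)[of a b] mult_right_mono[OF _ K(1)] by fastforce
  qed
  let ?E = "C * D * K"
  have E: "?E \<ge> 0" using C0 D0 K by auto
  \<comment> \<open>The four estimates need the factors 1, 2, 8 and 11. The 8 is
    \<open>1 + 3 + 3 + 1\<close> and the 11 is \<open>1 + 1 + 9\<close>, the 3s being the Lipschitz
    constants from \<open>taylor2_lipschitz\<close>.\<close>
  have "taylor2 (\<lambda>x. pr (f x) (g x)) (\<lambda>x v. pr (f x) (Dg x v) + pr (Df x v) (g x)) (11 * ?E)"
    unfolding taylor2_def
  proof (intro conjI ballI allI)
    fix x
    interpret f: linear "Df x" by (rule taylor2D(1)[OF C])
    interpret g: linear "Dg x" by (rule taylor2D(1)[OF D])
    show "linear (\<lambda>v. pr (f x) (Dg x v) + pr (Df x v) (g x))"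
      by (rule linearI) (simp_all add: f.add g.add f.scale g.scale pr.add_left pr.add_right pr.scaleR_left pr.scaleR_right scaleR_add_right)
  next
    show "11 * ?E \<ge> 0" using E by simp
  next
    fix x y v assume xy: "x \<in> S2" "y \<in> S2"
    note C' = taylor2D(3-6)[OF C] and D' = taylor2D(3-6)[OF D]
    note lf = taylor2_lipschitz[OF C xy] and lg = taylor2_lipschitz[OF D xy]
    show "norm (pr (f x) (g x)) \<le> 11 * ?E"
      using pb[OF C'(1)[OF xy(1)] D'(1)[OF xy(1)]] E by simp
    have "norm (pr (f x) (Dg x v) + pr (Df x v) (g x)) \<le> C * (D * norm v) * K + (C * norm v) * D * K"
      by (rule norm_triangle_mono[OF pb[OF C'(1)[OF xy(1)] D'(2)[OF xy(1)]] pb[OF C'(2)[OF xy(1)] D'(1)[OF xy(1)]]])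
    also have "\<dots> = 2 * (?E * norm v)" by simp
    also have "\<dots> \<le> 11 * ?E * norm v"
      using E mult_nonneg_nonneg[OF E norm_ge_zero[of v]] by linarith
    finally show "norm (pr (f x) (Dg x v) + pr (Df x v) (g x)) \<le> 11 * ?E * norm v" .
    have "pr (f x) (Dg x v) + pr (Df x v) (g x) - (pr (f y) (Dg y v) + pr (Df y v) (g y))
       = (pr (f x) (Dg x v - Dg y v) + pr (f x - f y) (Dg y v)) + (pr (Df x v - Df y v) (g x) + pr (Df y v) (g x - g y))"
      by (simp add: pr.diff_left pr.diff_right)
    also have "norm \<dots> \<le> (C * (D * norm (x - y) * norm v) * K + (3 * C * norm (x - y)) * (D * norm v) * K)
        + ((C * norm (x - y) * norm v) * D * K + (C * norm v) * (3 * D * norm (x - y)) * K)"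
      by (intro norm_triangle_mono pb C' D' lf lg xy)
    also have "\<dots> = 8 * (?E * norm (x - y) * norm v)" by simp
    also have "\<dots> \<le> 11 * ?E * norm (x - y) * norm v"
      using mult_nonneg_nonneg[OF mult_nonneg_nonneg[OF E norm_ge_zero[of "x - y"]] norm_ge_zero[of v]] by linarith
    finally show "norm (pr (f x) (Dg x v) + pr (Df x v) (g x) - (pr (f y) (Dg y v) + pr (Df y v) (g y)))
       \<le> 11 * ?E * norm (x - y) * norm v" .
    have "pr (f y) (g y) - pr (f x) (g x) - (pr (f x) (Dg x (y - x)) + pr (Df x (y - x)) (g x))
       = pr (f x) (g y - g x - Dg x (y - x)) + pr (f y - f x - Df x (y - x)) (g x) + pr (f x - f y) (g x - g y)"
      by (simp add: pr.diff_left pr.diff_right)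
    also have "norm \<dots> \<le> C * (D * (norm (y - x))\<^sup>2) * K + (C * (norm (y - x))\<^sup>2) * D * K
        + (3 * C * norm (x - y)) * (3 * D * norm (x - y)) * K"
      by (intro norm_triangle_mono pb C' D' lf lg xy)
    also have "\<dots> = 11 * ?E * (norm (y - x))\<^sup>2" by (simp add: power2_eq_square norm_minus_commute)
    finally show "norm (pr (f y) (g y) - pr (f x) (g x) - (pr (f x) (Dg x (y - x)) + pr (Df x (y - x)) (g x)))
       \<le> 11 * ?E * (norm (y - x))\<^sup>2" .
  qed
  then show ?thesis by (auto simp: smooth_pair_def)
qed

lemma smooth_pair_continuous: "smooth_pair W DW \<Longrightarrow> continuous_on S2 W"
proof -
  assume "smooth_pair W DW"
  then obtain C where C: "taylor2 W DW C" by (auto simp: smooth_pair_def)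
  show ?thesis
    by (rule lipschitz_on_continuous_on[of "3 * C"])
      (use taylor2_lipschitz[OF C] taylor2D(2)[OF C] in \<open>auto simp: lipschitz_on_def dist_norm\<close>)
qed

lemma has_derivative_zero_dominated:
  fixes R :: "'a::real_normed_vector \<Rightarrow> 'b::real_normed_vector"
  assumes \<rho>: "(\<rho> has_derivative (\<lambda>h. 0)) (at t within I)" and "\<And>s. s \<in> I \<Longrightarrow> norm (R s) \<le> \<rho> s" "\<rho> t = 0" "R t = 0"
  shows "(R has_derivative (\<lambda>h. 0)) (at t within I)"
proof -
  have "((\<lambda>s. norm (\<rho> s - \<rho> t - 0) / norm (s - t)) \<longlongrightarrow> 0) (at t within I)"
    using \<rho> unfolding has_derivative_iff_norm by blast
  then have "((\<lambda>s. norm (R s - R t - 0) / norm (s - t)) \<longlongrightarrow> 0) (at t within I)"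
  proof (rule Lim_null_comparison[rotated])
    show "\<forall>\<^sub>F s in at t within I. norm (norm (R s - R t - 0) / norm (s - t)) \<le> norm (\<rho> s - \<rho> t - 0) / norm (s - t)"
      unfolding eventually_at_filter using assms
      by (intro always_eventually) (auto intro!: divide_right_mono order_trans[OF _ abs_ge_self])
  qed
  then show ?thesis unfolding has_derivative_iff_norm by simp
qed

lemma taylor2_chain:
  fixes \<gamma> :: "real \<Rightarrow> real ^ 3"
  assumes W: "taylor2 W DW C" and \<gamma>: "(\<gamma> has_vector_derivative \<gamma>') (at t within I)"
    and S: "\<And>s. s \<in> I \<Longrightarrow> \<gamma> s \<in> S2" and t: "t \<in> I"
  shows "((\<lambda>s. W (\<gamma> s)) has_vector_derivative DW (\<gamma> t) \<gamma>') (at t within I)"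
proof -
  let ?x = "\<gamma> t"
  let ?R = "\<lambda>s. W (\<gamma> s) - W ?x - DW ?x (\<gamma> s - ?x)"
  have lin: "bounded_linear (DW ?x)" using taylor2D(1)[OF W] by (simp add: linear_conv_bounded_linear)
  have D: "((\<lambda>s. \<gamma> s - ?x) has_derivative (\<lambda>h. h *\<^sub>R \<gamma>')) (at t within I)"
    using \<gamma> unfolding has_vector_derivative_def by (auto intro!: derivative_eq_intros)
  have "((\<lambda>s. C * ((\<gamma> s - ?x) \<bullet> (\<gamma> s - ?x))) has_derivative
      (\<lambda>h. C * ((?x - ?x) \<bullet> (h *\<^sub>R \<gamma>') + (h *\<^sub>R \<gamma>') \<bullet> (?x - ?x)))) (at t within I)"
    by (intro has_derivative_mult_right has_derivative_inner D)
  then have "((\<lambda>s. C * (norm (\<gamma> s - ?x))\<^sup>2) has_derivative (\<lambda>h. 0)) (at t within I)"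
    by (simp add: power2_norm_eq_inner)
  then have R: "(?R has_derivative (\<lambda>h. 0)) (at t within I)"
    by (rule has_derivative_zero_dominated)
      (use taylor2D(6)[OF W S[OF t] S] linear_0[OF taylor2D(1)[OF W]] in auto)
  have "((\<lambda>s. ?R s + (W ?x + DW ?x (\<gamma> s - ?x))) has_derivative (\<lambda>h. 0 + (0 + DW ?x (h *\<^sub>R \<gamma>')))) (at t within I)"
    by (intro has_derivative_add R has_derivative_const bounded_linear.has_derivative[OF lin] D)
  then show ?thesis
    unfolding has_vector_derivative_def by (simp add: linear_cmul[OF taylor2D(1)[OF W]])
qed

text \<open>\<open>DW x (V x)\<close> is the derivative of \<open>W\<close> along the flow of
  \<open>V\<close>; its Lipschitz bound replaces a bound on second derivatives. Moving the base
  point costs \<open>C * K\<close>, moving the argument \<open>3 * C * K\<close>.\<close>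

lemma taylor2_transport_lipschitz:
  assumes V: "taylor2 V DV C" and W: "taylor2 W DW K" and xy: "x \<in> S2" "y \<in> S2"
  shows "norm (DW x (V x) - DW y (V y)) \<le> 4 * C * K * norm (x - y)"
proof -
  have "DW x (V x) - DW y (V y) = (DW x (V x) - DW y (V x)) + DW y (V x - V y)"
    by (simp add: linear_diff[OF taylor2D(1)[OF W]])
  also have "norm \<dots> \<le> K * norm (x - y) * C + K * (3 * C * norm (x - y))"
  proof (rule norm_triangle_mono)
    have "norm (DW x (V x) - DW y (V x)) \<le> K * norm (x - y) * norm (V x)" by (rule taylor2D(5)[OF W xy])
    also have "\<dots> \<le> K * norm (x - y) * C"
      using taylor2D(2)[OF W] by (intro mult_left_mono taylor2D(3)[OF V xy(1)]) auto
    finally show "norm (DW x (V x) - DW y (V x)) \<le> K * norm (x - y) * C" .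
    have "norm (DW y (V x - V y)) \<le> K * norm (V x - V y)" by (rule taylor2D(4)[OF W xy(2)])
    also have "\<dots> \<le> K * (3 * C * norm (x - y))"
      using taylor2D(2)[OF W] by (intro mult_left_mono taylor2_lipschitz[OF V xy]) auto
    finally show "norm (DW y (V x - V y)) \<le> K * (3 * C * norm (x - y))" .
  qed
  finally show ?thesis by (simp add: algebra_simps)
qed

lemma vector_derivative_bound:
  fixes g :: "real \<Rightarrow> 'a::real_normed_vector"
  assumes "\<And>s. s \<in> {a..b} \<Longrightarrow> (g has_vector_derivative g' s) (at s within {a..b})"
    and "\<And>s. s \<in> {a..b} \<Longrightarrow> norm (g' s) \<le> B" and "s \<in> {a..b}" "t \<in> {a..b}"
  shows "norm (g t - g s) \<le> B * \<bar>t - s\<bar>"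
proof -
  have "norm (g t - g s) \<le> B * norm (t - s)"
  proof (rule differentiable_bound[where S = "{a..b}" and f' = "\<lambda>s h. h *\<^sub>R g' s"])
    fix x assume "x \<in> {a..b}"
    then show "onorm (\<lambda>h. h *\<^sub>R g' x) \<le> B"
      using assms(2)[of x] by (intro onorm_le) (simp add: mult.commute[of B] mult_left_mono)
  qed (use assms in \<open>auto simp: has_vector_derivative_def\<close>)
  then show ?thesis by simp
qed

section \<open>Accessible fields\<close>

lemma has_vector_derivative_id_scaleR: "((\<lambda>s. s *\<^sub>R v) has_vector_derivative 1 *\<^sub>R v) (at s within A)"
  by (auto simp: has_vector_derivative_def intro!: derivative_eq_intros)

lemma divide_cancel_factor: "c \<noteq> 0 \<Longrightarrow> d / (2 * c) * c = d / 2" for c d :: real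
  by (simp add: field_simps)

text \<open>\<open>M\<close> stands for the reachable maps. No inverses are assumed; reversibility
  enters only through flows that are reachable in both time directions.\<close>

locale sphere_monoid =
  fixes M :: "(real ^ 3 \<Rightarrow> real ^ 3) set"
  assumes id_mem: "id \<in> M"
    and comp_mem: "f \<in> M \<Longrightarrow> g \<in> M \<Longrightarrow> f \<circ> g \<in> M"
    and maps_S2: "f \<in> M \<Longrightarrow> x \<in> S2 \<Longrightarrow> f x \<in> S2"
begin

definition family :: "(real \<Rightarrow> real ^ 3 \<Rightarrow> real ^ 3) \<Rightarrow> bool" where
  "family \<psi> \<longleftrightarrow> (\<forall>h. \<psi> h \<in> M) \<and> continuous_on (UNIV \<times> S2) (\<lambda>(h, x). \<psi> h x)"

text \<open>
  Tangency of \<open>V\<close> is automatic. Continuity of the family in \<open>h\<close> is what makes Brouwer's theorem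
  applicable to exact steering.
\<close>

definition accessible_within :: "real \<Rightarrow> (real ^ 3 \<Rightarrow> real ^ 3) \<Rightarrow> bool" where
  "accessible_within \<eta> V \<longleftrightarrow> (\<exists>\<psi> \<delta>. family \<psi> \<and> \<delta> > 0 \<and>
     (\<forall>h x. \<bar>h\<bar> \<le> \<delta> \<longrightarrow> x \<in> S2 \<longrightarrow> norm (\<psi> h x - x - h *\<^sub>R V x) \<le> \<eta> * \<bar>h\<bar>))"

definition accessible :: "(real ^ 3 \<Rightarrow> real ^ 3) \<Rightarrow> bool" where
  "accessible V \<longleftrightarrow> continuous_on S2 V \<and> (\<forall>\<eta>>0. accessible_within \<eta> V)"

text \<open>Membership in \<open>M\<close> is exact and holds for both signs of \<open>t\<close>:
  conjugation needs \<open>\<Phi> (- t)\<close> as inverse of \<open>\<Phi> t\<close>, and it needs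
  differences of nearby points to be transported accurately, which an accessible family does not
  provide.\<close>

definition local_flow :: "(real ^ 3 \<Rightarrow> real ^ 3) \<Rightarrow> real \<Rightarrow> (real \<Rightarrow> real ^ 3 \<Rightarrow> real ^ 3) \<Rightarrow> bool" where
  "local_flow V \<tau> \<Phi> \<longleftrightarrow> \<tau> > 0 \<and> (\<forall>t\<in>{-\<tau>..\<tau>}. \<Phi> t \<in> M) \<and> (\<forall>x\<in>S2. \<Phi> 0 x = x \<and> (\<forall>t\<in>{-\<tau>..\<tau>}.
     ((\<lambda>t. \<Phi> t x) has_vector_derivative V (\<Phi> t x)) (at t within {-\<tau>..\<tau>})))"

lemma family_comp:
  assumes "family \<psi>" "family \<omega>"
  shows "family (\<lambda>h. \<psi> h \<circ> \<omega> h)"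
proof -
  have c: "continuous_on (UNIV \<times> S2) (\<lambda>(h, x). \<psi> h x)" "continuous_on (UNIV \<times> S2) (\<lambda>(h, x). \<omega> h x)"
    and mem: "\<And>h. \<omega> h \<in> M"
    using assms by (simp_all add: family_def)
  have "continuous_on (UNIV \<times> S2) (\<lambda>p. (fst p, (\<lambda>(h, x). \<omega> h x) p))"
    by (intro continuous_on_Pair continuous_on_fst continuous_on_id c)
  moreover have "(\<lambda>p. (fst p, (\<lambda>(h, x). \<omega> h x) p)) ` (UNIV \<times> S2) \<subseteq> UNIV \<times> S2"
    using maps_S2[OF mem] by fastforce
  ultimately have "continuous_on (UNIV \<times> S2) (\<lambda>p. (\<lambda>(h, x). \<psi> h x) (fst p, (\<lambda>(h, x). \<omega> h x) p))"
    by (rule continuous_on_compose2[OF c(1)])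
  then show ?thesis using assms comp_mem unfolding family_def by (simp add: case_prod_unfold)
qed

lemma family_reparam:
  assumes "family \<psi>" "continuous_on UNIV r"
  shows "family (\<lambda>h. \<psi> (r h))"
proof -
  have c: "continuous_on (UNIV \<times> S2) (\<lambda>(h, x). \<psi> h x)"
    using assms by (simp add: family_def)
  have "continuous_on (UNIV \<times> S2) (\<lambda>p. (r (fst p), snd p))"
    by (intro continuous_on_Pair continuous_on_snd continuous_on_id
        continuous_on_compose2[OF assms(2) continuous_on_fst[OF continuous_on_id]]) simp
  moreover have "(\<lambda>p. (r (fst p), snd p)) ` (UNIV \<times> S2) \<subseteq> UNIV \<times> S2" by fastforce
  ultimately have "continuous_on (UNIV \<times> S2) (\<lambda>p. (\<lambda>(h, x). \<psi> h x) (r (fst p), snd p))"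
    by (rule continuous_on_compose2[OF c])
  then show ?thesis using assms unfolding family_def by (simp add: case_prod_unfold)
qed

lemma family_const:
  assumes "f \<in> M" "continuous_on S2 f"
  shows "family (\<lambda>h. f)"
proof -
  have "continuous_on (UNIV \<times> S2) (\<lambda>p :: real \<times> (real ^ 3). f (snd p))"
    by (intro continuous_on_compose2[OF assms(2) continuous_on_snd[OF continuous_on_id]]) auto
  then show ?thesis using assms unfolding family_def by (simp add: case_prod_unfold)
qed

lemma accessible_withinI:
  assumes "family \<psi>" "\<delta> > 0"
    "\<And>h x. \<bar>h\<bar> \<le> \<delta> \<Longrightarrow> x \<in> S2 \<Longrightarrow> norm (\<psi> h x - x - h *\<^sub>R V x) \<le> \<eta> * \<bar>h\<bar>"
  shows "accessible_within \<eta> V"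
  using assms unfolding accessible_within_def by blast

lemma accessible_withinE:
  assumes "accessible_within \<eta> V"
  obtains \<psi> \<delta> where "family \<psi>" "\<delta> > 0"
    "\<And>h x. \<bar>h\<bar> \<le> \<delta> \<Longrightarrow> x \<in> S2 \<Longrightarrow> norm (\<psi> h x - x - h *\<^sub>R V x) \<le> \<eta> * \<bar>h\<bar>"
  using assms unfolding accessible_within_def by blast

lemma accessible_within_close:
  assumes V: "accessible_within \<eta> V" and W: "\<And>x. x \<in> S2 \<Longrightarrow> norm (V x - W x) \<le> \<epsilon>" and "\<eta> + \<epsilon> \<le> \<zeta>"
  shows "accessible_within \<zeta> W"
proof -
  obtain \<psi> \<delta> where \<psi>: "family \<psi>" "\<delta> > 0"
    "\<And>h x. \<bar>h\<bar> \<le> \<delta> \<Longrightarrow> x \<in> S2 \<Longrightarrow> norm (\<psi> h x - x - h *\<^sub>R V x) \<le> \<eta> * \<bar>h\<bar>"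
    using accessible_withinE[OF V] by blast
  show ?thesis
  proof (rule accessible_withinI[OF \<psi>(1,2)])
    fix h x assume h: "\<bar>h\<bar> \<le> \<delta>" and x: "x \<in> S2"
    have "\<psi> h x - x - h *\<^sub>R W x = (\<psi> h x - x - h *\<^sub>R V x) + h *\<^sub>R (V x - W x)"
      by (simp add: algebra_simps)
    also have "norm \<dots> \<le> \<eta> * \<bar>h\<bar> + \<bar>h\<bar> * \<epsilon>"
      using \<psi>(3)[OF h x] W[OF x] by (intro norm_triangle_mono) (auto intro!: mult_left_mono)
    also have "\<dots> = (\<eta> + \<epsilon>) * \<bar>h\<bar>" by (simp add: algebra_simps)
    also have "\<dots> \<le> \<zeta> * \<bar>h\<bar>" using assms(3) by (intro mult_right_mono) auto
    finally show "norm (\<psi> h x - x - h *\<^sub>R W x) \<le> \<zeta> * \<bar>h\<bar>" .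
  qed
qed

lemma accessible_within_scale:
  assumes "accessible_within \<eta> V"
  shows "accessible_within (\<bar>r\<bar> * \<eta>) (\<lambda>x. r *\<^sub>R V x)"
proof -
  obtain \<psi> \<delta> where \<psi>: "family \<psi>" "\<delta> > 0"
    "\<And>h x. \<bar>h\<bar> \<le> \<delta> \<Longrightarrow> x \<in> S2 \<Longrightarrow> norm (\<psi> h x - x - h *\<^sub>R V x) \<le> \<eta> * \<bar>h\<bar>"
    using accessible_withinE[OF assms] by blast
  show ?thesis
  proof (rule accessible_withinI)
    show "family (\<lambda>h. \<psi> (r * h))" by (rule family_reparam[OF \<psi>(1)]) (intro continuous_intros)
    show "\<delta> / (\<bar>r\<bar> + 1) > 0" using \<psi>(2) by simp
    fix h x assume h: "\<bar>h\<bar> \<le> \<delta> / (\<bar>r\<bar> + 1)" and x: "x \<in> S2"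
    have "\<bar>r * h\<bar> \<le> \<bar>h\<bar> * (\<bar>r\<bar> + 1)" by (simp add: abs_mult algebra_simps)
    also have "\<dots> \<le> \<delta>" using h by (simp add: pos_le_divide_eq)
    finally have "norm (\<psi> (r * h) x - x - (r * h) *\<^sub>R V x) \<le> \<eta> * \<bar>r * h\<bar>" using \<psi>(3) x by blast
    then show "norm (\<psi> (r * h) x - x - h *\<^sub>R r *\<^sub>R V x) \<le> \<bar>r\<bar> * \<eta> * \<bar>h\<bar>"
      by (simp add: abs_mult mult_ac)
  qed
qed

lemma accessible_within_add:
  assumes V: "accessible_within \<eta> V" and W: "accessible_within \<zeta> W"
    and cV: "continuous_on S2 V" and cW: "continuous_on S2 W" and "\<epsilon> > 0"
  shows "accessible_within (\<eta> + \<zeta> + \<epsilon>) (\<lambda>x. V x + W x)"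
proof -
  obtain \<psi> \<delta> where \<psi>: "family \<psi>" "\<delta> > 0"
    "\<And>h x. \<bar>h\<bar> \<le> \<delta> \<Longrightarrow> x \<in> S2 \<Longrightarrow> norm (\<psi> h x - x - h *\<^sub>R V x) \<le> \<eta> * \<bar>h\<bar>"
    using accessible_withinE[OF V] by blast
  obtain \<omega> \<rho> where \<omega>: "family \<omega>" "\<rho> > 0"
    "\<And>h x. \<bar>h\<bar> \<le> \<rho> \<Longrightarrow> x \<in> S2 \<Longrightarrow> norm (\<omega> h x - x - h *\<^sub>R W x) \<le> \<zeta> * \<bar>h\<bar>"
    using accessible_withinE[OF W] by blast
  have "uniformly_continuous_on S2 V" by (rule compact_uniformly_continuous[OF cV]) simp
  then obtain d where d: "d > 0" "\<And>x y. x \<in> S2 \<Longrightarrow> y \<in> S2 \<Longrightarrow> dist y x < d \<Longrightarrow> dist (V y) (V x) < \<epsilon>"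
    unfolding uniformly_continuous_on_def using \<open>\<epsilon> > 0\<close> by metis
  have "bounded (W ` S2)" by (intro compact_imp_bounded compact_continuous_image cW) simp
  then obtain B where B: "B > 0" "\<forall>x\<in>S2. norm (W x) \<le> B" unfolding bounded_pos by auto
  \<comment> \<open>\<open>\<omega> h\<close> moves points by at most
    \<open>\<bar>h\<bar> * (\<bar>\<zeta>\<bar> + B)\<close>; this \<open>r\<close> keeps the
    displacement below the modulus of continuity \<open>d\<close> of \<open>V\<close>.\<close>
  define r where "r = d / (2 * (\<bar>\<zeta>\<bar> + B))"
  have "r > 0" using d B by (auto simp: r_def)
  show ?thesis
  proof (rule accessible_withinI)
    show "family (\<lambda>h. \<psi> h \<circ> \<omega> h)" by (intro family_comp \<psi> \<omega>)
    show "min (min \<delta> \<rho>) r > 0" using \<psi> \<omega> \<open>r > 0\<close> by auto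
    fix h x assume h: "\<bar>h\<bar> \<le> min (min \<delta> \<rho>) r" and x: "x \<in> S2"
    let ?y = "\<omega> h x"
    have y: "?y \<in> S2" using \<omega>(1) x maps_S2 unfolding family_def by blast
    have 1: "norm (?y - x - h *\<^sub>R W x) \<le> \<zeta> * \<bar>h\<bar>" using \<omega>(3)[of h x] h x by simp
    have 2: "norm (\<psi> h ?y - ?y - h *\<^sub>R V ?y) \<le> \<eta> * \<bar>h\<bar>" using \<psi>(3)[of h ?y] h y by simp
    have "norm (?y - x) = norm ((?y - x - h *\<^sub>R W x) + h *\<^sub>R W x)" by simp
    also have "\<dots> \<le> \<bar>\<zeta>\<bar> * \<bar>h\<bar> + \<bar>h\<bar> * B"
      using order_trans[OF 1 mult_right_mono[OF abs_ge_self abs_ge_zero]] B(2) x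
      by (intro norm_triangle_mono) (auto intro!: mult_left_mono)
    also have "\<dots> = \<bar>h\<bar> * (\<bar>\<zeta>\<bar> + B)" by (simp add: algebra_simps)
    also have "\<dots> \<le> r * (\<bar>\<zeta>\<bar> + B)" using h B by (intro mult_right_mono) auto
    also have "\<bar>\<zeta>\<bar> + B \<noteq> 0" using B by linarith
    then have "r * (\<bar>\<zeta>\<bar> + B) = d / 2" unfolding r_def by (rule divide_cancel_factor)
    also have "\<dots> < d" using d by simp
    finally have "norm (V ?y - V x) \<le> \<epsilon>" using d(2)[OF x y] by (simp add: dist_norm)
    have "(\<psi> h \<circ> \<omega> h) x - x - h *\<^sub>R (V x + W x)
        = (\<psi> h ?y - ?y - h *\<^sub>R V ?y) + (?y - x - h *\<^sub>R W x) + h *\<^sub>R (V ?y - V x)"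
      by (simp add: algebra_simps)
    also have "norm \<dots> \<le> \<eta> * \<bar>h\<bar> + \<zeta> * \<bar>h\<bar> + \<bar>h\<bar> * \<epsilon>"
      using 1 2 \<open>norm (V ?y - V x) \<le> \<epsilon>\<close> by (intro norm_triangle_mono) (auto intro!: mult_left_mono)
    finally show "norm ((\<psi> h \<circ> \<omega> h) x - x - h *\<^sub>R (V x + W x)) \<le> (\<eta> + \<zeta> + \<epsilon>) * \<bar>h\<bar>"
      by (simp add: algebra_simps)
  qed
qed

text \<open>The tolerance in the definition absorbs the distance between the fields: a family for a
  nearby field serves \<open>V\<close> directly, and no limit of families is taken.\<close>

lemma accessible_limit:
  assumes "continuous_on S2 V" and "\<And>\<epsilon>. \<epsilon> > 0 \<Longrightarrow> \<exists>W. accessible W \<and> (\<forall>x\<in>S2. norm (W x - V x) \<le> \<epsilon>)"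
  shows "accessible V"
  unfolding accessible_def
proof (intro conjI assms allI impI)
  fix \<eta> :: real assume "\<eta> > 0"
  then obtain W where "accessible W" "\<forall>x\<in>S2. norm (W x - V x) \<le> \<eta>/2" using assms(2)[of "\<eta>/2"] by auto
  then have W: "accessible_within (\<eta>/2) W" "\<And>x. x \<in> S2 \<Longrightarrow> norm (W x - V x) \<le> \<eta>/2"
    using \<open>\<eta> > 0\<close> by (simp_all add: accessible_def)
  have "accessible_within (\<eta>/2 + \<eta>/2) V" by (rule accessible_within_close[OF W order_refl])
  then show "accessible_within \<eta> V" by simp
qed

lemma accessible_cong:
  assumes "accessible V" "\<And>x. x \<in> S2 \<Longrightarrow> V x = W x"
  shows "accessible W"
proof -
  have "continuous_on S2 W" using assms continuous_on_cong unfolding accessible_def by metis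
  then show ?thesis using assms by (intro accessible_limit) (auto intro!: exI[of _ V])
qed

lemma accessible_scale: "accessible V \<Longrightarrow> accessible (\<lambda>x. r *\<^sub>R V x)"
  unfolding accessible_def
proof (intro conjI allI impI)
  assume V: "continuous_on S2 V \<and> (\<forall>\<eta>>0. accessible_within \<eta> V)"
  then show "continuous_on S2 (\<lambda>x. r *\<^sub>R V x)" by (intro continuous_intros) auto
  fix \<eta> :: real assume \<eta>: "\<eta> > 0"
  then have "accessible_within (\<bar>r\<bar> * (\<eta> / (\<bar>r\<bar> + 1))) (\<lambda>x. r *\<^sub>R V x)"
    using V by (intro accessible_within_scale) auto
  from accessible_within_close[OF this, of _ 0 \<eta>]
  show "accessible_within \<eta> (\<lambda>x. r *\<^sub>R V x)" using \<eta> by (simp add: field_simps)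
qed

lemma accessible_add: "accessible V \<Longrightarrow> accessible W \<Longrightarrow> accessible (\<lambda>x. V x + W x)"
  unfolding accessible_def
proof (intro conjI allI impI)
  assume VW: "continuous_on S2 V \<and> (\<forall>\<eta>>0. accessible_within \<eta> V)" "continuous_on S2 W \<and> (\<forall>\<eta>>0. accessible_within \<eta> W)"
  then show "continuous_on S2 (\<lambda>x. V x + W x)" by (intro continuous_intros) auto
  fix \<eta> :: real assume \<eta>: "\<eta> > 0"
  then have "accessible_within (\<eta>/3 + \<eta>/3 + \<eta>/3) (\<lambda>x. V x + W x)"
    using VW by (intro accessible_within_add) auto
  then show "accessible_within \<eta> (\<lambda>x. V x + W x)" by simp
qed

lemma accessible_diff: "accessible V \<Longrightarrow> accessible W \<Longrightarrow> accessible (\<lambda>x. V x - W x)"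
  using accessible_add[OF _ accessible_scale[of W "-1"]] by simp

lemma accessible_zero: "accessible (\<lambda>x. 0)"
proof -
  have "accessible_within \<eta> (\<lambda>x. 0)" if "\<eta> > 0" for \<eta>
    by (rule accessible_withinI[of "\<lambda>h. id" 1]) (use that in \<open>auto intro!: family_const id_mem continuous_intros\<close>)
  then show ?thesis by (simp add: accessible_def)
qed

lemma accessible_sum: "finite A \<Longrightarrow> (\<And>i. i \<in> A \<Longrightarrow> accessible (V i)) \<Longrightarrow> accessible (\<lambda>x. \<Sum>i\<in>A. V i x)"
  by (induction A rule: finite_induct) (auto intro!: accessible_zero accessible_add)

text \<open>An involution is its own inverse, so conjugation only composes members of
  \<open>M\<close>; as a linear isometry \<open>D\<close> leaves the error bound unchanged.\<close>

lemma accessible_conj: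
  assumes V: "accessible V" and D: "D \<in> M" "linear D" "\<And>x. norm (D x) = norm x" "\<And>x. D (D x) = x"
  shows "accessible (\<lambda>x. D (V (D x)))"
  unfolding accessible_def
proof (intro conjI allI impI)
  have cD: "continuous_on A D" for A
    using D(2) by (simp add: linear_continuous_on linear_conv_bounded_linear)
  have DS: "D x \<in> S2" if "x \<in> S2" for x using that D(3) by simp
  show "continuous_on S2 (\<lambda>x. D (V (D x)))"
  proof (rule continuous_on_compose2[OF cD[of UNIV]])
    show "continuous_on S2 (\<lambda>x. V (D x))"
      by (rule continuous_on_compose2[OF _ cD]) (use V DS in \<open>auto simp: accessible_def\<close>)
  qed auto
  fix \<eta> :: real assume "\<eta> > 0"
  then have "accessible_within \<eta> V" using V by (simp add: accessible_def)
  from accessible_withinE[OF this] obtain \<psi> \<delta> where \<psi>: "family \<psi>" "\<delta> > 0"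
    "\<And>h x. \<bar>h\<bar> \<le> \<delta> \<Longrightarrow> x \<in> S2 \<Longrightarrow> norm (\<psi> h x - x - h *\<^sub>R V x) \<le> \<eta> * \<bar>h\<bar>" by blast
  show "accessible_within \<eta> (\<lambda>x. D (V (D x)))"
  proof (rule accessible_withinI)
    show "family (\<lambda>h. D \<circ> (\<psi> h \<circ> D))"
      by (rule family_comp[OF family_const[OF D(1) cD] family_comp[OF \<psi>(1) family_const[OF D(1) cD]]])
    fix h x assume h: "\<bar>h\<bar> \<le> \<delta>" and x: "x \<in> S2"
    have "(D \<circ> (\<psi> h \<circ> D)) x - x - h *\<^sub>R D (V (D x)) = D (\<psi> h (D x) - D x - h *\<^sub>R V (D x))"
      by (simp add: linear_diff[OF D(2)] linear_cmul[OF D(2)] D(4))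
    then show "norm ((D \<circ> (\<psi> h \<circ> D)) x - x - h *\<^sub>R D (V (D x))) \<le> \<eta> * \<bar>h\<bar>"
      using \<psi>(3)[OF h DS[OF x]] by (simp add: D(3))
  qed (rule \<psi>)
qed

text \<open>Accessible fields form a closed linear space, so they contain the uniform limit of the
  difference quotients of a curve \<open>G\<close>. This is the device for polarising
  identities.\<close>

lemma accessible_parameter_derivative:
  assumes G: "\<And>s. accessible (G s)" and D: "continuous_on S2 D"
    and bound: "\<And>s x. \<bar>s\<bar> \<le> 1 \<Longrightarrow> x \<in> S2 \<Longrightarrow> norm (G s x - G 0 x - s *\<^sub>R D x) \<le> K * s\<^sup>2"
  shows "accessible D"
proof (rule accessible_limit[OF D])
  fix \<epsilon> :: real assume "\<epsilon> > 0"
  define s where "s = min 1 (\<epsilon> / (\<bar>K\<bar> + 1))"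
  have s: "0 < s" "s \<le> 1" "s \<le> \<epsilon> / (\<bar>K\<bar> + 1)"
    using \<open>\<epsilon> > 0\<close> by (auto simp: s_def)
  then have s': "s * (\<bar>K\<bar> + 1) \<le> \<epsilon>" by (simp add: pos_le_divide_eq)
  have "norm ((1/s) *\<^sub>R (G s x - G 0 x) - D x) \<le> \<epsilon>" if x: "x \<in> S2" for x
  proof -
    have "(1/s) *\<^sub>R (G s x - G 0 x) - D x = (1/s) *\<^sub>R (G s x - G 0 x - s *\<^sub>R D x)"
      using s by (simp add: scaleR_diff_right)
    also have "norm \<dots> \<le> (1/s) * (K * s\<^sup>2)"
      using bound[of s x] s x by (simp add: divide_right_mono)
    also have "\<dots> = s * K" using s by (simp add: power2_eq_square)
    also have "\<dots> \<le> s * (\<bar>K\<bar> + 1)" using s by (intro mult_left_mono) auto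
    finally show ?thesis using s' by linarith
  qed
  then show "\<exists>W. accessible W \<and> (\<forall>x\<in>S2. norm (W x - D x) \<le> \<epsilon>)"
    using G by (intro exI[of _ "\<lambda>x. (1/s) *\<^sub>R (G s x - G 0 x)"]) (auto intro!: accessible_scale accessible_diff)
qed

section \<open>Exact local flows, conjugation and the Lie bracket\<close>

lemma local_flowD:
  assumes "local_flow V \<tau> \<Phi>"
  shows "\<tau> > 0" "t \<in> {-\<tau>..\<tau>} \<Longrightarrow> \<Phi> t \<in> M" "x \<in> S2 \<Longrightarrow> \<Phi> 0 x = x"
    "x \<in> S2 \<Longrightarrow> t \<in> {-\<tau>..\<tau>} \<Longrightarrow> ((\<lambda>t. \<Phi> t x) has_vector_derivative V (\<Phi> t x)) (at t within {-\<tau>..\<tau>})"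
    "x \<in> S2 \<Longrightarrow> t \<in> {-\<tau>..\<tau>} \<Longrightarrow> \<Phi> t x \<in> S2"
  using assms maps_S2[of "\<Phi> t" x] unfolding local_flow_def by blast+

lemma local_flow_lipschitz:
  assumes \<Phi>: "local_flow V \<tau> \<Phi>" and V: "taylor2 V DV C" and "x \<in> S2" "y \<in> S2" "t \<in> {-\<tau>..\<tau>}"
  shows "norm (\<Phi> t x - \<Phi> t y) \<le> exp (3 * C * \<tau>) * norm (x - y)"
proof -
  have "norm (\<Phi> t x - \<Phi> t y) \<le> exp (3 * C * \<bar>t - 0\<bar>) * norm (\<Phi> 0 x - \<Phi> 0 y)"
    by (rule ode_stability[of S2 V "3 * C" "-\<tau>" \<tau>])
      (use assms local_flowD[OF \<Phi>] taylor2_lipschitz[OF V] in simp_all)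
  also have "\<dots> \<le> exp (3 * C * \<tau>) * norm (x - y)"
    using assms local_flowD[OF \<Phi>] taylor2D(2)[OF V] by (auto intro!: mult_right_mono mult_left_mono)
  finally show ?thesis .
qed

text \<open>The curves \<open>\<Phi> s x\<close> and \<open>\<Phi> (s - t) (\<Phi> t x)\<close>
  solve the same equation and agree at \<open>s = t\<close>, so stability makes them agree at
  \<open>s = 0\<close>. Staying between \<open>0\<close> and \<open>t\<close> keeps both within the
  range of the flow.\<close>

lemma local_flow_inverse:
  assumes \<Phi>: "local_flow V \<tau> \<Phi>" and V: "taylor2 V DV C" and x: "x \<in> S2" and t: "t \<in> {-\<tau>..\<tau>}"
  shows "\<Phi> (- t) (\<Phi> t x) = x"
proof -
  let ?y = "\<Phi> t x" and ?I = "{min 0 t..max 0 t}"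
  note F = local_flowD[OF \<Phi>]
  have y: "?y \<in> S2" using F x t by simp
  have sub: "?I \<subseteq> {-\<tau>..\<tau>}" "\<And>s. s \<in> ?I \<Longrightarrow> s - t \<in> {-\<tau>..\<tau>}" using t F(1) by auto
  have "norm (\<Phi> 0 x - \<Phi> (0 - t) ?y) \<le> exp (3 * C * \<bar>0 - t\<bar>) * norm (\<Phi> t x - \<Phi> (t - t) ?y)"
  proof (rule ode_stability[of S2 V "3 * C" "min 0 t" "max 0 t" "\<lambda>s. \<Phi> s x" "\<lambda>s. \<Phi> (s - t) ?y"])
    fix s assume s: "s \<in> ?I"
    show "\<Phi> s x \<in> S2 \<and> ((\<lambda>s. \<Phi> s x) has_vector_derivative V (\<Phi> s x)) (at s within ?I)"
      using F(5)[OF x, of s] has_vector_derivative_within_subset[OF F(4)[OF x, of s] sub(1)] s sub(1) by blast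
    have 1: "((\<lambda>s. s - t) has_vector_derivative 1) (at s within ?I)"
      by (auto intro!: derivative_eq_intros)
    have "((\<lambda>s. \<Phi> s ?y) has_vector_derivative V (\<Phi> (s - t) ?y)) (at (s - t) within (\<lambda>s. s - t) ` ?I)"
      by (rule has_vector_derivative_within_subset[OF F(4)[OF y sub(2)[OF s]]]) (use sub(2) in blast)
    from vector_diff_chain_within[OF 1 this] F(5)[OF y sub(2)[OF s]]
    show "\<Phi> (s - t) ?y \<in> S2 \<and> ((\<lambda>s. \<Phi> (s - t) ?y) has_vector_derivative V (\<Phi> (s - t) ?y)) (at s within ?I)"
      by (simp add: o_def)
  qed (use taylor2_lipschitz[OF V] in auto)
  also have "\<dots> = 0" using F(3)[OF y] by simp
  finally show ?thesis using F(3)[OF x] by simp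
qed

lemma local_flow_speed:
  assumes \<Phi>: "local_flow V \<tau> \<Phi>" and V: "taylor2 V DV C" and x: "x \<in> S2" and t: "s \<in> {-\<tau>..\<tau>}" "t \<in> {-\<tau>..\<tau>}"
  shows "norm (\<Phi> t x - \<Phi> s x) \<le> C * \<bar>t - s\<bar>"
  by (rule vector_derivative_bound[OF local_flowD(4)[OF \<Phi> x] taylor2D(3)[OF V local_flowD(5)[OF \<Phi> x]] t])

text \<open>The velocity changes by at most \<open>3 * C\<close> times the distance travelled,
  itself at most \<open>C * \<bar>t\<bar>\<close>.\<close>

lemma local_flow_first_order:
  assumes \<Phi>: "local_flow V \<tau> \<Phi>" and V: "taylor2 V DV C" and x: "x \<in> S2" and t: "t \<in> {-\<tau>..\<tau>}"
  shows "norm (\<Phi> t x - x - t *\<^sub>R V x) \<le> 3 * C\<^sup>2 * t\<^sup>2"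
proof -
  note F = local_flowD[OF \<Phi>]
  have sub: "{-\<bar>t\<bar>..\<bar>t\<bar>} \<subseteq> {-\<tau>..\<tau>}" using t by auto
  have "norm ((\<Phi> t x - t *\<^sub>R V x) - (\<Phi> 0 x - 0 *\<^sub>R V x)) \<le> (3 * C * (C * \<bar>t\<bar>)) * \<bar>t - 0\<bar>"
  proof (rule vector_derivative_bound[of "-\<bar>t\<bar>" "\<bar>t\<bar>" "\<lambda>s. \<Phi> s x - s *\<^sub>R V x" "\<lambda>s. V (\<Phi> s x) - V x"])
    fix s assume s: "s \<in> {-\<bar>t\<bar>..\<bar>t\<bar>}"
    have "((\<lambda>s. \<Phi> s x - s *\<^sub>R V x) has_vector_derivative V (\<Phi> s x) - 1 *\<^sub>R V x) (at s within {-\<bar>t\<bar>..\<bar>t\<bar>})"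
      by (intro has_vector_derivative_diff has_vector_derivative_within_subset[OF F(4)[OF x] sub]
          has_vector_derivative_id_scaleR) (use s sub in auto)
    then show "((\<lambda>s. \<Phi> s x - s *\<^sub>R V x) has_vector_derivative V (\<Phi> s x) - V x) (at s within {-\<bar>t\<bar>..\<bar>t\<bar>})" by simp
    have s': "s \<in> {-\<tau>..\<tau>}" using s sub by blast
    have "norm (V (\<Phi> s x) - V x) \<le> 3 * C * norm (\<Phi> s x - x)"
      by (rule taylor2_lipschitz[OF V F(5)[OF x s'] x])
    also have "norm (\<Phi> s x - x) \<le> C * \<bar>t\<bar>"
      using local_flow_speed[OF \<Phi> V x _ s', of 0] F(1,3) x s taylor2D(2)[OF V]
      by (simp add: order_trans[OF _ mult_left_mono[of "\<bar>s\<bar>" "\<bar>t\<bar>" C]] abs_le_iff)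
    finally show "norm (V (\<Phi> s x) - V x) \<le> 3 * C * (C * \<bar>t\<bar>)"
      using taylor2D(2)[OF V] by (simp add: mult_left_mono)
  qed auto
  then show ?thesis using F(3)[OF x] by (simp add: power2_eq_square algebra_simps)
qed

text \<open>In the conjugation the two points are \<open>O(h)\<close> apart and the error has to be
  \<open>O(t\<^sup>2 h)\<close>; the first-order bound at each point separately would lose the
  factor \<open>h\<close>. The velocity difference is therefore differentiated once more along the
  flow.\<close>

lemma local_flow_difference:
  assumes \<Phi>: "local_flow V \<tau> \<Phi>" and V: "taylor2 V DV C" and x: "x \<in> S2" and y: "y \<in> S2" and t: "t \<in> {-\<tau>..\<tau>}"
  shows "norm (\<Phi> t x - \<Phi> t y - (x - y) - t *\<^sub>R (V x - V y)) \<le> 4 * C\<^sup>2 * exp (3 * C * \<tau>) * t\<^sup>2 * norm (x - y)"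
proof -
  note F = local_flowD[OF \<Phi>]
  let ?B = "4 * C * C * (exp (3 * C * \<tau>) * norm (x - y))"
  let ?J = "{-\<bar>t\<bar>..\<bar>t\<bar>}"
  have C0: "C \<ge> 0" by (rule taylor2D(2)[OF V])
  have sub: "?J \<subseteq> {-\<tau>..\<tau>}" using t by auto
  have D: "((\<lambda>t. \<Phi> t z) has_vector_derivative V (\<Phi> s z)) (at s within ?J)" if "z \<in> S2" "s \<in> ?J" for s z
    by (rule has_vector_derivative_within_subset[OF F(4)[OF that(1)] sub]) (use that sub in auto)
  have S: "\<Phi> s z \<in> S2" if "z \<in> S2" "s \<in> ?J" for s z by (rule F(5)[OF that(1)]) (use that sub in auto)
  let ?k = "\<lambda>s. V (\<Phi> s x) - V (\<Phi> s y)"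
  have k: "norm (?k s - ?k 0) \<le> ?B * \<bar>t\<bar>" if s: "s \<in> ?J" for s
  proof -
    have "norm (?k s - ?k 0) \<le> ?B * \<bar>s - 0\<bar>"
    proof (rule vector_derivative_bound[of "-\<bar>t\<bar>" "\<bar>t\<bar>" ?k "\<lambda>s. DV (\<Phi> s x) (V (\<Phi> s x)) - DV (\<Phi> s y) (V (\<Phi> s y))"])
      fix r assume r: "r \<in> ?J"
      show "(?k has_vector_derivative DV (\<Phi> r x) (V (\<Phi> r x)) - DV (\<Phi> r y) (V (\<Phi> r y))) (at r within ?J)"
        by (intro has_vector_derivative_diff taylor2_chain[OF V] D S x y r)
      have "norm (DV (\<Phi> r x) (V (\<Phi> r x)) - DV (\<Phi> r y) (V (\<Phi> r y))) \<le> 4 * C * C * norm (\<Phi> r x - \<Phi> r y)"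
        by (rule taylor2_transport_lipschitz[OF V V S[OF x r] S[OF y r]])
      also have "\<dots> \<le> ?B"
        by (rule mult_left_mono[OF local_flow_lipschitz[OF \<Phi> V x y]]) (use r sub C0 in auto)
      finally show "norm (DV (\<Phi> r x) (V (\<Phi> r x)) - DV (\<Phi> r y) (V (\<Phi> r y))) \<le> ?B" .
    qed (use s in auto)
    also have "\<dots> \<le> ?B * \<bar>t\<bar>" using s C0 by (intro mult_left_mono) auto
    finally show ?thesis .
  qed
  let ?g = "\<lambda>s. \<Phi> s x - \<Phi> s y - s *\<^sub>R (V x - V y)"
  have "norm (?g t - ?g 0) \<le> (?B * \<bar>t\<bar>) * \<bar>t - 0\<bar>"
  proof (rule vector_derivative_bound[of "-\<bar>t\<bar>" "\<bar>t\<bar>" ?g "\<lambda>s. ?k s - (V x - V y)"])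
    fix s assume s: "s \<in> ?J"
    have "(?g has_vector_derivative ?k s - 1 *\<^sub>R (V x - V y)) (at s within ?J)"
      by (intro has_vector_derivative_diff D x y s
          has_vector_derivative_id_scaleR)
    then show "(?g has_vector_derivative ?k s - (V x - V y)) (at s within ?J)" by simp
    show "norm (?k s - (V x - V y)) \<le> ?B * \<bar>t\<bar>" using k[OF s] F(3) x y by simp
  qed auto
  moreover have "?g t - ?g 0 = \<Phi> t x - \<Phi> t y - (x - y) - t *\<^sub>R (V x - V y)" using F(3) x y by simp
  moreover have "(?B * \<bar>t\<bar>) * \<bar>t - 0\<bar> = 4 * C\<^sup>2 * exp (3 * C * \<tau>) * \<bar>t\<bar>\<^sup>2 * norm (x - y)"
    by (simp add: power2_eq_square del: abs_mult_self_eq)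
  ultimately show ?thesis by (simp only: power2_abs)
qed

lemma local_flow_tangent:
  assumes \<Phi>: "local_flow V \<tau> \<Phi>" and V: "taylor2 V DV C"
  shows "accessible V"
  unfolding accessible_def
proof (intro conjI allI impI)
  note F = local_flowD[OF \<Phi>]
  show "continuous_on S2 V" using V smooth_pair_continuous unfolding smooth_pair_def by blast
  \<comment> \<open>A family has a member for every real parameter, so the time is clamped to the
    interval of the flow; near zero this changes nothing.\<close>
  define cl where "cl h = max (-\<tau>) (min \<tau> h)" for h
  have cl: "cl h \<in> {-\<tau>..\<tau>}" for h using F(1) by (auto simp: cl_def)
  have "(C + exp (3 * C * \<tau>))-lipschitz_on ({-\<tau>..\<tau>} \<times> S2) (\<lambda>(t, x). \<Phi> t x)"
  proof (rule lipschitz_onI, clarify)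
    fix s x t y assume a: "s \<in> {-\<tau>..\<tau>}" "x \<in> S2" "t \<in> {-\<tau>..\<tau>}" "y \<in> S2"
    have "dist (\<Phi> s x) (\<Phi> t y) \<le> norm (\<Phi> s x - \<Phi> t x) + norm (\<Phi> t x - \<Phi> t y)"
      unfolding dist_norm by (metis diff_add_cancel add_diff_eq norm_triangle_ineq)
    also have "\<dots> \<le> C * \<bar>s - t\<bar> + exp (3 * C * \<tau>) * norm (x - y)"
      by (intro add_mono local_flow_speed[OF \<Phi> V] local_flow_lipschitz[OF \<Phi> V] a)
    also have "\<dots> \<le> C * dist (s, x) (t, y) + exp (3 * C * \<tau>) * dist (s, x) (t, y)"
      using dist_fst_le[of "(s, x)" "(t, y)"] dist_snd_le[of "(s, x)" "(t, y)"] taylor2D(2)[OF V]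
      by (intro add_mono mult_left_mono) (auto simp: dist_norm)
    finally show "dist (\<Phi> s x) (\<Phi> t y) \<le> (C + exp (3 * C * \<tau>)) * dist (s, x) (t, y)" by (simp add: distrib_right)
  qed (use taylor2D(2)[OF V] in simp)
  then have c: "continuous_on ({-\<tau>..\<tau>} \<times> S2) (\<lambda>(t, x). \<Phi> t x)" by (rule lipschitz_on_continuous_on)
  have "continuous_on (UNIV \<times> S2) (\<lambda>p. (cl (fst p), snd p))"
    unfolding cl_def by (intro continuous_intros)
  moreover have "(\<lambda>p. (cl (fst p), snd p)) ` (UNIV \<times> S2) \<subseteq> {-\<tau>..\<tau>} \<times> S2" using cl by fastforce
  ultimately have "continuous_on (UNIV \<times> S2) (\<lambda>p. (\<lambda>(t, x). \<Phi> t x) (cl (fst p), snd p))"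
    by (rule continuous_on_compose2[OF c])
  then have fam: "family (\<lambda>h. \<Phi> (cl h))" using cl F(2) by (simp add: family_def case_prod_unfold)
  fix \<eta> :: real assume \<eta>: "\<eta> > 0"
  show "accessible_within \<eta> V"
  proof (rule accessible_withinI[OF fam])
    have "0 < \<eta> / (3 * C\<^sup>2 + 1)" using \<eta> by (intro divide_pos_pos) (auto intro: add_nonneg_pos)
    then show "min \<tau> (\<eta> / (3 * C\<^sup>2 + 1)) > 0" using F(1) by simp
    fix h x assume h: "\<bar>h\<bar> \<le> min \<tau> (\<eta> / (3 * C\<^sup>2 + 1))" and x: "x \<in> S2"
    then have hI: "h \<in> {-\<tau>..\<tau>}" by auto
    then have "cl h = h" by (auto simp: cl_def)
    then have "norm (\<Phi> (cl h) x - x - h *\<^sub>R V x) \<le> 3 * C\<^sup>2 * h\<^sup>2"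
      using local_flow_first_order[OF \<Phi> V x hI] by simp
    also have "\<dots> = (3 * C\<^sup>2 * \<bar>h\<bar>) * \<bar>h\<bar>"
      by (simp add: power2_eq_square[of h] mult.assoc)
    also have "\<dots> \<le> ((3 * C\<^sup>2 + 1) * \<bar>h\<bar>) * \<bar>h\<bar>"
      by (intro mult_right_mono) auto
    also have "(3 * C\<^sup>2 + 1) * \<bar>h\<bar> \<le> \<eta>"
    proof -
      have "\<bar>h\<bar> \<le> \<eta> / (3 * C\<^sup>2 + 1)" "3 * C\<^sup>2 + 1 > 0" using h by (auto intro: add_nonneg_pos)
      then show ?thesis by (simp add: pos_le_divide_eq mult.commute)
    qed
    finally show "norm (\<Phi> (cl h) x - x - h *\<^sub>R V x) \<le> \<eta> * \<bar>h\<bar>" by (simp add: mult_right_mono)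
  qed
qed

text \<open>
  \<open>\<Phi> (- t) \<circ> \<psi> h \<circ> \<Phi> t\<close> has velocity the pull-back of \<open>W\<close>, which is \<open>W\<close> plus \<open>t\<close> times the bracket up to \<open>O(t\<^sup>2)\<close>.
\<close>

lemma accessible_within_conjugate:
  assumes \<Phi>: "local_flow V \<tau> \<Phi>" and V: "smooth_pair V DV" and W: "smooth_pair W DW" and tW: "accessible W"
  shows "\<exists>C>0. \<exists>t0>0. \<forall>t. 0 < t \<longrightarrow> t \<le> t0 \<longrightarrow>
    accessible_within (C * t\<^sup>2) (\<lambda>x. W x + t *\<^sub>R (DW x (V x) - DV x (W x)))"
proof -
  note F = local_flowD[OF \<Phi>]
  obtain C1 C2 where C1: "taylor2 V DV C1" and C2: "taylor2 W DW C2"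
    using V W by (auto simp: smooth_pair_def)
  \<comment> \<open>One constant covers both fields and the error constant of
    \<open>local_flow_difference\<close>; \<open>K \<ge> 1\<close> lets lower powers be absorbed in
    \<open>K^3\<close>.\<close>
  define K where "K = max (max 1 C1) (max C2 (4 * C1\<^sup>2 * exp (3 * C1 * \<tau>)))"
  have K1: "K \<ge> 1" by (auto simp: K_def)
  have V: "taylor2 V DV K" by (rule taylor2_mono[OF C1]) (auto simp: K_def)
  have W: "taylor2 W DW K" by (rule taylor2_mono[OF C2]) (auto simp: K_def)
  have "accessible_within (21 * K^3 * t\<^sup>2) (\<lambda>x. W x + t *\<^sub>R (DW x (V x) - DV x (W x)))"
    if t: "0 < t" "t \<le> min \<tau> 1" for t
  proof -
    have tI: "t \<in> {-\<tau>..\<tau>}" "- t \<in> {-\<tau>..\<tau>}" using t by auto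
    have t1: "t \<le> 1" "t\<^sup>2 \<le> t" "t\<^sup>2 > 0" using t by (auto simp: power2_eq_square mult_left_le)
    \<comment> \<open>The tolerance matches the order of the error that the conjugation itself
      produces.\<close>
    have "accessible_within (t\<^sup>2) W" using tW t1 by (auto simp: accessible_def)
    from accessible_withinE[OF this] obtain \<psi> \<delta> where \<psi>: "family \<psi>" "\<delta> > 0"
      "\<And>h x. \<bar>h\<bar> \<le> \<delta> \<Longrightarrow> x \<in> S2 \<Longrightarrow> norm (\<psi> h x - x - h *\<^sub>R W x) \<le> t\<^sup>2 * \<bar>h\<bar>" by blast
    have cont: "continuous_on S2 (\<Phi> s)" if "s \<in> {-\<tau>..\<tau>}" for s
      by (rule lipschitz_on_continuous_on[of "exp (3 * K * \<tau>)"])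
        (use local_flow_lipschitz[OF \<Phi> V _ _ that] in \<open>auto simp: lipschitz_on_def dist_norm\<close>)
    show ?thesis
    proof (rule accessible_withinI)
      show "family (\<lambda>h. \<Phi> (- t) \<circ> (\<psi> h \<circ> \<Phi> t))"
        by (rule family_comp[OF family_const[OF F(2)[OF tI(2)] cont[OF tI(2)]]
              family_comp[OF \<psi>(1) family_const[OF F(2)[OF tI(1)] cont[OF tI(1)]]]])
      \<comment> \<open>The restriction to \<open>\<bar>h\<bar> \<le> t\<^sup>2\<close>, hence
        \<open>\<bar>h\<bar> \<le> t\<close>, turns terms quadratic in \<open>h\<close> into
        multiples of \<open>t * \<bar>h\<bar>\<close>.\<close>
      show "min \<delta> (t\<^sup>2) > 0" using \<psi>(2) t1 by simp
      fix h x assume h: "\<bar>h\<bar> \<le> min \<delta> (t\<^sup>2)" and x: "x \<in> S2"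
      define z0 where "z0 = \<Phi> t x"
      define z where "z = \<psi> h z0"
      have z0: "z0 \<in> S2" using F(5)[OF x tI(1)] by (simp add: z0_def)
      have z: "z \<in> S2" using maps_S2 \<psi>(1) z0 by (auto simp: z_def family_def)
      have ht: "\<bar>h\<bar> \<le> t" using h t1 by linarith
      have hn: "\<bar>h\<bar> \<ge> 0" by simp
      note lV = taylor2_lipschitz[OF V] and lW = taylor2_lipschitz[OF W]
      define e2 where "e2 = z - z0 - h *\<^sub>R W z0"
      have e2: "norm e2 \<le> t\<^sup>2 * \<bar>h\<bar>" using \<psi>(3)[of h z0] h z0 by (simp add: e2_def z_def)
      have zz0: "norm (z - z0) \<le> 2 * K * \<bar>h\<bar>"
      proof -
        have "norm (z - z0) = norm (e2 + h *\<^sub>R W z0)" by (simp add: e2_def)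
        also have "\<dots> \<le> t\<^sup>2 * \<bar>h\<bar> + \<bar>h\<bar> * K"
          using taylor2D(3)[OF W z0] by (intro norm_triangle_mono e2) (auto intro: mult_left_mono)
        also have "\<dots> \<le> K * \<bar>h\<bar> + \<bar>h\<bar> * K"
          using t1 K1 by (intro add_mono mult_right_mono) auto
        finally show ?thesis by simp
      qed
      have z0x: "norm (z0 - x) \<le> K * t"
        using local_flow_speed[OF \<Phi> V x, of 0 t] F(1,3) x tI t by (simp add: z0_def)
      define e3 where "e3 = \<Phi> (- t) z - \<Phi> (- t) z0 - (z - z0) - (- t) *\<^sub>R (V z - V z0)"
      have e3: "norm e3 \<le> 2 * K\<^sup>2 * t\<^sup>2 * \<bar>h\<bar>"
      proof -
        have "norm e3 \<le> (4 * C1\<^sup>2 * exp (3 * C1 * \<tau>)) * (- t)\<^sup>2 * norm (z - z0)"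
          unfolding e3_def by (rule local_flow_difference[OF \<Phi> C1 z z0 tI(2)])
        also have "\<dots> \<le> K * (- t)\<^sup>2 * (2 * K * \<bar>h\<bar>)"
          by (intro mult_mono zz0) (use K1 in \<open>auto simp: K_def\<close>)
        also have "\<dots> = 2 * K\<^sup>2 * t\<^sup>2 * \<bar>h\<bar>" by (simp add: power2_eq_square)
        finally show ?thesis .
      qed
      define e4 where "e4 = W z0 - W x - t *\<^sub>R DW x (V x)"
      have e4: "norm e4 \<le> 4 * K^3 * t\<^sup>2"
      proof -
        have "e4 = (W z0 - W x - DW x (z0 - x)) + DW x (z0 - x - t *\<^sub>R V x)"
          by (simp add: e4_def linear_diff[OF taylor2D(1)[OF W]] linear_cmul[OF taylor2D(1)[OF W]])
        also have "norm \<dots> \<le> K * (K * t)\<^sup>2 + K * (3 * K\<^sup>2 * t\<^sup>2)"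
        proof (rule norm_triangle_mono)
          have "norm (W z0 - W x - DW x (z0 - x)) \<le> K * (norm (z0 - x))\<^sup>2" by (rule taylor2D(6)[OF W x z0])
          also have "\<dots> \<le> K * (K * t)\<^sup>2" using K1 by (intro mult_left_mono power_mono z0x) auto
          finally show "norm (W z0 - W x - DW x (z0 - x)) \<le> K * (K * t)\<^sup>2" .
          have "norm (DW x (z0 - x - t *\<^sub>R V x)) \<le> K * norm (z0 - x - t *\<^sub>R V x)" by (rule taylor2D(4)[OF W x])
          also have "\<dots> \<le> K * (3 * K\<^sup>2 * t\<^sup>2)"
            using K1 local_flow_first_order[OF \<Phi> V x tI(1)] by (intro mult_left_mono) (auto simp: z0_def)
          finally show "norm (DW x (z0 - x - t *\<^sub>R V x)) \<le> K * (3 * K\<^sup>2 * t\<^sup>2)" .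
        qed
        also have "\<dots> = 4 * K^3 * t\<^sup>2" by (simp add: power2_eq_square power3_eq_cube)
        finally show ?thesis .
      qed
      define e5 where "e5 = V z - V z0 - h *\<^sub>R DV x (W x)"
      have e5: "norm e5 \<le> 9 * K^3 * (t * \<bar>h\<bar>)"
      proof -
        have "e5 = (V z - V z0 - DV z0 (z - z0)) + DV z0 e2 + h *\<^sub>R (DV z0 (W z0) - DV x (W x))"
          by (simp add: e5_def e2_def linear_diff[OF taylor2D(1)[OF V]] linear_cmul[OF taylor2D(1)[OF V]] scaleR_diff_right)
        also have "norm \<dots> \<le> K * (2 * K * \<bar>h\<bar>)\<^sup>2 + K * (t\<^sup>2 * \<bar>h\<bar>) + \<bar>h\<bar> * (4 * K * K * (K * t))"
        proof (intro norm_triangle_mono)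
          have "norm (V z - V z0 - DV z0 (z - z0)) \<le> K * (norm (z - z0))\<^sup>2" by (rule taylor2D(6)[OF V z0 z])
          also have "\<dots> \<le> K * (2 * K * \<bar>h\<bar>)\<^sup>2" using K1 by (intro mult_left_mono power_mono zz0) auto
          finally show "norm (V z - V z0 - DV z0 (z - z0)) \<le> K * (2 * K * \<bar>h\<bar>)\<^sup>2" .
          show "norm (DV z0 e2) \<le> K * (t\<^sup>2 * \<bar>h\<bar>)"
            using order_trans[OF taylor2D(4)[OF V z0] mult_left_mono[OF e2]] K1 by simp
          have "norm (DV z0 (W z0) - DV x (W x)) \<le> 4 * K * K * norm (z0 - x)"
            by (rule taylor2_transport_lipschitz[OF W V z0 x])
          also have "\<dots> \<le> 4 * K * K * (K * t)" using K1 by (intro mult_left_mono z0x) auto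
          finally show "norm (h *\<^sub>R (DV z0 (W z0) - DV x (W x))) \<le> \<bar>h\<bar> * (4 * K * K * (K * t))"
            by (simp add: mult_left_mono)
        qed
        also have "\<dots> = 4 * K^3 * (\<bar>h\<bar> * \<bar>h\<bar>) + K * (t\<^sup>2 * \<bar>h\<bar>) + 4 * K^3 * (t * \<bar>h\<bar>)"
          by (simp add: power2_eq_square power3_eq_cube algebra_simps)
        also have "\<dots> \<le> 4 * K^3 * (t * \<bar>h\<bar>) + K^3 * (t * \<bar>h\<bar>) + 4 * K^3 * (t * \<bar>h\<bar>)"
        proof -
          have "K \<le> K^3" using K1 power_increasing[of 1 3 K] by simp
          then show ?thesis using K1 t1 ht by (intro add_mono mult_mono mult_left_mono mult_right_mono) auto
        qed
        finally show ?thesis by (simp add: mult_ac)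
      qed
      \<comment> \<open>An exact identity: \<open>e2\<close> is the error of the family,
        \<open>e3\<close> that of the backward flow, \<open>e4\<close> and \<open>e5\<close> those
        of expanding \<open>W\<close> along the flow and \<open>V\<close> along the family. The
        coefficients add up to at most 16, below 21.\<close>
      have "(\<Phi> (- t) \<circ> (\<psi> h \<circ> \<Phi> t)) x - x - h *\<^sub>R (W x + t *\<^sub>R (DW x (V x) - DV x (W x)))
          = e3 + e2 + h *\<^sub>R e4 - t *\<^sub>R e5"
        using local_flow_inverse[OF \<Phi> V x tI(1)]
        by (simp add: e2_def e3_def e4_def e5_def z_def z0_def algebra_simps)
      also have "norm \<dots> \<le> 2 * K\<^sup>2 * t\<^sup>2 * \<bar>h\<bar> + t\<^sup>2 * \<bar>h\<bar> + \<bar>h\<bar> * (4 * K^3 * t\<^sup>2) + t * (9 * K^3 * (t * \<bar>h\<bar>))"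
      proof (rule order_trans[OF norm_triangle_ineq4], rule add_mono)
        show "norm (e3 + e2 + h *\<^sub>R e4) \<le> 2 * K\<^sup>2 * t\<^sup>2 * \<bar>h\<bar> + t\<^sup>2 * \<bar>h\<bar> + \<bar>h\<bar> * (4 * K^3 * t\<^sup>2)"
          using e4 by (intro norm_triangle_mono e3 e2) (auto intro: mult_left_mono)
        show "norm (t *\<^sub>R e5) \<le> t * (9 * K^3 * (t * \<bar>h\<bar>))" using e5 t by (simp add: mult_left_mono)
      qed
      also have "\<dots> = (2 * K\<^sup>2 + 1 + 13 * K^3) * (t\<^sup>2 * \<bar>h\<bar>)"
        by (simp add: power2_eq_square algebra_simps)
      also have "\<dots> \<le> (21 * K^3) * (t\<^sup>2 * \<bar>h\<bar>)"
      proof (rule mult_right_mono)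
        have "K\<^sup>2 \<le> K^3" "1 \<le> K^3" using K1 power_increasing[of 2 3 K] one_le_power[of K 3] by auto
        then show "2 * K\<^sup>2 + 1 + 13 * K^3 \<le> 21 * K^3" by linarith
      qed simp
      finally show "norm ((\<Phi> (- t) \<circ> (\<psi> h \<circ> \<Phi> t)) x - x - h *\<^sub>R (W x + t *\<^sub>R (DW x (V x) - DV x (W x))))
          \<le> 21 * K^3 * t\<^sup>2 * \<bar>h\<bar>" by (simp add: mult.assoc)
    qed
  qed
  moreover have "21 * K^3 > 0" "min \<tau> 1 > 0" using K1 F(1) by auto
  ultimately show ?thesis by blast
qed

text \<open>The conjugated field minus \<open>W\<close> is \<open>t\<close> times the bracket up to
  \<open>O(t\<^sup>2)\<close>, so dividing by \<open>t\<close> leaves an error \<open>O(t)\<close>.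
  The 2 in \<open>C + 2\<close> is made of the tolerances for \<open>- W\<close> and for the
  sum.\<close>

lemma accessible_bracket:
  assumes \<Phi>: "local_flow V \<tau> \<Phi>" and V: "smooth_pair V DV" and W: "smooth_pair W DW" and tW: "accessible W"
  shows "accessible (\<lambda>x. DW x (V x) - DV x (W x))" (is "accessible ?U")
  unfolding accessible_def
proof (intro conjI allI impI)
  obtain C1 C2 where C1: "taylor2 V DV C1" and C2: "taylor2 W DW C2"
    using V W by (auto simp: smooth_pair_def)
  have cont: "continuous_on S2 (\<lambda>x. DW x (V x))" "continuous_on S2 (\<lambda>x. DV x (W x))"
    by (rule lipschitz_on_continuous_on[of "4 * C1 * C2"],
        use taylor2_transport_lipschitz[OF C1 C2] taylor2D(2)[OF C1] taylor2D(2)[OF C2] in \<open>simp add: lipschitz_on_def dist_norm\<close>,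
        rule lipschitz_on_continuous_on[of "4 * C2 * C1"],
        use taylor2_transport_lipschitz[OF C2 C1] taylor2D(2)[OF C1] taylor2D(2)[OF C2] in \<open>simp add: lipschitz_on_def dist_norm\<close>)
  then show cU: "continuous_on S2 ?U" by (intro continuous_intros)
  have cW: "continuous_on S2 W" using tW by (simp add: accessible_def)
  obtain C t0 where C: "C > 0" "t0 > 0"
    "\<And>t. 0 < t \<Longrightarrow> t \<le> t0 \<Longrightarrow> accessible_within (C * t\<^sup>2) (\<lambda>x. W x + t *\<^sub>R ?U x)"
    using accessible_within_conjugate[OF \<Phi> V W tW] by blast
  fix \<eta> :: real assume \<eta>: "\<eta> > 0"
  define t where "t = min t0 (\<eta> / (C + 2))"
  have t: "0 < t" "t \<le> t0" "t \<le> \<eta> / (C + 2)" using C \<eta> by (auto simp: t_def)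
  then have t2: "(C + 2) * t \<le> \<eta>" using C by (simp add: pos_le_divide_eq mult.commute)
  have "accessible (\<lambda>x. (-1) *\<^sub>R W x)" by (rule accessible_scale[OF tW])
  then have "accessible_within (t\<^sup>2) (\<lambda>x. (-1) *\<^sub>R W x)" using t by (simp add: accessible_def)
  from accessible_within_add[OF C(3)[OF t(1,2)] this, of "t\<^sup>2"]
  have "accessible_within (C * t\<^sup>2 + t\<^sup>2 + t\<^sup>2) (\<lambda>x. t *\<^sub>R ?U x)"
    using t cU cW by (simp add: continuous_intros)
  from accessible_within_scale[OF this, of "1/t"]
  have "accessible_within (\<bar>1/t\<bar> * (C * t\<^sup>2 + t\<^sup>2 + t\<^sup>2)) ?U" using t by simp
  moreover have "\<bar>1/t\<bar> * (C * t\<^sup>2 + t\<^sup>2 + t\<^sup>2) = (C + 2) * t"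
    using t by (simp add: power2_eq_square field_simps)
  ultimately have "accessible_within ((C + 2) * t) ?U" by simp
  then show "accessible_within \<eta> ?U"
    by (rule accessible_within_close[where \<epsilon> = 0]) (use t2 in auto)
qed

end

section \<open>Half-turns and linear coefficients\<close>

notation cross3 (infixr "\<^bold>\<times>" 80)

lemma bounded_bilinear_cross3: "bounded_bilinear cross3"
  using bilinear_cross by (simp add: bilinear_conv_bounded_bilinear)

lemma cross3_triple: "x \<^bold>\<times> (y \<^bold>\<times> z) = (x \<bullet> z) *\<^sub>R y - (x \<bullet> y) *\<^sub>R z" for x y z :: "real ^ 3"
  by (simp add: cross3_simps forall_3)

lemma norm_cross3_le: "norm (x \<^bold>\<times> y) \<le> norm x * norm y" for x y :: "real ^ 3"
proof -
  have "(norm (x \<^bold>\<times> y))\<^sup>2 \<le> (norm x * norm y)\<^sup>2"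
    using norm_cross_dot[of x y] zero_le_power2[of "x \<bullet> y"] by linarith
  then show ?thesis by (rule power2_le_imp_le) simp
qed

lemma sgn_eq_scaleR: "sgn x = (1 / norm x) *\<^sub>R x" for x :: "'a::real_normed_vector"
  by (simp add: sgn_div_norm divide_inverse)

text \<open>For a unit vector \<open>m\<close>, the rotation through \<open>pi\<close> about the
  axis \<open>m\<close>. Half-turns preserve orientation and so respect cross products, they are
  involutions, and they carry any unit vector to any other.\<close>

definition half_turn :: "real ^ 3 \<Rightarrow> real ^ 3 \<Rightarrow> real ^ 3" where
  "half_turn m x = (2 * (m \<bullet> x)) *\<^sub>R m - x"

lemma linear_half_turn: "linear (half_turn m)"
  by (rule linearI) (simp_all add: half_turn_def inner_add_right algebra_simps)

lemma half_turn_involution: "norm m = 1 \<Longrightarrow> half_turn m (half_turn m x) = x"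
  by (simp add: half_turn_def inner_diff_right dot_square_norm)

lemma inner_half_turn: "half_turn m x \<bullet> y = x \<bullet> half_turn m y"
  by (simp add: half_turn_def inner_diff_right inner_diff_left inner_commute)

lemma norm_half_turn: "norm m = 1 \<Longrightarrow> norm (half_turn m x) = norm x"
  unfolding norm_eq_sqrt_inner by (metis inner_half_turn half_turn_involution norm_eq_sqrt_inner)

lemma half_turn_cross: "norm m = 1 \<Longrightarrow> half_turn m (x \<^bold>\<times> y) = half_turn m x \<^bold>\<times> half_turn m y"
proof -
  assume m: "norm m = 1"
  \<comment> \<open>Both sides expand \<open>m \<times> (m \<times> (y \<times> x))\<close>.\<close>
  have 1: "(m \<bullet> x) *\<^sub>R (m \<^bold>\<times> y) - (m \<bullet> y) *\<^sub>R (m \<^bold>\<times> x) = (m \<bullet> m) *\<^sub>R (x \<^bold>\<times> y) - (m \<bullet> (x \<^bold>\<times> y)) *\<^sub>R m"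
    by (simp add: cross3_simps forall_3)
  have mm: "m \<bullet> m = 1" using m by (simp add: dot_square_norm)
  have "half_turn m x \<^bold>\<times> half_turn m y
      = x \<^bold>\<times> y - 2 *\<^sub>R ((m \<bullet> x) *\<^sub>R (m \<^bold>\<times> y) - (m \<bullet> y) *\<^sub>R (m \<^bold>\<times> x))"
    by (simp add: half_turn_def Cross3.left_diff_distrib Cross3.right_diff_distrib cross_mult_left cross_mult_right
        cross_skew[of x m] algebra_simps)
  also have "\<dots> = half_turn m (x \<^bold>\<times> y)"
    unfolding 1 half_turn_def mm by (simp add: vec_eq_iff algebra_simps)
  finally show ?thesis by simp
qed

text \<open>The axis bisects the two vectors. For antipodal ones the bisector vanishes, and any axis
  orthogonal to \<open>e\<close> serves.\<close>

lemma half_turn_transitive: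
  assumes "norm e = 1" "norm f = 1"
  shows "\<exists>m. norm m = 1 \<and> half_turn m e = f"
proof (cases "e + f = 0")
  case True
  obtain m where m: "m \<noteq> 0" "orthogonal e m"
    using orthogonal_to_vector_exists[of e] by auto
  then have "norm (sgn m) = 1" "sgn m \<bullet> e = 0"
    by (simp_all add: norm_sgn sgn_div_norm orthogonal_def inner_commute)
  moreover have "f = - e" using True by (simp add: add_eq_0_iff)
  ultimately show ?thesis by (intro exI[of _ "sgn m"]) (simp add: half_turn_def)
next
  case False
  let ?s = "e + f"
  have eq: "(norm ?s)\<^sup>2 = 2 * (?s \<bullet> e)"
  proof -
    have "e \<bullet> e = 1" "f \<bullet> f = 1" using assms by (simp_all add: dot_square_norm)
    then show ?thesis by (simp add: power2_norm_eq_inner inner_add_left inner_add_right inner_commute[of f e])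
  qed
  have q: "2 * (?s \<bullet> e) / (norm ?s)\<^sup>2 = 1" unfolding eq[symmetric] using False by simp
  have "half_turn (sgn s) e = (2 * (s \<bullet> e) / (norm s)\<^sup>2) *\<^sub>R s - e" for s
    by (simp add: half_turn_def sgn_eq_scaleR power2_eq_square)
  then have "half_turn (sgn ?s) e = 1 *\<^sub>R ?s - e" by (simp only: q)
  then have "half_turn (sgn ?s) e = f" by simp
  then show ?thesis using False by (intro exI[of _ "sgn ?s"]) (simp add: norm_sgn)
qed

lemma smooth_pair_conj:
  assumes D: "linear D" "\<And>x. norm (D x) = norm x" "\<And>x. D (D x) = x" and W: "smooth_pair W DW"
  shows "smooth_pair (\<lambda>x. D (W (D x))) (\<lambda>x v. D (DW (D x) (D v)))"
proof -
  obtain C where C: "taylor2 W DW C" using W by (auto simp: smooth_pair_def)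
  note lin = linear_diff[OF D(1), symmetric]
  have DS: "D x \<in> S2" if "x \<in> S2" for x using that D(2) by simp
  have nd: "norm (D x - D y) = norm (x - y)" for x y by (simp add: lin D(2))
  have "taylor2 (\<lambda>x. D (W (D x))) (\<lambda>x v. D (DW (D x) (D v))) C"
    unfolding taylor2_def
  proof (intro conjI ballI allI)
    show "linear (\<lambda>v. D (DW (D x) (D v)))" for x
      using linear_compose[OF D(1) linear_compose[OF taylor2D(1)[OF C] D(1)]] by (simp add: o_def)
    show "C \<ge> 0" by (rule taylor2D(2)[OF C])
    fix x y v assume xy: "x \<in> S2" "y \<in> S2"
    show "norm (D (W (D x))) \<le> C" using taylor2D(3)[OF C DS[OF xy(1)]] by (simp add: D(2))
    show "norm (D (DW (D x) (D v))) \<le> C * norm v" using taylor2D(4)[OF C DS[OF xy(1)], of "D v"] by (simp add: D(2))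
    show "norm (D (DW (D x) (D v)) - D (DW (D y) (D v))) \<le> C * norm (x - y) * norm v"
      using taylor2D(5)[OF C DS[OF xy(1)] DS[OF xy(2)], of "D v"] by (simp add: D(2) nd)
    show "norm (D (W (D y)) - D (W (D x)) - D (DW (D x) (D (y - x)))) \<le> C * (norm (y - x))\<^sup>2"
      using taylor2D(6)[OF C DS[OF xy(1)] DS[OF xy(2)]] unfolding lin D(2) nd .
  qed
  then show ?thesis by (auto simp: smooth_pair_def)
qed

lemma smooth_pair_inner: "smooth_pair (\<lambda>x. a \<bullet> x) (\<lambda>x v. a \<bullet> v)"
  by (rule smooth_pair_linear[OF bounded_linear_inner_right])

lemma smooth_pair_rotation: "smooth_pair (\<lambda>x. x \<^bold>\<times> b) (\<lambda>x v. v \<^bold>\<times> b)"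
  by (rule smooth_pair_linear[OF bounded_bilinear.bounded_linear_left[OF bounded_bilinear_cross3]])

lemma smooth_pair_mult:
  "smooth_pair f Df \<Longrightarrow> smooth_pair g Dg \<Longrightarrow> smooth_pair (\<lambda>x. f x * g x) (\<lambda>x v. f x * Dg x v + Df x v * g x)"
  for f g :: "real ^ 3 \<Rightarrow> real"
  by (rule smooth_pair_bilinear[OF bounded_bilinear_mult])

lemma smooth_pair_scaleR:
  "smooth_pair f Df \<Longrightarrow> smooth_pair g Dg \<Longrightarrow> smooth_pair (\<lambda>x. f x *\<^sub>R g x) (\<lambda>x v. f x *\<^sub>R Dg x v + Df x v *\<^sub>R g x)"
  by (rule smooth_pair_bilinear[OF bounded_bilinear_scaleR])

lemma smooth_pair_power:
  "smooth_pair (\<lambda>x. (c \<bullet> x) ^ n) (\<lambda>x v. of_nat n * (c \<bullet> x) ^ (n - 1) * (c \<bullet> v))"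
proof (induction n)
  case 0
  show ?case using smooth_pair_const[of "1 :: real"] by simp
next
  case (Suc n)
  have *: "(\<lambda>x v. (c \<bullet> x) * (of_nat n * (c \<bullet> x) ^ (n - 1) * (c \<bullet> v)) + (c \<bullet> v) * (c \<bullet> x) ^ n)
      = (\<lambda>x v. of_nat (Suc n) * (c \<bullet> x) ^ (Suc n - 1) * (c \<bullet> v))"
    by (intro ext) (cases n; simp add: algebra_simps)
  show ?case using smooth_pair_mult[OF smooth_pair_inner[of c] Suc] by (simp only: * power_Suc)
qed

context sphere_monoid begin

text \<open>
  Only fields whose flow is reachable have this property a priori; being linear in \<open>V\<close> and invariant
  under half-turns, it passes to their rotated averages.
\<close>

definition bracket_stable :: "(real ^ 3 \<Rightarrow> real ^ 3) \<Rightarrow> (real ^ 3 \<Rightarrow> real ^ 3 \<Rightarrow> real ^ 3) \<Rightarrow> bool" where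
  "bracket_stable V DV \<longleftrightarrow> smooth_pair V DV \<and> accessible V \<and>
     (\<forall>W DW. smooth_pair W DW \<longrightarrow> accessible W \<longrightarrow> accessible (\<lambda>x. DW x (V x) - DV x (W x)))"

lemma bracket_stableD:
  assumes "bracket_stable V DV"
  shows "smooth_pair V DV" "accessible V"
    "smooth_pair W DW \<Longrightarrow> accessible W \<Longrightarrow> accessible (\<lambda>x. DW x (V x) - DV x (W x))"
  using assms by (auto simp: bracket_stable_def)

lemma bracket_stable_local_flow: "local_flow V \<tau> \<Phi> \<Longrightarrow> smooth_pair V DV \<Longrightarrow> bracket_stable V DV"
  unfolding bracket_stable_def using accessible_bracket local_flow_tangent unfolding smooth_pair_def by blast

lemma smooth_pair_linearD: "smooth_pair W DW \<Longrightarrow> linear (DW x)"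
  unfolding smooth_pair_def taylor2_def by blast

lemma bracket_stable_add:
  assumes V: "bracket_stable V DV" and U: "bracket_stable U DU"
  shows "bracket_stable (\<lambda>x. V x + U x) (\<lambda>x v. DV x v + DU x v)"
  unfolding bracket_stable_def
proof (intro conjI allI impI smooth_pair_add accessible_add bracket_stableD(1,2)[OF V] bracket_stableD(1,2)[OF U])
  fix W DW assume W: "smooth_pair W DW" "accessible W"
  have "DW x (V x + U x) - (DV x (W x) + DU x (W x)) = (DW x (V x) - DV x (W x)) + (DW x (U x) - DU x (W x))" for x
    by (simp add: linear_add[OF smooth_pair_linearD[OF W(1)]])
  then show "accessible (\<lambda>x. DW x (V x + U x) - (DV x (W x) + DU x (W x)))"
    using accessible_add[OF bracket_stableD(3)[OF V W] bracket_stableD(3)[OF U W]] by presburger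
qed

lemma bracket_stable_scale:
  assumes V: "bracket_stable V DV"
  shows "bracket_stable (\<lambda>x. r *\<^sub>R V x) (\<lambda>x v. r *\<^sub>R DV x v)"
  unfolding bracket_stable_def
proof (intro conjI allI impI accessible_scale bracket_stableD(1,2)[OF V])
  show "smooth_pair (\<lambda>x. r *\<^sub>R V x) (\<lambda>x v. r *\<^sub>R DV x v)"
    using smooth_pair_scaleR[OF smooth_pair_const[of r] bracket_stableD(1)[OF V]] by simp
  fix W DW assume W: "smooth_pair W DW" "accessible W"
  have "DW x (r *\<^sub>R V x) - r *\<^sub>R DV x (W x) = r *\<^sub>R (DW x (V x) - DV x (W x))" for x
    by (simp add: linear_cmul[OF smooth_pair_linearD[OF W(1)]] scaleR_diff_right)
  then show "accessible (\<lambda>x. DW x (r *\<^sub>R V x) - r *\<^sub>R DV x (W x))"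
    using accessible_scale[OF bracket_stableD(3)[OF V W]] by simp
qed

lemma bracket_stable_cong: "bracket_stable V DV \<Longrightarrow> (\<And>x. V x = U x) \<Longrightarrow> (\<And>x v. DV x v = DU x v) \<Longrightarrow> bracket_stable U DU"
  by (metis ext)

text \<open>Conjugation commutes with brackets: the bracket of the conjugated field with
  \<open>W\<close> is the conjugate of the bracket of \<open>V\<close> with the conjugated
  \<open>W\<close>.\<close>

lemma bracket_stable_conj:
  assumes V: "bracket_stable V DV" and D: "D \<in> M" "linear D" "\<And>x. norm (D x) = norm x" "\<And>x. D (D x) = x"
  shows "bracket_stable (\<lambda>x. D (V (D x))) (\<lambda>x v. D (DV (D x) (D v)))"
  unfolding bracket_stable_def
proof (intro conjI allI impI)
  show "smooth_pair (\<lambda>x. D (V (D x))) (\<lambda>x v. D (DV (D x) (D v)))"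
    by (rule smooth_pair_conj[OF D(2-4) bracket_stableD(1)[OF V]])
  show "accessible (\<lambda>x. D (V (D x)))" by (rule accessible_conj[OF bracket_stableD(2)[OF V] D])
  fix W DW assume W: "smooth_pair W DW" "accessible W"
  have "accessible (\<lambda>x. D (DW (D x) (D (V x))) - DV x (D (W (D x))))"
    by (rule bracket_stableD(3)[OF V smooth_pair_conj[OF D(2-4) W(1)] accessible_conj[OF W(2) D]])
  from accessible_conj[OF this D]
  show "accessible (\<lambda>x. DW x (D (V (D x))) - D (DV (D x) (D (W x))))"
    by (simp add: linear_diff[OF D(2)] D(4))
qed

end

text \<open>For symmetric \<open>A\<close> the field \<open>x \<times> A x\<close> is the
  Hamiltonian field of the quadratic form of \<open>A / 2\<close>, which is harmonic when
  \<open>A\<close> is traceless; \<open>e\<close> witnesses that it does not vanish. On the sphere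
  \<open>x \<times> (x \<times> k)\<close> equals \<open>\<langle>k, x\<rangle> x - k\<close>, minus
  the gradient field of \<open>\<langle>k, x\<rangle>\<close>.\<close>

locale rich_sphere_monoid = sphere_monoid +
  fixes A :: "real ^ 3 ^ 3" and e k :: "real ^ 3"
  assumes half_turn_mem: "norm m = 1 \<Longrightarrow> half_turn m \<in> M"
    and bracket_stable_rotation: "bracket_stable (\<lambda>x. x \<^bold>\<times> b) (\<lambda>x v. v \<^bold>\<times> b)"
    and bracket_stable_quadratic: "bracket_stable (\<lambda>x. x \<^bold>\<times> (A *v x)) (\<lambda>x v. v \<^bold>\<times> (A *v x) + x \<^bold>\<times> (A *v v))"
    and traceless: "trace A = 0" and unit_e: "norm e = 1" and nonzero_e: "e \<bullet> (A *v e) \<noteq> 0"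
    and bracket_stable_gradient: "bracket_stable (\<lambda>x. x \<^bold>\<times> (x \<^bold>\<times> k)) (\<lambda>x v. v \<^bold>\<times> (x \<^bold>\<times> k) + x \<^bold>\<times> (v \<^bold>\<times> k))"
    and nonzero_k: "k \<noteq> 0"
begin

lemma bracket_stable_half_turn:
  assumes "bracket_stable V DV" "norm m = 1"
  shows "bracket_stable (\<lambda>x. half_turn m (V (half_turn m x))) (\<lambda>x v. half_turn m (DV (half_turn m x) (half_turn m v)))"
  by (rule bracket_stable_conj[OF assms(1) half_turn_mem[OF assms(2)] linear_half_turn norm_half_turn[OF assms(2)] half_turn_involution[OF assms(2)]])

text \<open>In the form \<open>x \<times> a x\<close> multiples of the identity in \<open>a\<close>
  are invisible, and half-turns act by conjugating the operator \<open>a\<close>.\<close>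

abbreviation bracket_stable_operator :: "(real ^ 3 \<Rightarrow> real ^ 3) \<Rightarrow> bool" where
  "bracket_stable_operator a \<equiv> bracket_stable (\<lambda>x. x \<^bold>\<times> a x) (\<lambda>x v. v \<^bold>\<times> a x + x \<^bold>\<times> a v)"

lemma bracket_stable_operator_add: "bracket_stable_operator a \<Longrightarrow> bracket_stable_operator b \<Longrightarrow> bracket_stable_operator (\<lambda>x. a x + b x)"
  by (erule (1) bracket_stable_cong[OF bracket_stable_add]) (simp_all add: cross_add_right)

lemma bracket_stable_operator_cong: "bracket_stable_operator a \<Longrightarrow> (\<And>x. a x = b x) \<Longrightarrow> bracket_stable_operator b"
  by (erule bracket_stable_cong) simp_all

lemma bracket_stable_operator_half_turn:
  assumes "bracket_stable_operator a" "norm m = 1"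
  shows "bracket_stable_operator (\<lambda>x. half_turn m (a (half_turn m x)))"
  by (rule bracket_stable_cong[OF bracket_stable_half_turn[OF assms]])
    (simp_all add: linear_add[OF linear_half_turn] half_turn_cross[OF assms(2)] half_turn_involution[OF assms(2)])

text \<open>
  Conjugating with the three coordinate half-turns and averaging makes \<open>A\<close> diagonal, averaging with the half-turn
  that swaps two axes makes it axially symmetric, and tracelessness leaves a nonzero multiple of \<open>e\<^sub>3 e\<^sub>3\<^sup>T\<close> plus a multiple
  of the identity, whose field vanishes.
\<close>

lemma bracket_stable_zonal_unit:
  assumes "norm b = 1"
  shows "bracket_stable (\<lambda>x. (b \<bullet> x) *\<^sub>R (x \<^bold>\<times> b)) (\<lambda>x v. (b \<bullet> v) *\<^sub>R (x \<^bold>\<times> b) + (b \<bullet> x) *\<^sub>R (v \<^bold>\<times> b))"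
proof -
  define e1 e2 e3 :: "real ^ 3" where e: "e1 = axis 1 1" "e2 = axis 2 1" "e3 = axis 3 1"
  have n: "norm e1 = 1" "norm e2 = 1" "norm e3 = 1" by (simp_all add: e)
  \<comment> \<open>The half-turn about this bisector exchanges the first two axes and reverses the
    third, so conjugation with it swaps the first two diagonal entries.\<close>
  define e12 :: "real ^ 3" where "e12 = (1 / sqrt 2) *\<^sub>R (e1 + e2)"
  have swap: "half_turn e12 x = vector [x $ 2, x $ 1, - (x $ 3)]" for x
    by (simp add: half_turn_def e12_def e vec_eq_iff forall_3 inner_vec_def sum_3 axis_def field_simps)
  have n12: "norm e12 = 1"
    by (simp add: e12_def e norm_vec_def L2_set_def sum_3 axis_def power_divide)
  have flip: "half_turn e1 x = vector [x $ 1, - (x $ 2), - (x $ 3)]"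
     "half_turn e2 x = vector [- (x $ 1), x $ 2, - (x $ 3)]"
     "half_turn e3 x = vector [- (x $ 1), - (x $ 2), x $ 3]" for x
    by (simp_all add: half_turn_def e vec_eq_iff forall_3 inner_vec_def sum_3 axis_def)
  \<comment> \<open>Moving the witness \<open>e\<close> to the third axis makes the entry
    \<open>B $ 3 $ 3\<close> nonzero.\<close>
  obtain m where m: "norm m = 1" "half_turn m e3 = e" using half_turn_transitive[OF n(3) unit_e] by blast
  define H where "H = matrix (half_turn m)"
  have H: "half_turn m x = H *v x" for x
    unfolding H_def by (simp add: matrix_works linear_matrix_vector_mul_eq linear_half_turn)
  define B where "B = H ** A ** H"
  have HH: "H ** H = mat 1"
    by (rule matrix_eq[THEN iffD2]) (simp add: H[symmetric] half_turn_involution[OF m(1)] matrix_vector_mul_assoc[symmetric])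
  have tB: "trace B = 0"
    unfolding B_def using traceless by (metis HH matrix_mul_assoc matrix_mul_rid trace_mul_sym)
  have "e3 \<bullet> (B *v e3) = e \<bullet> (A *v e)"
    unfolding B_def matrix_vector_mul_assoc[symmetric] H[symmetric] inner_half_turn[symmetric] m(2) ..
  then have B3: "B $ 3 $ 3 \<noteq> 0"
    using nonzero_e by (simp add: e inner_axis' matrix_vector_mult_basis column_def)
  have "bracket_stable_operator (\<lambda>x. B *v x)"
    using bracket_stable_operator_half_turn[OF bracket_stable_quadratic m(1)]
    by (simp add: H B_def matrix_vector_mul_assoc matrix_mul_assoc)
  note gB = this bracket_stable_operator_half_turn[OF this n(1)] bracket_stable_operator_half_turn[OF this n(2)] bracket_stable_operator_half_turn[OF this n(3)]
  define d where "d a b c x = (vector [a * x $ 1, b * x $ 2, c * x $ 3] :: real ^ 3)" for a b c :: real and x :: "real ^ 3"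
  have s1: "bracket_stable_operator (\<lambda>x. (B *v x + half_turn e1 (B *v half_turn e1 x)) + (half_turn e2 (B *v half_turn e2 x) + half_turn e3 (B *v half_turn e3 x)))"
    by (intro bracket_stable_operator_add gB)
  \<comment> \<open>Each off-diagonal entry keeps its sign in two of the four conjugates, the
    identity included, and changes it in the other two; the diagonal survives with the factor
    4.\<close>
  have s2: "(\<lambda>x. (B *v x + half_turn e1 (B *v half_turn e1 x)) + (half_turn e2 (B *v half_turn e2 x) + half_turn e3 (B *v half_turn e3 x)))
     = d (4 * B $ 1 $ 1) (4 * B $ 2 $ 2) (4 * B $ 3 $ 3)"
    by (rule ext) (simp add: flip d_def vec_eq_iff forall_3 matrix_vector_mult_def sum_3)
  have g1: "bracket_stable_operator (d (4 * B $ 1 $ 1) (4 * B $ 2 $ 2) (4 * B $ 3 $ 3))"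
    by (rule bracket_stable_operator_cong[OF s1 fun_cong[OF s2]])
  let ?\<beta> = "B $ 3 $ 3"
  have tr: "B $ 1 $ 1 + B $ 2 $ 2 = - ?\<beta>" using tB by (simp add: trace_def sum_3)
  \<comment> \<open>By tracelessness the symmetrised diagonal is
    \<open>(-4 \<beta>, -4 \<beta>, 8 \<beta>)\<close>: the projection to the third axis with weight
    \<open>12 \<beta>\<close>, minus \<open>4 \<beta>\<close> times the identity.\<close>
  have dd: "(\<lambda>x. d (4 * B $ 1 $ 1) (4 * B $ 2 $ 2) (4 * ?\<beta>) x + half_turn e12 (d (4 * B $ 1 $ 1) (4 * B $ 2 $ 2) (4 * ?\<beta>) (half_turn e12 x)))
     = (\<lambda>x. (12 * ?\<beta> * (e3 \<bullet> x)) *\<^sub>R e3 - (4 * ?\<beta>) *\<^sub>R x)"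
  proof
    fix x
    have "4 * B $ 1 $ 1 * y + 4 * B $ 2 $ 2 * y = - (4 * ?\<beta> * y)" for y
    proof -
      have "4 * B $ 1 $ 1 * y + 4 * B $ 2 $ 2 * y = 4 * (B $ 1 $ 1 + B $ 2 $ 2) * y" by (simp add: algebra_simps)
      then show ?thesis unfolding tr by simp
    qed
    then show "d (4 * B $ 1 $ 1) (4 * B $ 2 $ 2) (4 * ?\<beta>) x + half_turn e12 (d (4 * B $ 1 $ 1) (4 * B $ 2 $ 2) (4 * ?\<beta>) (half_turn e12 x))
      = (12 * ?\<beta> * (e3 \<bullet> x)) *\<^sub>R e3 - (4 * ?\<beta>) *\<^sub>R x"
      by (simp add: swap d_def e vec_eq_iff forall_3 inner_vec_def sum_3 axis_def add.commute)
  qed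
  have g2: "bracket_stable_operator (\<lambda>x. (12 * ?\<beta> * (e3 \<bullet> x)) *\<^sub>R e3 - (4 * ?\<beta>) *\<^sub>R x)"
    by (rule bracket_stable_operator_cong[OF bracket_stable_operator_add[OF g1 bracket_stable_operator_half_turn[OF g1 n12]] fun_cong[OF dd]])
  have g3: "bracket_stable (\<lambda>x. (e3 \<bullet> x) *\<^sub>R (x \<^bold>\<times> e3)) (\<lambda>x v. (e3 \<bullet> v) *\<^sub>R (x \<^bold>\<times> e3) + (e3 \<bullet> x) *\<^sub>R (v \<^bold>\<times> e3))"
  proof (rule bracket_stable_cong[OF bracket_stable_scale[OF g2, of "1 / (12 * ?\<beta>)"]])
    show "(1 / (12 * ?\<beta>)) *\<^sub>R (x \<^bold>\<times> ((12 * ?\<beta> * (e3 \<bullet> x)) *\<^sub>R e3 - (4 * ?\<beta>) *\<^sub>R x)) = (e3 \<bullet> x) *\<^sub>R (x \<^bold>\<times> e3)" for x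
      using B3 by (simp add: Cross3.right_diff_distrib cross_mult_right)
    show "(1 / (12 * ?\<beta>)) *\<^sub>R (v \<^bold>\<times> ((12 * ?\<beta> * (e3 \<bullet> x)) *\<^sub>R e3 - (4 * ?\<beta>) *\<^sub>R x) +
          x \<^bold>\<times> ((12 * ?\<beta> * (e3 \<bullet> v)) *\<^sub>R e3 - (4 * ?\<beta>) *\<^sub>R v)) = (e3 \<bullet> v) *\<^sub>R (x \<^bold>\<times> e3) + (e3 \<bullet> x) *\<^sub>R (v \<^bold>\<times> e3)" for x v
      using B3 by (simp add: Cross3.right_diff_distrib cross_mult_right scaleR_add_right scaleR_diff_right cross_skew[of v x])
  qed
  obtain m' where m': "norm m' = 1" "half_turn m' e3 = b" using half_turn_transitive[OF n(3) assms] by blast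
  show ?thesis
    by (rule bracket_stable_cong[OF bracket_stable_half_turn[OF g3 m'(1)]])
      (simp_all add: linear_add[OF linear_half_turn] linear_cmul[OF linear_half_turn] half_turn_cross[OF m'(1)]
        half_turn_involution[OF m'(1)] m'(2) inner_half_turn[symmetric])
qed

lemma bracket_stable_zonal: "bracket_stable (\<lambda>x. (b \<bullet> x) *\<^sub>R (x \<^bold>\<times> b)) (\<lambda>x v. (b \<bullet> v) *\<^sub>R (x \<^bold>\<times> b) + (b \<bullet> x) *\<^sub>R (v \<^bold>\<times> b))"
proof (cases "b = 0")
  case True
  then show ?thesis using bracket_stable_scale[OF bracket_stable_rotation, of 0 0] by simp
next
  case False
  then have "norm (sgn b) = 1" by (simp add: norm_sgn)
  from bracket_stable_scale[OF bracket_stable_zonal_unit[OF this], of "norm b * norm b"] show ?thesis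
    by (rule bracket_stable_cong) (use False in \<open>simp_all add: sgn_eq_scaleR cross_mult_right scaleR_add_right\<close>)
qed

text \<open>A half-turn takes the direction of \<open>k\<close> to that of \<open>b\<close>, and
  linearity in \<open>b\<close> adjusts the length.\<close>

lemma bracket_stable_gradient_all: "bracket_stable (\<lambda>x. x \<^bold>\<times> (x \<^bold>\<times> b)) (\<lambda>x v. v \<^bold>\<times> (x \<^bold>\<times> b) + x \<^bold>\<times> (v \<^bold>\<times> b))"
proof (cases "b = 0")
  case True
  then show ?thesis using bracket_stable_scale[OF bracket_stable_rotation, of 0 0] by simp
next
  case False
  have n: "norm (sgn k) = 1" "norm (sgn b) = 1" using False nonzero_k by (auto simp: norm_sgn)
  obtain m where m: "norm m = 1" "half_turn m (sgn k) = sgn b" using half_turn_transitive[OF n] by blast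
  have "half_turn m k = norm k *\<^sub>R sgn b"
    using m(2) nonzero_k by (metis linear_cmul[OF linear_half_turn] norm_scaleR scaleR_scaleR sgn_div_norm divideR_right norm_eq_zero)
  then have hk: "half_turn m k = (norm k / norm b) *\<^sub>R b" by (simp add: sgn_div_norm divide_inverse)
  show ?thesis
    by (rule bracket_stable_cong[OF bracket_stable_scale[OF bracket_stable_half_turn[OF bracket_stable_gradient m(1)], of "norm b / norm k"]])
      (use False nonzero_k in \<open>simp_all add: linear_add[OF linear_half_turn] half_turn_cross[OF m(1)]
        half_turn_involution[OF m(1)] hk cross_mult_right scaleR_add_right\<close>)
qed

text \<open>
  \<open>\<langle>a, x\<rangle> x \<times> b\<close> is half the sum of its symmetric part in \<open>a\<close>, \<open>b\<close>, a polarised zonal field, and its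
  antisymmetric part, the gradient field \<open>x \<times> (x \<times> (b \<times> a))\<close>.
\<close>

lemma bracket_stable_linear:
  "bracket_stable (\<lambda>x. (a \<bullet> x) *\<^sub>R (x \<^bold>\<times> b)) (\<lambda>x v. (a \<bullet> v) *\<^sub>R (x \<^bold>\<times> b) + (a \<bullet> x) *\<^sub>R (v \<^bold>\<times> b))"
proof -
  have anti: "(a \<bullet> x) *\<^sub>R (y \<^bold>\<times> b) - (b \<bullet> x) *\<^sub>R (y \<^bold>\<times> a) = y \<^bold>\<times> (x \<^bold>\<times> (b \<^bold>\<times> a))" for x y
    by (simp add: cross3_triple Cross3.right_diff_distrib cross_mult_right inner_commute)
  note Z = bracket_stable_zonal[of "a + b"] bracket_stable_scale[OF bracket_stable_add[OF bracket_stable_zonal[of a] bracket_stable_zonal[of b]], of "-1"]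
  note G = bracket_stable_scale[OF bracket_stable_add[OF bracket_stable_add[OF Z] bracket_stable_gradient_all[of "b \<^bold>\<times> a"]], of "1/2"]
  show ?thesis
    by (rule bracket_stable_cong[OF G]) (simp_all add: anti[symmetric] inner_add_left cross_add_right vec_eq_iff algebra_simps)
qed

end

section \<open>Accessibility of all continuous tangent fields\<close>

text \<open>Multiplying the expansion for \<open>n\<close> by \<open>u + s * w\<close> adds to the
  old remainder a single new term of order \<open>s\<^sup>2\<close>. The bound is uniform in
  \<open>u\<close> and \<open>w\<close>, as \<open>accessible_parameter_derivative\<close>
  demands.\<close>

lemma power_linear_remainder:
  "\<exists>K\<ge>0. \<forall>u w s :: real. \<bar>u\<bar> \<le> B \<longrightarrow> \<bar>w\<bar> \<le> B \<longrightarrow> \<bar>s\<bar> \<le> 1 \<longrightarrow>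
     \<bar>(u + s * w) ^ n - u ^ n - s * (of_nat n * u ^ (n - 1) * w)\<bar> \<le> K * s\<^sup>2"
proof (induction n)
  case 0
  show ?case by (intro exI[of _ 0]) auto
next
  case (Suc n)
  then obtain K where K: "K \<ge> 0" "\<And>u w s :: real. \<bar>u\<bar> \<le> B \<Longrightarrow> \<bar>w\<bar> \<le> B \<Longrightarrow> \<bar>s\<bar> \<le> 1 \<Longrightarrow>
     \<bar>(u + s * w) ^ n - u ^ n - s * (of_nat n * u ^ (n - 1) * w)\<bar> \<le> K * s\<^sup>2" by blast
  let ?b = "\<bar>B\<bar>"
  define L where "L = of_nat n * ?b ^ (n - 1) * (?b * ?b) + 2 * ?b * K"
  have "\<bar>(u + s * w) ^ Suc n - u ^ Suc n - s * (of_nat (Suc n) * u ^ (Suc n - 1) * w)\<bar> \<le> L * s\<^sup>2"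
    if a: "\<bar>u\<bar> \<le> B" "\<bar>w\<bar> \<le> B" "\<bar>s\<bar> \<le> 1" for u w s :: real
  proof -
    define r where "r = (u + s * w) ^ n - u ^ n - s * (of_nat n * u ^ (n - 1) * w)"
    have r: "\<bar>r\<bar> \<le> K * s\<^sup>2" using K(2)[OF a] by (simp add: r_def)
    have ab: "\<bar>u\<bar> \<le> ?b" "\<bar>w\<bar> \<le> ?b" using a by auto
    \<comment> \<open>For \<open>n = 0\<close> the exponent \<open>n - 1\<close> truncates to
      \<open>0\<close>; the factor \<open>of_nat n\<close> then makes both sides vanish.\<close>
    have un: "of_nat n * (u * u ^ (n - 1)) = of_nat n * u ^ n" by (cases n) auto
    have "(u + s * w) ^ Suc n = (u + s * w) * (r + u ^ n + s * (of_nat n * u ^ (n - 1) * w))"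
      by (simp add: r_def)
    also have "\<dots> = (u + s * w) * r + u ^ Suc n + s * (w * u ^ n) + s * w * (of_nat n * (u * u ^ (n - 1)))
        + s\<^sup>2 * (of_nat n * u ^ (n - 1) * (w * w))"
      by (simp add: algebra_simps power2_eq_square)
    finally have "(u + s * w) ^ Suc n - u ^ Suc n - s * (of_nat (Suc n) * u ^ (Suc n - 1) * w)
        = (u + s * w) * r + s\<^sup>2 * (of_nat n * u ^ (n - 1) * (w * w))"
      unfolding un by (simp add: algebra_simps)
    also have "\<bar>\<dots>\<bar> \<le> (2 * ?b) * (K * s\<^sup>2) + s\<^sup>2 * (of_nat n * ?b ^ (n - 1) * (?b * ?b))"
    proof (rule order_trans[OF abs_triangle_ineq add_mono])
      have "\<bar>s * w\<bar> \<le> 1 * ?b" unfolding abs_mult by (intro mult_mono ab a) auto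
      then have "\<bar>u + s * w\<bar> \<le> 2 * ?b" using ab(1) abs_triangle_ineq[of u "s * w"] by linarith
      then show "\<bar>(u + s * w) * r\<bar> \<le> (2 * ?b) * (K * s\<^sup>2)" unfolding abs_mult by (intro mult_mono r) auto
      have "\<bar>u ^ (n - 1) * (w * w)\<bar> \<le> ?b ^ (n - 1) * (?b * ?b)"
        unfolding abs_mult power_abs by (intro mult_mono power_mono ab) auto
      then have "of_nat n * \<bar>u ^ (n - 1) * (w * w)\<bar> \<le> of_nat n * (?b ^ (n - 1) * (?b * ?b))"
        by (intro mult_left_mono) auto
      then have "s\<^sup>2 * (of_nat n * \<bar>u ^ (n - 1) * (w * w)\<bar>) \<le> s\<^sup>2 * (of_nat n * (?b ^ (n - 1) * (?b * ?b)))"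
        by (rule mult_left_mono) simp
      then show "\<bar>s\<^sup>2 * (of_nat n * u ^ (n - 1) * (w * w))\<bar> \<le> s\<^sup>2 * (of_nat n * ?b ^ (n - 1) * (?b * ?b))"
        by (simp only: abs_mult[of "s\<^sup>2"] mult.assoc abs_mult[of "of_nat n"] abs_of_nat abs_power2)
    qed
    also have "\<dots> = L * s\<^sup>2" by (simp add: L_def algebra_simps)
    finally show ?thesis .
  qed
  moreover have "L \<ge> 0" using K by (simp add: L_def)
  ultimately show ?case by blast
qed

text \<open>Powers of single linear forms are not closed under products, whereas exponentials
  multiply by adding exponents. That gives the algebra which Stone--Weierstrass requires.\<close>

inductive_set exponential_span :: "(real ^ 3 \<Rightarrow> real) set" where
  exp: "(\<lambda>x. r * exp (c \<bullet> x)) \<in> exponential_span"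
| add: "f \<in> exponential_span \<Longrightarrow> g \<in> exponential_span \<Longrightarrow> (\<lambda>x. f x + g x) \<in> exponential_span"

lemma exponential_span_mult:
  assumes "f \<in> exponential_span" "g \<in> exponential_span"
  shows "(\<lambda>x. f x * g x) \<in> exponential_span"
  using assms(1)
proof induction
  case (exp r c)
  show ?case using assms(2)
  proof induction
    case (exp s d)
    have "(\<lambda>x. r * exp (c \<bullet> x) * (s * exp (d \<bullet> x))) = (\<lambda>x. (r * s) * exp ((c + d) \<bullet> x))"
      by (simp add: inner_add_left exp_add mult_ac)
    then show ?case by (simp only: exponential_span.exp)
  next
    case (add f g)
    then show ?case using exponential_span.add by (simp add: distrib_left)
  qed
next
  case (add f1 f2)
  then show ?case using exponential_span.add by (simp add: distrib_right)
qed

lemma exponential_span_dense: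
  assumes "continuous_on S2 f" "\<epsilon> > 0"
  shows "\<exists>g\<in>exponential_span. \<forall>x\<in>S2. \<bar>f x - g x\<bar> < \<epsilon>"
proof -
  interpret function_ring_on exponential_span S2
  proof
    show "compact S2" by simp
    show "continuous_on S2 f" if "f \<in> exponential_span" for f
      using that by induction (intro continuous_intros | assumption)+
    show "(\<lambda>x. f x + g x) \<in> exponential_span" if "f \<in> exponential_span" "g \<in> exponential_span" for f g
      using that by (rule exponential_span.add)
    show "(\<lambda>x. f x * g x) \<in> exponential_span" if "f \<in> exponential_span" "g \<in> exponential_span" for f g
      using that by (rule exponential_span_mult)
    show "(\<lambda>_. c) \<in> exponential_span" for c using exponential_span.exp[of c 0] by simp
    show "\<exists>f\<in>exponential_span. f x \<noteq> f y" if "x \<noteq> y" for x y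
    proof (rule bexI)
      have "(x - y) \<bullet> x \<noteq> (x - y) \<bullet> y"
        using that by (metis inner_diff_right inner_eq_zero_iff right_minus_eq)
      then show "1 * exp ((x - y) \<bullet> x) \<noteq> 1 * exp ((x - y) \<bullet> y)" by simp
    qed (rule exponential_span.exp)
  qed
  show ?thesis using Stone_Weierstrass_basic[OF assms] by simp
qed

lemma exp_partial_sums_uniform:
  fixes B \<epsilon> :: real
  assumes "\<epsilon> > 0"
  shows "\<exists>n. \<forall>u. \<bar>u\<bar> \<le> B \<longrightarrow> \<bar>(\<Sum>k<n. u ^ k / fact k) - exp u\<bar> \<le> \<epsilon>"
proof -
  have "uniform_limit {-B..B} (\<lambda>n u. \<Sum>k<n. u ^ k / fact k) (\<lambda>u. suminf (\<lambda>k. u ^ k / fact k)) sequentially"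
  proof (rule Weierstrass_m_test)
    show "norm (u ^ k / fact k) \<le> B ^ k / fact k" if "u \<in> {-B..B}" for k u
      using that by (auto simp: power_abs intro!: divide_right_mono power_mono)
    show "summable (\<lambda>k. B ^ k / fact k)" using summable_exp[of B] by (simp add: divide_inverse mult.commute)
  qed
  then have "\<forall>\<^sub>F n in sequentially. \<forall>u\<in>{-B..B}. dist (\<Sum>k<n. u ^ k / fact k) (suminf (\<lambda>k. u ^ k / fact k)) < \<epsilon>"
    using assms by (rule uniform_limitD)
  from eventually_happens'[OF sequentially_bot this]
  obtain n where "\<forall>u\<in>{-B..B}. dist (\<Sum>k<n. u ^ k / fact k) (suminf (\<lambda>k. u ^ k / fact k)) < \<epsilon>"
    by blast
  then have n: "\<bar>(\<Sum>k<n. u ^ k / fact k) - (suminf (\<lambda>k. u ^ k / fact k))\<bar> < \<epsilon>" if "\<bar>u\<bar> \<le> B" for u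
    using that by (auto simp: dist_real_def abs_le_iff)
  have "(suminf (\<lambda>k. u ^ k / fact k)) = exp u" for u :: real by (simp add: exp_def divide_inverse mult.commute)
  then show ?thesis using n by (intro exI[of _ n]) (metis less_imp_le)
qed

lemma fraction_bound: "\<epsilon> > 0 \<Longrightarrow> b \<ge> 0 \<Longrightarrow> \<epsilon> / (b + 1) * b \<le> \<epsilon>" for \<epsilon> b :: real
  by (simp add: pos_divide_le_eq algebra_simps)

text \<open>The bracket of \<open>accessible_ridge_aligned_step\<close> with \<open>X\<close> for
  \<open>x \<times> g\<close> and opaque letters for the scalar functions, which reduces it to
  linear algebra. As \<open>X\<close> is orthogonal to \<open>g\<close>, the derivative of the power
  \<open>G\<close> drops out.\<close>

lemma linear_bracket_linear:
  assumes "g \<bullet> X = 0"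
  shows "(G * \<phi>) *\<^sub>R ((\<alpha> *\<^sub>R X) \<^bold>\<times> g) + (G * (f \<bullet> (\<alpha> *\<^sub>R X)) + (r * (g \<bullet> (\<alpha> *\<^sub>R X))) * \<phi>) *\<^sub>R X
     - ((a \<bullet> ((G * \<phi>) *\<^sub>R X)) *\<^sub>R X + \<alpha> *\<^sub>R (((G * \<phi>) *\<^sub>R X) \<^bold>\<times> g)) = (G * (\<alpha> * (f \<bullet> X) - \<phi> * (a \<bullet> X))) *\<^sub>R X"
  by (simp add: assms cross_mult_left vec_eq_iff algebra_simps)

text \<open>The bracket of \<open>accessible_ridge_step\<close>, with \<open>X\<close> for
  \<open>x \<times> b\<close> and \<open>Y\<close> for \<open>x \<times> c\<close>.\<close>

lemma linear_bracket_ridge: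
  assumes "c \<bullet> Y = 0"
  shows "P *\<^sub>R ((\<gamma> *\<^sub>R X) \<^bold>\<times> c) + (N * Q * (c \<bullet> (\<gamma> *\<^sub>R X))) *\<^sub>R Y
     - ((c \<bullet> (P *\<^sub>R Y)) *\<^sub>R X + \<gamma> *\<^sub>R ((P *\<^sub>R Y) \<^bold>\<times> b))
     = (N * (Q * \<gamma>) * (c \<bullet> X)) *\<^sub>R Y + (\<gamma> * P) *\<^sub>R (X \<^bold>\<times> c - Y \<^bold>\<times> b)"
  by (simp add: assms cross_mult_left vec_eq_iff algebra_simps)

section \<open>Raising the degree of the ridge fields\<close>

context rich_sphere_monoid begin

lemma bracket_linear:
  assumes "smooth_pair W DW" "accessible W"
  shows "accessible (\<lambda>x. DW x ((a \<bullet> x) *\<^sub>R (x \<^bold>\<times> b)) - ((a \<bullet> W x) *\<^sub>R (x \<^bold>\<times> b) + (a \<bullet> x) *\<^sub>R (W x \<^bold>\<times> b)))"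
  by (rule bracket_stableD(3)[OF bracket_stable_linear assms])

lemma inner_le_norm_S2: "x \<in> S2 \<Longrightarrow> \<bar>c \<bullet> x\<bar> \<le> norm c"
  using Cauchy_Schwarz_ineq2[of c x] by simp

text \<open>Differentiating \<open>\<langle>c + s a, x\<rangle>^n\<close> at \<open>s = 0\<close>
  and dividing by \<open>n\<close> frees one of the linear factors.\<close>

lemma accessible_ridge_polarized:
  assumes "\<And>c. accessible (\<lambda>x. (c \<bullet> x) ^ n *\<^sub>R (x \<^bold>\<times> b))" "n \<ge> 1"
  shows "accessible (\<lambda>x. ((c \<bullet> x) ^ (n - 1) * (a \<bullet> x)) *\<^sub>R (x \<^bold>\<times> b))"
proof -
  define B where "B = max (norm c) (norm a)"
  obtain K where K: "K \<ge> 0" "\<And>u w s :: real. \<bar>u\<bar> \<le> B \<Longrightarrow> \<bar>w\<bar> \<le> B \<Longrightarrow> \<bar>s\<bar> \<le> 1 \<Longrightarrow>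
     \<bar>(u + s * w) ^ n - u ^ n - s * (of_nat n * u ^ (n - 1) * w)\<bar> \<le> K * s\<^sup>2"
    using power_linear_remainder[of B n] by blast
  have "accessible (\<lambda>x. (of_nat n * (c \<bullet> x) ^ (n - 1) * (a \<bullet> x)) *\<^sub>R (x \<^bold>\<times> b))"
  proof (rule accessible_parameter_derivative[of "\<lambda>s x. ((c + s *\<^sub>R a) \<bullet> x) ^ n *\<^sub>R (x \<^bold>\<times> b)"])
    show "accessible (\<lambda>x. ((c + s *\<^sub>R a) \<bullet> x) ^ n *\<^sub>R (x \<^bold>\<times> b))" for s by (rule assms)
    show "continuous_on S2 (\<lambda>x. (of_nat n * (c \<bullet> x) ^ (n - 1) * (a \<bullet> x)) *\<^sub>R (x \<^bold>\<times> b))"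
      by (intro continuous_intros continuous_on_cross)
    fix s x assume s: "\<bar>s\<bar> \<le> (1::real)" and x: "x \<in> S2"
    have "\<bar>c \<bullet> x\<bar> \<le> B" "\<bar>a \<bullet> x\<bar> \<le> B" using inner_le_norm_S2[OF x, of c] inner_le_norm_S2[OF x, of a] by (auto simp: B_def le_max_iff_disj)
    note r = K(2)[OF this s]
    let ?r = "(c \<bullet> x + s * (a \<bullet> x)) ^ n - (c \<bullet> x) ^ n - s * (of_nat n * (c \<bullet> x) ^ (n - 1) * (a \<bullet> x))"
    have "((c + s *\<^sub>R a) \<bullet> x) ^ n *\<^sub>R (x \<^bold>\<times> b) - ((c + 0 *\<^sub>R a) \<bullet> x) ^ n *\<^sub>R (x \<^bold>\<times> b) -
        s *\<^sub>R (of_nat n * (c \<bullet> x) ^ (n - 1) * (a \<bullet> x)) *\<^sub>R (x \<^bold>\<times> b) = ?r *\<^sub>R (x \<^bold>\<times> b)"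
      by (simp add: inner_add_left scaleR_diff_left)
    also have "norm \<dots> \<le> (K * s\<^sup>2) * norm b"
      using norm_cross3_le[of x b] x r by (auto intro!: mult_mono)
    finally show "norm (((c + s *\<^sub>R a) \<bullet> x) ^ n *\<^sub>R (x \<^bold>\<times> b) - ((c + 0 *\<^sub>R a) \<bullet> x) ^ n *\<^sub>R (x \<^bold>\<times> b) -
        s *\<^sub>R (of_nat n * (c \<bullet> x) ^ (n - 1) * (a \<bullet> x)) *\<^sub>R (x \<^bold>\<times> b)) \<le> (K * norm b) * s\<^sup>2"
      by (simp add: mult_ac)
  qed
  from accessible_scale[OF this, of "1 / of_nat n"] show ?thesis using assms(2) by (simp add: mult.assoc)
qed

text \<open>Only aligned fields are available here, so the axis has to move together with the
  coefficient, and the product rule leaves two terms.\<close>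

lemma accessible_ridge_aligned_polarized:
  assumes "\<And>c. accessible (\<lambda>x. (c \<bullet> x) ^ n *\<^sub>R (x \<^bold>\<times> c))"
  shows "accessible (\<lambda>x. (of_nat n * (c \<bullet> x) ^ (n - 1) * (d \<bullet> x)) *\<^sub>R (x \<^bold>\<times> c) + (c \<bullet> x) ^ n *\<^sub>R (x \<^bold>\<times> d))"
proof -
  define B where "B = max (norm c) (norm d)"
  obtain K where K: "K \<ge> 0" "\<And>u w s :: real. \<bar>u\<bar> \<le> B \<Longrightarrow> \<bar>w\<bar> \<le> B \<Longrightarrow> \<bar>s\<bar> \<le> 1 \<Longrightarrow>
     \<bar>(u + s * w) ^ n - u ^ n - s * (of_nat n * u ^ (n - 1) * w)\<bar> \<le> K * s\<^sup>2"
    using power_linear_remainder[of B n] by blast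
  have B0: "B \<ge> 0" by (simp add: B_def le_max_iff_disj)
  \<comment> \<open>Bounds the first-order variation of the coefficient; multiplied by the variation
    \<open>s d\<close> of the axis it becomes a second-order error.\<close>
  define E where "E = of_nat n * B ^ (n - 1) * B"
  have E0: "E \<ge> 0" using B0 by (simp add: E_def)
  show ?thesis
  proof (rule accessible_parameter_derivative[of "\<lambda>s x. ((c + s *\<^sub>R d) \<bullet> x) ^ n *\<^sub>R (x \<^bold>\<times> (c + s *\<^sub>R d))"])
    show "accessible (\<lambda>x. ((c + s *\<^sub>R d) \<bullet> x) ^ n *\<^sub>R (x \<^bold>\<times> (c + s *\<^sub>R d)))" for s by (rule assms)
    show "continuous_on S2 (\<lambda>x. (of_nat n * (c \<bullet> x) ^ (n - 1) * (d \<bullet> x)) *\<^sub>R (x \<^bold>\<times> c) + (c \<bullet> x) ^ n *\<^sub>R (x \<^bold>\<times> d))"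
      by (intro continuous_intros continuous_on_cross)
    fix s x assume s: "\<bar>s\<bar> \<le> (1::real)" and x: "x \<in> S2"
    have cd: "\<bar>c \<bullet> x\<bar> \<le> B" "\<bar>d \<bullet> x\<bar> \<le> B" using inner_le_norm_S2[OF x, of c] inner_le_norm_S2[OF x, of d] by (auto simp: B_def le_max_iff_disj)
    note r = K(2)[OF this s]
    let ?p = "of_nat n * (c \<bullet> x) ^ (n - 1) * (d \<bullet> x)"
    let ?r = "(c \<bullet> x + s * (d \<bullet> x)) ^ n - (c \<bullet> x) ^ n - s * ?p"
    have p: "\<bar>?p\<bar> \<le> E" unfolding E_def abs_mult power_abs using B0 cd by (intro mult_mono power_mono) auto
    have P: "((c + s *\<^sub>R d) \<bullet> x) ^ n = (c \<bullet> x) ^ n + s * ?p + ?r" by (simp add: inner_add_left)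
    have "((c + s *\<^sub>R d) \<bullet> x) ^ n *\<^sub>R (x \<^bold>\<times> (c + s *\<^sub>R d)) - ((c + 0 *\<^sub>R d) \<bullet> x) ^ n *\<^sub>R (x \<^bold>\<times> (c + 0 *\<^sub>R d)) -
        s *\<^sub>R (?p *\<^sub>R (x \<^bold>\<times> c) + (c \<bullet> x) ^ n *\<^sub>R (x \<^bold>\<times> d))
        = ?r *\<^sub>R (x \<^bold>\<times> c) + (s * (s * ?p + ?r)) *\<^sub>R (x \<^bold>\<times> d)"
      unfolding P by (simp add: cross_add_right cross_mult_right scaleR_add_right scaleR_add_left mult.commute)
        (simp add: algebra_simps)
    also have "norm \<dots> \<le> (K * s\<^sup>2) * norm c + (s\<^sup>2 * (E + K)) * norm d"
    proof (rule norm_triangle_mono)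
      show "norm (?r *\<^sub>R (x \<^bold>\<times> c)) \<le> (K * s\<^sup>2) * norm c"
        using norm_cross3_le[of x c] x r by (auto intro!: mult_mono)
      have "\<bar>s * ?p + ?r\<bar> \<le> \<bar>s\<bar> * E + K * s\<^sup>2"
        using p r mult_left_mono[OF p abs_ge_zero[of s]] abs_triangle_ineq[of "s * ?p" ?r] by (simp add: abs_mult)
      also have "K * s\<^sup>2 = (K * \<bar>s\<bar>) * \<bar>s\<bar>" by (simp add: power2_eq_square)
      also have "\<dots> \<le> (K * 1) * \<bar>s\<bar>" using s K(1) by (intro mult_right_mono mult_left_mono) auto
      finally have "\<bar>s\<bar> * \<bar>s * ?p + ?r\<bar> \<le> \<bar>s\<bar> * (\<bar>s\<bar> * (E + K))"
        by (intro mult_left_mono) (auto simp: algebra_simps)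
      then have "\<bar>s * (s * ?p + ?r)\<bar> \<le> s\<^sup>2 * (E + K)" by (simp add: abs_mult power2_eq_square mult.assoc[symmetric])
      then show "norm ((s * (s * ?p + ?r)) *\<^sub>R (x \<^bold>\<times> d)) \<le> (s\<^sup>2 * (E + K)) * norm d"
        using norm_cross3_le[of x d] x E0 K(1) by (auto intro!: mult_mono simp del: abs_mult)
    qed
    also have "\<dots> = (K * norm c + (E + K) * norm d) * s\<^sup>2" by (simp add: algebra_simps)
    finally show "norm (((c + s *\<^sub>R d) \<bullet> x) ^ n *\<^sub>R (x \<^bold>\<times> (c + s *\<^sub>R d)) - ((c + 0 *\<^sub>R d) \<bullet> x) ^ n *\<^sub>R (x \<^bold>\<times> (c + 0 *\<^sub>R d)) -
        s *\<^sub>R (?p *\<^sub>R (x \<^bold>\<times> c) + (c \<bullet> x) ^ n *\<^sub>R (x \<^bold>\<times> d))) \<le> (K * norm c + (E + K) * norm d) * s\<^sup>2" .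
  qed
qed

text \<open>
  Summing the brackets of \<open>\<langle>e\<^sub>i, x\<rangle> x \<times> g\<close> with \<open>\<langle>g \<times> e\<^sub>i, x\<rangle> \<langle>g, x\<rangle>\<^sup>n\<^sup>-\<^sup>1 x \<times> g\<close> over the axes
  gives \<open>-2 \<langle>g, x\<rangle>\<^sup>n\<^sup>-\<^sup>1 (\<bar>g\<bar>\<^sup>2 - \<langle>g, x\<rangle>\<^sup>2) x \<times> g\<close> on the sphere.
\<close>

lemma accessible_ridge_aligned_step:
  assumes n: "n \<ge> 1" and P: "\<And>c b. accessible (\<lambda>x. (c \<bullet> x) ^ n *\<^sub>R (x \<^bold>\<times> b))"
    and Q: "\<And>c b. accessible (\<lambda>x. (c \<bullet> x) ^ (n - 1) *\<^sub>R (x \<^bold>\<times> b))"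
  shows "accessible (\<lambda>x. (g \<bullet> x) ^ (n + 1) *\<^sub>R (x \<^bold>\<times> g))"
proof -
  define G where "G x = (g \<bullet> x) ^ (n - 1)" for x
  have br: "accessible (\<lambda>x. (G x * ((a \<bullet> x) * (f \<bullet> (x \<^bold>\<times> g)) - (f \<bullet> x) * (a \<bullet> (x \<^bold>\<times> g)))) *\<^sub>R (x \<^bold>\<times> g))" for a f
  proof -
    have sp: "smooth_pair (\<lambda>x. (G x * (f \<bullet> x)) *\<^sub>R (x \<^bold>\<times> g))
      (\<lambda>x v. (G x * (f \<bullet> x)) *\<^sub>R (v \<^bold>\<times> g) + (G x * (f \<bullet> v) + (of_nat (n - 1) * (g \<bullet> x) ^ (n - 1 - 1) * (g \<bullet> v)) * (f \<bullet> x)) *\<^sub>R (x \<^bold>\<times> g))"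
      unfolding G_def by (intro smooth_pair_scaleR smooth_pair_mult smooth_pair_power smooth_pair_inner smooth_pair_rotation)
    have "accessible (\<lambda>x. (G x * (f \<bullet> x)) *\<^sub>R (x \<^bold>\<times> g))"
      unfolding G_def by (rule accessible_ridge_polarized[OF P n])
    from bracket_linear[OF sp this, of a g] show ?thesis
      by (rule accessible_cong) (rule linear_bracket_linear, simp add: dot_cross_self)
  qed
  have "accessible (\<lambda>x. \<Sum>i\<in>UNIV. (G x * ((axis i 1 \<bullet> x) * ((g \<^bold>\<times> axis i 1) \<bullet> (x \<^bold>\<times> g)) - ((g \<^bold>\<times> axis i 1) \<bullet> x) * (axis i 1 \<bullet> (x \<^bold>\<times> g)))) *\<^sub>R (x \<^bold>\<times> g))"
    by (intro accessible_sum br) auto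
  then have S: "accessible (\<lambda>x. (G x * (-2 * ((norm g)\<^sup>2 - (g \<bullet> x)\<^sup>2))) *\<^sub>R (x \<^bold>\<times> g))"
  proof (rule accessible_cong)
    fix x :: "real ^ 3" assume "x \<in> S2"
    then have "x \<bullet> x = 1" by (simp add: dot_square_norm)
    have "(\<Sum>i\<in>UNIV. (axis i 1 \<bullet> x) * ((g \<^bold>\<times> axis i 1) \<bullet> (x \<^bold>\<times> g)) - ((g \<^bold>\<times> axis i 1) \<bullet> x) * (axis i 1 \<bullet> (x \<^bold>\<times> g)))
       = -2 * ((g \<bullet> g) * (x \<bullet> x) - (g \<bullet> x)\<^sup>2)"
    proof -
      \<comment> \<open>Contracting the axes, the first products sum to
        \<open>(g \<times> x) \<bullet> y\<close> and the second to
        \<open>(g \<times> y) \<bullet> x\<close>, which is its negative.\<close>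
      have "(\<Sum>i\<in>UNIV. (axis i 1 \<bullet> x) * ((g \<^bold>\<times> axis i 1) \<bullet> y) - ((g \<^bold>\<times> axis i 1) \<bullet> x) * (axis i 1 \<bullet> y)) = 2 * (y \<bullet> (g \<^bold>\<times> x))" for y
        by (simp add: cross3_simps axis_def)
      moreover have "(x \<^bold>\<times> g) \<bullet> (g \<^bold>\<times> x) = - ((g \<bullet> g) * (x \<bullet> x) - (g \<bullet> x)\<^sup>2)"
        by (simp add: cross3_simps power2_eq_square)
      ultimately show ?thesis by simp
    qed
    then show "(\<Sum>i\<in>UNIV. (G x * ((axis i 1 \<bullet> x) * ((g \<^bold>\<times> axis i 1) \<bullet> (x \<^bold>\<times> g)) - ((g \<^bold>\<times> axis i 1) \<bullet> x) * (axis i 1 \<bullet> (x \<^bold>\<times> g)))) *\<^sub>R (x \<^bold>\<times> g))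
       = (G x * (-2 * ((norm g)\<^sup>2 - (g \<bullet> x)\<^sup>2))) *\<^sub>R (x \<^bold>\<times> g)"
      unfolding scaleR_left.sum[symmetric] sum_distrib_left[symmetric] using \<open>x \<bullet> x = 1\<close> by (simp add: dot_square_norm)
  qed
  \<comment> \<open>The field of degree \<open>n - 1\<close> cancels the contribution of
    \<open>(norm g)\<^sup>2\<close> and leaves the coefficient of degree
    \<open>n + 1\<close>.\<close>
  have "accessible (\<lambda>x. (1/2) *\<^sub>R ((G x * (-2 * ((norm g)\<^sup>2 - (g \<bullet> x)\<^sup>2))) *\<^sub>R (x \<^bold>\<times> g)) + (norm g)\<^sup>2 *\<^sub>R ((g \<bullet> x) ^ (n - 1) *\<^sub>R (x \<^bold>\<times> g)))"
    by (intro accessible_add accessible_scale S Q)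
  then show ?thesis
  proof (rule accessible_cong)
    fix x
    have "(g \<bullet> x) ^ (n + 1) = G x * (g \<bullet> x)\<^sup>2"
      using n unfolding G_def power_add[symmetric] by simp
    then show "(1/2) *\<^sub>R ((G x * (-2 * ((norm g)\<^sup>2 - (g \<bullet> x)\<^sup>2))) *\<^sub>R (x \<^bold>\<times> g)) + (norm g)\<^sup>2 *\<^sub>R ((g \<bullet> x) ^ (n - 1) *\<^sub>R (x \<^bold>\<times> g))
      = (g \<bullet> x) ^ (n + 1) *\<^sub>R (x \<^bold>\<times> g)"
      unfolding G_def[symmetric] by (simp add: vec_eq_iff algebra_simps)
  qed
qed

text \<open>
  For \<open>d = b \<times> c\<close>, polarising the aligned field and bracketing \<open>\<langle>c, x\<rangle> x \<times> b\<close> with \<open>\<langle>c, x\<rangle>\<^sup>n x \<times> c\<close> give two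
  different combinations of \<open>\<langle>c, x\<rangle>\<^sup>n \<langle>d, x\<rangle> x \<times> c\<close> and \<open>\<langle>c, x\<rangle>\<^sup>n\<^sup>+\<^sup>1 x \<times> d\<close>.
\<close>

lemma accessible_ridge_step:
  assumes n: "n \<ge> 1" and P: "\<And>c b. accessible (\<lambda>x. (c \<bullet> x) ^ n *\<^sub>R (x \<^bold>\<times> b))"
    and Q: "\<And>c b. accessible (\<lambda>x. (c \<bullet> x) ^ (n - 1) *\<^sub>R (x \<^bold>\<times> b))"
  shows "accessible (\<lambda>x. (c \<bullet> x) ^ (n + 1) *\<^sub>R (x \<^bold>\<times> b))"
proof -
  note A = accessible_ridge_aligned_step[OF assms]
  have perp: "accessible (\<lambda>x. (c \<bullet> x) ^ (n + 1) *\<^sub>R (x \<^bold>\<times> (b \<^bold>\<times> c)))" for b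
  proof -
    let ?d = "b \<^bold>\<times> c"
    have 1: "accessible (\<lambda>x. (of_nat (n + 1) * (c \<bullet> x) ^ (n + 1 - 1) * (?d \<bullet> x)) *\<^sub>R (x \<^bold>\<times> c) + (c \<bullet> x) ^ (n + 1) *\<^sub>R (x \<^bold>\<times> ?d))"
      by (rule accessible_ridge_aligned_polarized[OF A])
    have sp: "smooth_pair (\<lambda>x. (c \<bullet> x) ^ n *\<^sub>R (x \<^bold>\<times> c))
       (\<lambda>x v. (c \<bullet> x) ^ n *\<^sub>R (v \<^bold>\<times> c) + (of_nat n * (c \<bullet> x) ^ (n - 1) * (c \<bullet> v)) *\<^sub>R (x \<^bold>\<times> c))"
      by (intro smooth_pair_scaleR smooth_pair_power smooth_pair_rotation)
    have 2: "accessible (\<lambda>x. (of_nat n * (c \<bullet> x) ^ n * (?d \<bullet> x)) *\<^sub>R (x \<^bold>\<times> c) + (c \<bullet> x) ^ (n + 1) *\<^sub>R (x \<^bold>\<times> ?d))"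
    proof (rule accessible_cong[OF bracket_linear[OF sp P, of c b]])
      fix x
      have pw: "(c \<bullet> x) ^ (n - 1) * (c \<bullet> x) = (c \<bullet> x) ^ n" using n by (simp add: power_eq_if)
      have jac: "(x \<^bold>\<times> b) \<^bold>\<times> c - (x \<^bold>\<times> c) \<^bold>\<times> b = x \<^bold>\<times> ?d" by (simp add: cross3_simps forall_3)
      have cx: "c \<bullet> (x \<^bold>\<times> b) = ?d \<bullet> x" by (simp add: cross3_simps)
      have "(c \<bullet> x) ^ n *\<^sub>R (((c \<bullet> x) *\<^sub>R (x \<^bold>\<times> b)) \<^bold>\<times> c) + (of_nat n * (c \<bullet> x) ^ (n - 1) * (c \<bullet> ((c \<bullet> x) *\<^sub>R (x \<^bold>\<times> b)))) *\<^sub>R (x \<^bold>\<times> c)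
         - ((c \<bullet> ((c \<bullet> x) ^ n *\<^sub>R (x \<^bold>\<times> c))) *\<^sub>R (x \<^bold>\<times> b) + (c \<bullet> x) *\<^sub>R (((c \<bullet> x) ^ n *\<^sub>R (x \<^bold>\<times> c)) \<^bold>\<times> b))
         = (of_nat n * ((c \<bullet> x) ^ (n - 1) * (c \<bullet> x)) * (?d \<bullet> x)) *\<^sub>R (x \<^bold>\<times> c)
           + (c \<bullet> x) ^ (n + 1) *\<^sub>R ((x \<^bold>\<times> b) \<^bold>\<times> c - (x \<^bold>\<times> c) \<^bold>\<times> b)"
        unfolding cx[symmetric] power_add power_one_right mult.commute[of "(c \<bullet> x) ^ n" "c \<bullet> x"]
        by (rule linear_bracket_ridge) (simp add: dot_cross_self)
      then show "(c \<bullet> x) ^ n *\<^sub>R (((c \<bullet> x) *\<^sub>R (x \<^bold>\<times> b)) \<^bold>\<times> c) + (of_nat n * (c \<bullet> x) ^ (n - 1) * (c \<bullet> ((c \<bullet> x) *\<^sub>R (x \<^bold>\<times> b)))) *\<^sub>R (x \<^bold>\<times> c)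
         - ((c \<bullet> ((c \<bullet> x) ^ n *\<^sub>R (x \<^bold>\<times> c))) *\<^sub>R (x \<^bold>\<times> b) + (c \<bullet> x) *\<^sub>R (((c \<bullet> x) ^ n *\<^sub>R (x \<^bold>\<times> c)) \<^bold>\<times> b))
         = (of_nat n * (c \<bullet> x) ^ n * (?d \<bullet> x)) *\<^sub>R (x \<^bold>\<times> c) + (c \<bullet> x) ^ (n + 1) *\<^sub>R (x \<^bold>\<times> ?d)"
        unfolding pw jac .
    qed
    \<comment> \<open>\<open>n + 1\<close> times the bracket minus \<open>n\<close> times the
      polarised field eliminates the terms with axis \<open>c\<close> and leaves the term with axis
      \<open>d\<close> exactly once.\<close>
    from accessible_diff[OF accessible_scale[OF 2, of "of_nat (n + 1)"] accessible_scale[OF 1, of "of_nat n"]]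
    show ?thesis
      by (rule accessible_cong) (simp add: scaleR_add_right algebra_simps)
  qed
  show ?thesis
  proof (cases "c = 0")
    case True
    then show ?thesis using accessible_zero by simp
  next
    case False
    \<comment> \<open>The part of \<open>b\<close> along \<open>c\<close> is handled by the aligned
      field; the part orthogonal to \<open>c\<close> is a cross product with \<open>c\<close>, hence
      handled by \<open>perp\<close>.\<close>
    have beq: "b = ((b \<bullet> c) / (c \<bullet> c)) *\<^sub>R c + (1 / (c \<bullet> c)) *\<^sub>R ((c \<^bold>\<times> b) \<^bold>\<times> c)"
    proof -
      have "(c \<^bold>\<times> b) \<^bold>\<times> c = (c \<bullet> c) *\<^sub>R b - (b \<bullet> c) *\<^sub>R c" by (simp add: cross3_simps forall_3)
      then show ?thesis using False by (simp add: scaleR_diff_right)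
    qed
    have gen: "p *\<^sub>R (\<alpha> *\<^sub>R w + \<beta> *\<^sub>R z) = \<alpha> *\<^sub>R (p *\<^sub>R w) + \<beta> *\<^sub>R (p *\<^sub>R z)"
      for p \<alpha> \<beta> and w z :: "real ^ 3"
      by (simp add: scaleR_add_right mult.commute)
    have xb: "x \<^bold>\<times> b = ((b \<bullet> c) / (c \<bullet> c)) *\<^sub>R (x \<^bold>\<times> c) + (1 / (c \<bullet> c)) *\<^sub>R (x \<^bold>\<times> ((c \<^bold>\<times> b) \<^bold>\<times> c))" for x
      by (rule trans[OF arg_cong[OF beq, of "cross3 x"]]) (simp add: cross_add_right cross_mult_right)
    have "(c \<bullet> x) ^ (n + 1) *\<^sub>R (x \<^bold>\<times> b) = ((b \<bullet> c) / (c \<bullet> c)) *\<^sub>R ((c \<bullet> x) ^ (n + 1) *\<^sub>R (x \<^bold>\<times> c))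
        + (1 / (c \<bullet> c)) *\<^sub>R ((c \<bullet> x) ^ (n + 1) *\<^sub>R (x \<^bold>\<times> ((c \<^bold>\<times> b) \<^bold>\<times> c)))" for x
      by (rule trans[OF arg_cong[OF xb, of "scaleR ((c \<bullet> x) ^ (n + 1))"] gen])
    from accessible_cong[OF accessible_add[OF accessible_scale[OF A] accessible_scale[OF perp]] this[symmetric]]
    show ?thesis .
  qed
qed

text \<open>The step uses two preceding degrees, so the induction has two base cases: rotations in
  degree 0 and linear coefficients in degree 1.\<close>

lemma accessible_ridge: "accessible (\<lambda>x. (c \<bullet> x) ^ n *\<^sub>R (x \<^bold>\<times> b))"
proof (induction n arbitrary: c b rule: less_induct)
  case (less n)
  consider "n = 0" | "n = 1" | "n \<ge> 2" by linarith
  then show ?case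
  proof cases
    case 1
    then show ?thesis using bracket_stableD(2)[OF bracket_stable_rotation[of b]] by simp
  next
    case 2
    then show ?thesis using bracket_stableD(2)[OF bracket_stable_linear[of c b]] by simp
  next
    case 3
    then have "accessible (\<lambda>x. (c \<bullet> x) ^ ((n - 1) + 1) *\<^sub>R (x \<^bold>\<times> b))"
      by (intro accessible_ridge_step less) auto
    then show ?thesis using 3 by simp
  qed
qed

lemma accessible_exponential: "accessible (\<lambda>x. exp (c \<bullet> x) *\<^sub>R (x \<^bold>\<times> b))"
proof (rule accessible_limit)
  show "continuous_on S2 (\<lambda>x. exp (c \<bullet> x) *\<^sub>R (x \<^bold>\<times> b))" by (intro continuous_intros continuous_on_cross)
  fix \<epsilon> :: real assume \<epsilon>: "\<epsilon> > 0"
  then have "\<epsilon> / (norm b + 1) > 0" by (simp add: add_nonneg_pos)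
  then obtain n where n: "\<And>u. \<bar>u\<bar> \<le> norm c \<Longrightarrow> \<bar>(\<Sum>k<n. u ^ k / fact k) - exp u\<bar> \<le> \<epsilon> / (norm b + 1)"
    using exp_partial_sums_uniform by blast
  have "accessible (\<lambda>x. \<Sum>k<n. (1 / fact k) *\<^sub>R ((c \<bullet> x) ^ k *\<^sub>R (x \<^bold>\<times> b)))"
    by (intro accessible_sum accessible_scale accessible_ridge) auto
  moreover have "norm ((\<Sum>k<n. (1 / fact k) *\<^sub>R ((c \<bullet> x) ^ k *\<^sub>R (x \<^bold>\<times> b))) - exp (c \<bullet> x) *\<^sub>R (x \<^bold>\<times> b)) \<le> \<epsilon>"
    if x: "x \<in> S2" for x
  proof -
    have "(\<Sum>k<n. (1 / fact k) *\<^sub>R ((c \<bullet> x) ^ k *\<^sub>R (x \<^bold>\<times> b))) - exp (c \<bullet> x) *\<^sub>R (x \<^bold>\<times> b)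
        = ((\<Sum>k<n. (c \<bullet> x) ^ k / fact k) - exp (c \<bullet> x)) *\<^sub>R (x \<^bold>\<times> b)"
      by (simp add: scaleR_diff_left scaleR_left.sum)
    also have "norm \<dots> \<le> (\<epsilon> / (norm b + 1)) * norm b"
      unfolding norm_scaleR real_norm_def
      using n[OF inner_le_norm_S2[OF x]] norm_cross3_le[of x b] x \<epsilon> by (intro mult_mono) auto
    also have "\<dots> \<le> \<epsilon>" using \<epsilon> by (intro fraction_bound) auto
    finally show ?thesis .
  qed
  ultimately show "\<exists>W. accessible W \<and> (\<forall>x\<in>S2. norm (W x - exp (c \<bullet> x) *\<^sub>R (x \<^bold>\<times> b)) \<le> \<epsilon>)" by blast
qed

theorem accessible_continuous:
  assumes cV: "continuous_on S2 V" and V: "\<And>x. x \<in> S2 \<Longrightarrow> x \<bullet> V x = 0"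
  shows "accessible V"
proof -
  have span: "accessible (\<lambda>x. f x *\<^sub>R (x \<^bold>\<times> b))" if "f \<in> exponential_span" for f b
    using that
  proof induction
    case (exp r c)
    show ?case using accessible_scale[OF accessible_exponential, of r] by simp
  next
    case (add f g)
    show ?case using accessible_add[OF add.IH] by (simp add: scaleR_add_left)
  qed
  have cont: "accessible (\<lambda>x. f x *\<^sub>R (x \<^bold>\<times> b))" if f: "continuous_on S2 f" for f b
  proof (rule accessible_limit)
    show "continuous_on S2 (\<lambda>x. f x *\<^sub>R (x \<^bold>\<times> b))" by (intro continuous_intros continuous_on_cross f)
    fix \<epsilon> :: real assume \<epsilon>: "\<epsilon> > 0"
    then have "\<epsilon> / (norm b + 1) > 0" by (simp add: add_nonneg_pos)
    from exponential_span_dense[OF f this] obtain g where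
      g: "g \<in> exponential_span" "\<forall>x\<in>S2. \<bar>f x - g x\<bar> < \<epsilon> / (norm b + 1)" by blast
    have "norm (g x *\<^sub>R (x \<^bold>\<times> b) - f x *\<^sub>R (x \<^bold>\<times> b)) \<le> \<epsilon>" if x: "x \<in> S2" for x
    proof -
      have "norm (g x *\<^sub>R (x \<^bold>\<times> b) - f x *\<^sub>R (x \<^bold>\<times> b)) = \<bar>f x - g x\<bar> * norm (x \<^bold>\<times> b)"
        by (simp add: scaleR_diff_left[symmetric] abs_minus_commute)
      also have "\<dots> \<le> (\<epsilon> / (norm b + 1)) * norm b"
        using g(2) norm_cross3_le[of x b] x \<epsilon> by (intro mult_mono) (auto intro: less_imp_le)
      also have "\<dots> \<le> \<epsilon>" using \<epsilon> by (intro fraction_bound) auto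
      finally show ?thesis .
    qed
    then show "\<exists>W. accessible W \<and> (\<forall>x\<in>S2. norm (W x - f x *\<^sub>R (x \<^bold>\<times> b)) \<le> \<epsilon>)" using span[OF g(1)] by blast
  qed
  \<comment> \<open>On the sphere a tangent field satisfies
    \<open>V = x \<times> (V \<times> x)\<close>, so the components of \<open>V \<times> x\<close>
    are continuous coefficients for the rotation fields of the three axes.\<close>
  have "accessible (\<lambda>x. \<Sum>i\<in>UNIV. ((V x \<^bold>\<times> x) $ i) *\<^sub>R (x \<^bold>\<times> axis i 1))"
    by (intro accessible_sum cont continuous_intros continuous_on_cross cV) auto
  then show ?thesis
  proof (rule accessible_cong)
    fix x assume x: "x \<in> S2"
    have "(\<Sum>i\<in>UNIV. ((V x \<^bold>\<times> x) $ i) *\<^sub>R (x \<^bold>\<times> axis i 1)) = x \<^bold>\<times> (V x \<^bold>\<times> x)"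
      by (simp add: cross3_simps axis_def forall_3)
    also have "\<dots> = V x" using V[OF x] x by (simp add: cross3_triple dot_square_norm)
    finally show "(\<Sum>i\<in>UNIV. ((V x \<^bold>\<times> x) $ i) *\<^sub>R (x \<^bold>\<times> axis i 1)) = V x" .
  qed
qed

end

section \<open>The harmonic control system\<close>

lemma gradient_eqI:
  assumes "GDERIV f x :> D"
  shows "gradient f x = D"
  unfolding gradient_def
proof (rule the_equality)
  show "GDERIV f x :> D" by (rule assms)
  fix E assume "GDERIV f x :> E"
  then have "(\<lambda>h. h \<bullet> E) = (\<lambda>h. h \<bullet> D)"
    using assms unfolding gderiv_def by (rule has_derivative_unique)
  then have "(E - D) \<bullet> E = (E - D) \<bullet> D" by metis
  then show "E = D" by (metis inner_diff_right inner_eq_zero_iff right_minus_eq)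
qed

lemma gradient_inner: "gradient (\<lambda>y. a \<bullet> y) x = a"
  by (rule gradient_eqI) (auto simp: gderiv_def inner_commute intro!: derivative_eq_intros)

lemma has_derivative_quadratic_form:
  fixes B :: "real ^ 3 ^ 3"
  assumes "transpose B = B"
  shows "((\<lambda>x. x \<bullet> (B *v x)) has_derivative (\<lambda>h. h \<bullet> (2 *\<^sub>R (B *v x)))) (at x)"
proof -
  have "((\<lambda>x. x \<bullet> (B *v x)) has_derivative (\<lambda>h. x \<bullet> (B *v h) + h \<bullet> (B *v x))) (at x)"
    by (intro has_derivative_inner has_derivative_ident bounded_linear_imp_has_derivative matrix_vector_mul_bounded_linear)
  moreover have "x \<bullet> (B *v h) = h \<bullet> (B *v x)" for h
    using dot_lmul_matrix[of x B h] by (simp add: assms inner_commute matrix_vector_mul_assoc flip: transpose_matrix_vector)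
  ultimately show ?thesis by simp
qed

lemma sum_Basis_vec3: "(\<Sum>b\<in>Basis. f b) = f (axis 1 1) + f (axis 2 1) + f (axis 3 1)"
  for f :: "real ^ 3 \<Rightarrow> 'b::comm_monoid_add"
proof -
  have "sum f Basis = sum f ((\<lambda>i. axis i 1) ` UNIV)"
    by (rule arg_cong[where f = "sum f"]) (auto simp: Basis_vec_def)
  also have "\<dots> = sum (f \<circ> (\<lambda>i. axis i 1)) UNIV"
    by (rule sum.reindex) (auto simp: inj_on_def axis_eq_axis)
  finally show ?thesis by (simp add: sum_3)
qed

lemma laplacian_quadratic_form:
  fixes B :: "real ^ 3 ^ 3"
  assumes "transpose B = B"
  shows "laplacian (\<lambda>x. x \<bullet> (B *v x)) x = 2 * trace B"
proof -
  have 1: "partial_deriv b (\<lambda>x. x \<bullet> (B *v x)) = (\<lambda>x. b \<bullet> (2 *\<^sub>R (B *v x)))" for b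
    unfolding partial_deriv_def using frechet_derivative_at[OF has_derivative_quadratic_form[OF assms]] by metis
  have D: "((\<lambda>x. b \<bullet> (2 *\<^sub>R (B *v x))) has_derivative (\<lambda>h. b \<bullet> (2 *\<^sub>R (B *v h)))) (at x)" for b x
    by (intro has_derivative_inner_right has_derivative_scaleR_right bounded_linear_imp_has_derivative matrix_vector_mul_bounded_linear)
  have 2: "partial_deriv b (\<lambda>x. b \<bullet> (2 *\<^sub>R (B *v x))) x = b \<bullet> (2 *\<^sub>R (B *v b))" for b x
    unfolding partial_deriv_def using frechet_derivative_at[OF D] by metis
  show ?thesis
    unfolding laplacian_def 1 2 sum_Basis_vec3
    by (simp add: trace_def sum_3 inner_axis' matrix_vector_mult_basis column_def)
qed

lemma homogeneous_polynomial_2: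
  assumes "homogeneous_polynomial 2 q"
  shows "\<exists>B :: real ^ 3 ^ 3. transpose B = B \<and> q = (\<lambda>x. x \<bullet> (B *v x))"
proof -
  obtain a where q: "\<And>x. q x = (\<Sum>(i, j, k) \<in> {(i, j, k). i + j + k = 2}. a i j k * x $ 1 ^ i * x $ 2 ^ j * x $ 3 ^ k)"
    using assms unfolding homogeneous_polynomial_def by blast
  have I: "{(i, j, k). i + j + k = (2::nat)} = {(2,0,0), (0,2,0), (0,0,2), (1,1,0), (1,0,1), (0,1,1)}"
  proof -
    have "i + j + k = 2 \<longleftrightarrow> i = 2 \<and> j = 0 \<and> k = 0 \<or> i = 0 \<and> j = 2 \<and> k = 0 \<or> i = 0 \<and> j = 0 \<and> k = 2
      \<or> i = 1 \<and> j = 1 \<and> k = 0 \<or> i = 1 \<and> j = 0 \<and> k = 1 \<or> i = 0 \<and> j = 1 \<and> k = 1" for i j k :: nat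
      by presburger
    then show ?thesis by auto
  qed
  \<comment> \<open>Each mixed coefficient is split evenly between two entries, for
    symmetry.\<close>
  define B :: "real ^ 3 ^ 3" where "B = vector [vector [a 2 0 0, a 1 1 0 / 2, a 1 0 1 / 2],
    vector [a 1 1 0 / 2, a 0 2 0, a 0 1 1 / 2], vector [a 1 0 1 / 2, a 0 1 1 / 2, a 0 0 2]]"
  have "transpose B = B" by (simp add: B_def transpose_def vec_eq_iff forall_3)
  moreover have "q x = x \<bullet> (B *v x)" for x
    unfolding q I by (simp add: B_def inner_vec_def matrix_vector_mult_def sum_3 power2_eq_square field_simps)
  ultimately show ?thesis by blast
qed

text \<open>For a quadratic form with symmetric matrix \<open>B\<close> the gradient is
  \<open>2 B x\<close> and the Laplacian is twice the trace, so harmonicity becomes tracelessness of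
  \<open>2 B\<close>.\<close>

lemma harmonic_quadratic_field:
  assumes "nonzero_spherical_harmonic 2 q"
  shows "\<exists>(A :: real ^ 3 ^ 3) e. trace A = 0 \<and> norm e = 1 \<and> e \<bullet> (A *v e) \<noteq> 0 \<and>
    (\<forall>x. hamiltonian_field q x = x \<^bold>\<times> (A *v x))"
proof -
  obtain B :: "real ^ 3 ^ 3" where B: "transpose B = B" "q = (\<lambda>x. x \<bullet> (B *v x))"
    using assms homogeneous_polynomial_2 unfolding nonzero_spherical_harmonic_def homogeneous_harmonic_def by blast
  have "laplacian q 0 = 0" using assms by (simp add: nonzero_spherical_harmonic_def homogeneous_harmonic_def)
  then have tB: "trace B = 0" using laplacian_quadratic_form[OF B(1)] by (simp add: B(2))
  obtain e where e: "norm e = 1" "q e \<noteq> 0" using assms by (auto simp: nonzero_spherical_harmonic_def)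
  have "gradient q x = (2 *\<^sub>R B) *v x" for x
    unfolding B(2) by (rule gradient_eqI)
      (use has_derivative_quadratic_form[OF B(1), of x] in \<open>simp add: gderiv_def scaleR_matrix_vector_assoc\<close>)
  then have "\<forall>x. hamiltonian_field q x = x \<^bold>\<times> ((2 *\<^sub>R B) *v x)" by (simp add: hamiltonian_field_def)
  moreover have "trace (2 *\<^sub>R B) = 2 * trace B" by (simp add: trace_def sum_3)
  then have "trace (2 *\<^sub>R B) = 0" using tB by simp
  moreover have "e \<bullet> ((2 *\<^sub>R B) *v e) \<noteq> 0" using e(2) by (simp add: B(2) scaleR_matrix_vector_assoc[symmetric])
  ultimately show ?thesis using e(1) by blast
qed

lemma reaches_id:
  assumes lin: "\<And>r u x. F (r *\<^sub>R u) x = r *\<^sub>R F u x"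
  shows "reaches F id"
proof -
  have F0: "F 0 x = 0" for x using lin[of 0 0] by simp
  have "reaches F ((\<lambda>s x. x) 1)"
    by (rule reaches_constant_control[of F 0]) (auto simp: lin F0 has_vector_derivative_const)
  then show ?thesis by (simp add: id_def)
qed

lemma sphere_monoid_reaches:
  assumes lin: "\<And>r u x. F (r *\<^sub>R u) x = r *\<^sub>R F u x"
  shows "sphere_monoid {g. reaches F g}"
proof
  show "id \<in> {g. reaches F g}" using reaches_id[of F] lin by simp
  show "f \<circ> g \<in> {g. reaches F g}" if "f \<in> {g. reaches F g}" "g \<in> {g. reaches F g}" for f g
    using that reaches_comp by blast
  show "f x \<in> S2" if "f \<in> {g. reaches F g}" "x \<in> S2" for f x
    using that reaches_sphere by blast
qed

lemma reaches_half_turn: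
  assumes lin: "\<And>r u x. F (r *\<^sub>R u) x = r *\<^sub>R F u x"
    and u: "\<And>x. F u x = x \<^bold>\<times> (pi *\<^sub>R m)" and m: "norm m = 1"
  shows "reaches F (half_turn m)"
proof -
  \<comment> \<open>Rodrigues' formula for the rotation about \<open>m\<close> through the angle
    \<open>pi * s\<close>, in the sense given by the velocity \<open>x \<times> m\<close>.\<close>
  define \<Phi> where "\<Phi> s x = (m \<bullet> x) *\<^sub>R m + cos (pi * s) *\<^sub>R (x - (m \<bullet> x) *\<^sub>R m) + sin (pi * s) *\<^sub>R (x \<^bold>\<times> m)" for s x
  have mm: "m \<bullet> m = 1" using m by (simp add: dot_square_norm)
  have half: "half_turn m x = \<Phi> 1 x" for x
    by (simp add: \<Phi>_def half_turn_def vec_eq_iff)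
  have unit: "\<Phi> s x \<in> S2" if "x \<in> S2" for s x
  proof -
    let ?p = "x - (m \<bullet> x) *\<^sub>R m" and ?r = "x \<^bold>\<times> m"
    have xx: "x \<bullet> x = 1" using that by (simp add: dot_square_norm)
    have o: "m \<bullet> ?p = 0" "m \<bullet> ?r = 0" "?p \<bullet> ?r = 0"
      by (simp_all add: inner_diff_left inner_diff_right mm dot_cross_self)
    have p: "?p \<bullet> ?p = 1 - (m \<bullet> x)\<^sup>2"
      by (simp add: inner_diff_left inner_diff_right mm xx inner_commute power2_eq_square)
    have r: "?r \<bullet> ?r = 1 - (m \<bullet> x)\<^sup>2"
      using norm_cross_dot[of x m] that m by (simp add: dot_square_norm inner_commute)
    have "\<Phi> s x \<bullet> \<Phi> s x = (m \<bullet> x)\<^sup>2 * (m \<bullet> m) + (cos (pi * s))\<^sup>2 * (?p \<bullet> ?p) + (sin (pi * s))\<^sup>2 * (?r \<bullet> ?r)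
      + 2 * (m \<bullet> x) * cos (pi * s) * (m \<bullet> ?p) + 2 * (m \<bullet> x) * sin (pi * s) * (m \<bullet> ?r) + 2 * cos (pi * s) * sin (pi * s) * (?p \<bullet> ?r)"
      unfolding \<Phi>_def inner_add_left inner_add_right inner_scaleR_left inner_scaleR_right
      by (simp only: inner_commute[of ?p m] inner_commute[of ?r m] inner_commute[of ?r ?p]) (simp add: algebra_simps power2_eq_square)
    also have "\<dots> = 1"
      unfolding o p r mm cos_squared_eq by (simp add: algebra_simps)
    finally show ?thesis by (simp add: norm_eq_1)
  qed
  have "((\<lambda>s. \<Phi> s x) has_vector_derivative F u (\<Phi> s x)) (at s within {0..1})" for s x
  proof -
    have "((\<lambda>s. \<Phi> s x) has_vector_derivative (- (sin (pi * s) * pi)) *\<^sub>R (x - (m \<bullet> x) *\<^sub>R m) + (cos (pi * s) * pi) *\<^sub>R (x \<^bold>\<times> m)) (at s within {0..1})"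
      unfolding \<Phi>_def has_vector_derivative_def
      by (auto intro!: derivative_eq_intros simp: algebra_simps)
    moreover have "(- (sin (pi * s) * pi)) *\<^sub>R (x - (m \<bullet> x) *\<^sub>R m) + (cos (pi * s) * pi) *\<^sub>R (x \<^bold>\<times> m) = F u (\<Phi> s x)"
    proof -
      have "(x \<^bold>\<times> m) \<^bold>\<times> m = - (x - (m \<bullet> x) *\<^sub>R m)"
        using cross3_triple[of m x m] by (simp add: cross_skew[of "x \<^bold>\<times> m" m] mm)
      then have "(x \<^bold>\<times> m) \<^bold>\<times> m = (-1) *\<^sub>R (x - (m \<bullet> x) *\<^sub>R m)" by simp
      then show ?thesis
        by (simp add: u \<Phi>_def cross_add_left cross_mult_left cross_mult_right Cross3.left_diff_distrib scaleR_add_right scaleR_diff_right mult.commute)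
    qed
    ultimately show ?thesis by simp
  qed
  moreover have "continuous_on S2 (F u)" unfolding u by (intro continuous_intros continuous_on_cross)
  ultimately have "reaches F (\<Phi> 1)"
    using unit by (intro reaches_constant_control[OF lin]) (auto simp: \<Phi>_def)
  then show ?thesis using half by (metis ext)
qed

text \<open>\<open>\<Phi> t\<close> is the unit-time flow of the constant control
  \<open>t *\<^sub>R u\<close>. Since \<open>t\<close> may be negative, the flow is reachable
  backwards as well.\<close>

lemma reaches_local_flow:
  assumes lin: "\<And>r u x. F (r *\<^sub>R u) x = r *\<^sub>R F u x"
    and V: "smooth_pair V DV" "\<And>x. x \<in> S2 \<Longrightarrow> x \<bullet> V x = 0" and u: "\<And>x. x \<in> S2 \<Longrightarrow> F u x = V x"
  shows "\<exists>\<tau> \<Phi>. sphere_monoid.local_flow {g. reaches F g} V \<tau> \<Phi>"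
proof -
  interpret sphere_monoid "{g. reaches F g}" by (rule sphere_monoid_reaches[OF lin])
  obtain C where C: "taylor2 V DV C" using V(1) by (auto simp: smooth_pair_def)
  obtain \<tau> \<Phi> where \<tau>: "\<tau> > 0" and \<Phi>: "\<And>x. x \<in> S2 \<Longrightarrow> \<Phi> 0 x = x"
    "\<And>x t. x \<in> S2 \<Longrightarrow> t \<in> {-\<tau>..\<tau>} \<Longrightarrow> \<Phi> t x \<in> S2 \<and> ((\<lambda>t. \<Phi> t x) has_vector_derivative V (\<Phi> t x)) (at t within {-\<tau>..\<tau>})"
    using sphere_local_flow[OF taylor2_lipschitz[OF C] V(2)] by blast
  have cV: "continuous_on S2 V" by (rule smooth_pair_continuous[OF V(1)])
  have "reaches F (\<Phi> t)" if t: "t \<in> {-\<tau>..\<tau>}" for t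
  proof -
    have "reaches F ((\<lambda>s. \<Phi> (s * t)) 1)"
    proof (rule reaches_constant_control[of F "t *\<^sub>R u"])
      have "continuous_on S2 (\<lambda>x. t *\<^sub>R V x)" by (intro continuous_intros cV)
      then show "continuous_on S2 (F (t *\<^sub>R u))"
        by (rule continuous_on_cong[THEN iffD1, rotated 2]) (simp_all add: lin u)
      fix x s assume x: "x \<in> S2" and s: "s \<in> {0..(1::real)}"
      have mem: "r * t \<in> {-\<tau>..\<tau>}" if "r \<in> {0..1}" for r
      proof -
        have "\<bar>r * t\<bar> \<le> 1 * \<tau>" unfolding abs_mult using that t by (intro mult_mono) auto
        then show ?thesis by auto
      qed
      have 1: "((\<lambda>s. s * t) has_vector_derivative t) (at s within {0..1})"
        by (auto intro!: derivative_eq_intros simp: has_real_derivative_iff_has_vector_derivative[symmetric])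
      have "((\<lambda>t. \<Phi> t x) has_vector_derivative V (\<Phi> (s * t) x)) (at (s * t) within (\<lambda>s. s * t) ` {0..1})"
        by (rule has_vector_derivative_within_subset[OF conjunct2[OF \<Phi>(2)[OF x mem[OF s]]]]) (use mem in auto)
      from vector_diff_chain_within[OF 1 this]
      show "\<Phi> (s * t) x \<in> S2 \<and> ((\<lambda>s. \<Phi> (s * t) x) has_vector_derivative F (t *\<^sub>R u) (\<Phi> (s * t) x)) (at s within {0..1})"
        using \<Phi>(2)[OF x mem[OF s]] by (simp add: o_def lin u)
    qed (use lin \<Phi>(1) in auto)
    then show ?thesis by simp
  qed
  then have "local_flow V \<tau> \<Phi>" unfolding local_flow_def using \<tau> \<Phi> by blast
  then show ?thesis by blast
qed

lemma rich_sphere_monoid_reaches: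
  assumes lin: "\<And>r u x. F (r *\<^sub>R u) x = r *\<^sub>R F u x"
    and rot: "\<And>b. \<exists>u. \<forall>x. F u x = x \<^bold>\<times> b"
    and quad: "\<And>x. F u\<^sub>1 x = x \<^bold>\<times> (A *v x)"
    and grad: "\<And>x. x \<in> S2 \<Longrightarrow> F u\<^sub>2 x = x \<^bold>\<times> (x \<^bold>\<times> k)"
    and "trace A = 0" "norm e = 1" "e \<bullet> (A *v e) \<noteq> 0" "k \<noteq> 0"
  shows "rich_sphere_monoid {g. reaches F g} A e k"
proof -
  interpret sphere_monoid "{g. reaches F g}" by (rule sphere_monoid_reaches[OF lin])
  have bracket_stable: "bracket_stable V DV" if "smooth_pair V DV" "\<And>x. x \<in> S2 \<Longrightarrow> x \<bullet> V x = 0" "\<And>x. x \<in> S2 \<Longrightarrow> F u x = V x" for V DV u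
    using reaches_local_flow[OF lin that] bracket_stable_local_flow[OF _ that(1)] by blast
  have sA: "smooth_pair (\<lambda>x. x \<^bold>\<times> (A *v x)) (\<lambda>x v. x \<^bold>\<times> (A *v v) + v \<^bold>\<times> (A *v x))"
    by (intro smooth_pair_bilinear[OF bounded_bilinear_cross3] smooth_pair_linear bounded_linear_ident matrix_vector_mul_bounded_linear)
  have sk: "smooth_pair (\<lambda>x. x \<^bold>\<times> (x \<^bold>\<times> k)) (\<lambda>x v. x \<^bold>\<times> (v \<^bold>\<times> k) + v \<^bold>\<times> (x \<^bold>\<times> k))"
    by (intro smooth_pair_bilinear[OF bounded_bilinear_cross3] smooth_pair_rotation smooth_pair_linear bounded_linear_ident)
  show ?thesis
  proof unfold_locales
    fix m :: "real ^ 3" assume "norm m = 1"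
    moreover obtain u where "\<forall>x. F u x = x \<^bold>\<times> (pi *\<^sub>R m)" using rot by blast
    ultimately have "reaches F (half_turn m)" by (intro reaches_half_turn[of F u]) (auto simp: lin)
    then show "half_turn m \<in> {g. reaches F g}" by simp
  next
    fix b :: "real ^ 3"
    obtain u where "\<forall>x. F u x = x \<^bold>\<times> b" using rot by blast
    then show "bracket_stable (\<lambda>x. x \<^bold>\<times> b) (\<lambda>x v. v \<^bold>\<times> b)"
      by (intro bracket_stable[of _ _ u] smooth_pair_rotation) (auto simp: dot_cross_self)
  next
    show "bracket_stable (\<lambda>x. x \<^bold>\<times> (A *v x)) (\<lambda>x v. v \<^bold>\<times> (A *v x) + x \<^bold>\<times> (A *v v))"
      by (rule bracket_stable_cong[OF bracket_stable[OF sA, of u\<^sub>1]]) (auto simp: quad dot_cross_self add.commute)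
    show "bracket_stable (\<lambda>x. x \<^bold>\<times> (x \<^bold>\<times> k)) (\<lambda>x v. v \<^bold>\<times> (x \<^bold>\<times> k) + x \<^bold>\<times> (v \<^bold>\<times> k))"
      by (rule bracket_stable_cong[OF bracket_stable[OF sk, of u\<^sub>2]]) (auto simp: grad dot_cross_self add.commute)
  qed (use assms in auto)
qed

text \<open>A vanishing combination of the \<open>l i\<close> is a vanishing combination of the
  linear functions, so the coefficient map is injective on a three-dimensional space and therefore
  onto.\<close>

lemma linear_system_spans:
  fixes l :: "3 \<Rightarrow> real ^ 3"
  assumes "linearly_independent_on S2 (\<lambda>i x. l i \<bullet> x)"
  shows "\<exists>a :: real ^ 3. (\<Sum>i\<in>UNIV. a $ i *\<^sub>R l i) = b"
proof -
  let ?L = "\<lambda>a :: real ^ 3. \<Sum>i\<in>UNIV. a $ i *\<^sub>R l i"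
  have lin: "linear ?L" by (intro linearI) (simp_all add: scaleR_add_left sum.distrib scaleR_sum_right)
  have "a = 0" if "?L a = 0" for a
  proof -
    have "(\<Sum>i\<in>UNIV. a $ i * (l i \<bullet> x)) = ?L a \<bullet> x" for x by (simp add: inner_sum_left)
    then have "\<forall>i. a $ i = 0" using assms that unfolding linearly_independent_on_def by simp
    then show ?thesis by (simp add: vec_eq_iff)
  qed
  then have "inj ?L" using linear_injective_0[OF lin] by blast
  then have "surj ?L" by (rule linear_injective_imp_surjective[OF lin]) simp
  from surjD[OF this, of b] obtain a where "b = ?L a" by blast
  then show ?thesis by (intro exI[of _ a]) simp
qed

lemma harmonic_control_system_rich:
  fixes l :: "3 \<Rightarrow> real ^ 3"
    and F :: "(real ^ 3) \<times> real \<times> real \<times> real \<times> real \<Rightarrow> real ^ 3 \<Rightarrow> real ^ 3"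
  assumes ind: "linearly_independent_on S2 (\<lambda>i x. l i \<bullet> x)"
    and q: "nonzero_spherical_harmonic 2 q"
    and l': "nonzero_spherical_harmonic 1 (\<lambda>x. l' \<bullet> x)"
    and F: "\<And>u v\<^sub>2 v\<^sub>3 w\<^sub>1 w\<^sub>2 x.
           F (u, v\<^sub>2, v\<^sub>3, w\<^sub>1, w\<^sub>2) x =
             (\<Sum>i\<in>UNIV. u $ i *\<^sub>R hamiltonian_field (\<lambda>y. l i \<bullet> y) x)
             + v\<^sub>2 *\<^sub>R hamiltonian_field q x
             + v\<^sub>3 *\<^sub>R hamiltonian_field c x
             + w\<^sub>1 *\<^sub>R spherical_gradient (\<lambda>y. l' \<bullet> y) x
             + w\<^sub>2 *\<^sub>R spherical_gradient q' x"
  shows "\<exists>A e k. rich_sphere_monoid {g. reaches F g} A e k"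
proof -
  obtain A e where A: "trace A = 0" "norm e = 1" "e \<bullet> (A *v e) \<noteq> 0"
    "\<And>x. hamiltonian_field q x = x \<^bold>\<times> (A *v x)"
    using harmonic_quadratic_field[OF q] by blast
  have lin: "F (r *\<^sub>R u) x = r *\<^sub>R F u x" for r u x
    by (cases u) (simp add: F scaleR_add_right scaleR_sum_right)
  have rot: "\<exists>u. \<forall>x. F u x = x \<^bold>\<times> b" for b
  proof -
    obtain a :: "real ^ 3" where a: "(\<Sum>i\<in>UNIV. a $ i *\<^sub>R l i) = b" using linear_system_spans[OF ind] by blast
    have "F (a, 0, 0, 0, 0) x = (\<Sum>i\<in>UNIV. a $ i *\<^sub>R (x \<^bold>\<times> l i))" for x
      by (simp add: F hamiltonian_field_def gradient_inner)
    also have "\<dots> x = x \<^bold>\<times> (\<Sum>i\<in>UNIV. a $ i *\<^sub>R l i)" for x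
      by (simp add: sum_3 cross_add_right cross_mult_right)
    finally show ?thesis unfolding a by blast
  qed
  have quad: "F (0, 1, 0, 0, 0) x = x \<^bold>\<times> (A *v x)" for x by (simp add: F A)
  \<comment> \<open>The spherical gradient agrees with a double cross product only for unit vectors,
    where \<open>x \<times> (x \<times> k) = \<langle>k, x\<rangle> x - k\<close>; this fixes the
    sign of \<open>k\<close>.\<close>
  have grad: "F (0, 0, 0, 1, 0) x = x \<^bold>\<times> (x \<^bold>\<times> (- l'))" if "x \<in> S2" for x
    using that inner_commute[of x l'] by (simp add: F spherical_gradient_def gradient_inner cross3_triple dot_square_norm)
  have "l' \<noteq> 0" using l' by (auto simp: nonzero_spherical_harmonic_def)
  then have "rich_sphere_monoid {g. reaches F g} A e (- l')"
    using A by (intro rich_sphere_monoid_reaches[OF lin rot quad grad]) auto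
  then show ?thesis by blast
qed

section \<open>Finite ensembles\<close>

text \<open>
  Brouwer's theorem for a dimension that is a number rather than a type: \<open>2 N\<close> varies with the ensemble.
  Without a zero, normalising \<open>f\<close> would contract the sphere.
\<close>

lemma near_identity_has_zero:
  fixes f :: "(nat \<Rightarrow> real) \<Rightarrow> nat \<Rightarrow> real" and n :: nat
  defines "D \<equiv> {s. (\<Sum>i\<le>n. (s i)\<^sup>2) \<le> 1 \<and> (\<forall>i>n. s i = 0)}"
  assumes cont: "\<And>i. i \<le> n \<Longrightarrow> continuous_on D (\<lambda>s. f s i)"
    and close: "\<And>s. s \<in> D \<Longrightarrow> (\<Sum>i\<le>n. (f s i - s i)\<^sup>2) < 1"
  shows "\<exists>s\<in>D. \<forall>i\<le>n. f s i = 0"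
proof (rule ccontr)
  assume nz: "\<not> (\<exists>s\<in>D. \<forall>i\<le>n. f s i = 0)"
  \<comment> \<open>The sphere \<open>nsphere n\<close> has \<open>n + 1\<close> coordinates, those
    of index at most \<open>n\<close>.\<close>
  define S where "S = {s. (\<Sum>i\<le>n. (s i)\<^sup>2) = (1::real) \<and> (\<forall>i>n. s i = 0)}"
  have nsphere: "nsphere n = top_of_set S"
    unfolding nsphere S_def euclidean_product_topology ..
  have pos: "(\<Sum>i\<le>n. (v i)\<^sup>2) > 0 \<longleftrightarrow> (\<exists>i\<le>n. v i \<noteq> 0)" for v :: "nat \<Rightarrow> real"
  proof -
    have "(\<Sum>i\<le>n. (v i)\<^sup>2) = 0 \<longleftrightarrow> (\<forall>i\<le>n. v i = 0)" by (subst sum_nonneg_eq_0_iff) auto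
    moreover have "(\<Sum>i\<le>n. (v i)\<^sup>2) \<ge> 0" by (intro sum_nonneg) auto
    ultimately show ?thesis by (metis order.not_eq_order_implies_strict order_less_irrefl)
  qed
  define N where "N v = (\<lambda>i. if i \<le> n then v i / sqrt (\<Sum>i\<le>n. (v i)\<^sup>2) else 0)" for v :: "nat \<Rightarrow> real"
  have N_S: "N v \<in> S" if "\<exists>i\<le>n. v i \<noteq> 0" for v
  proof -
    have p: "(\<Sum>i\<le>n. (v i)\<^sup>2) > 0" using that pos by blast
    have "(\<Sum>i\<le>n. (N v i)\<^sup>2) = (\<Sum>i\<le>n. (v i)\<^sup>2 / (\<Sum>i\<le>n. (v i)\<^sup>2))"
      using p by (intro sum.cong) (auto simp: N_def power_divide)
    also have "\<dots> = 1" using p by (simp add: sum_divide_distrib[symmetric])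
    finally show ?thesis by (simp add: S_def N_def)
  qed
  have hom: "homotopic_with_canon (\<lambda>x. True) S S (\<lambda>s. N (g (0, s))) (\<lambda>s. N (g (1, s)))"
    if g: "\<And>i. i \<le> n \<Longrightarrow> continuous_on ({0..1} \<times> S) (\<lambda>p. g p i)"
      and g0: "\<And>t s. t \<in> {0..1} \<Longrightarrow> s \<in> S \<Longrightarrow> \<exists>i\<le>n. g (t, s) i \<noteq> 0" for g :: "real \<times> (nat \<Rightarrow> real) \<Rightarrow> nat \<Rightarrow> real"
  proof -
    have sq: "sqrt (\<Sum>i\<le>n. (g p i)\<^sup>2) \<noteq> 0" if "p \<in> {0..1} \<times> S" for p
      using that g0[of "fst p" "snd p"] pos[of "g p"] by auto
    have "continuous_on ({0..1} \<times> S) (\<lambda>p. N (g p) i)" for i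
    proof (cases "i \<le> n")
      case True
      have "continuous_on ({0..1} \<times> S) (\<lambda>p. g p i / sqrt (\<Sum>i\<le>n. (g p i)\<^sup>2))"
        using sq True by (intro continuous_intros g) auto
      then show ?thesis using True by (simp add: N_def)
    qed (simp add: N_def)
    then have "continuous_on ({0..1} \<times> S) (\<lambda>p. N (g p))" by (rule continuous_on_coordinatewise_then_product)
    moreover have "N (g p) \<in> S" if "p \<in> {0..1} \<times> S" for p using that g0[of "fst p" "snd p"] by (intro N_S) auto
    ultimately have "continuous_map (prod_topology (top_of_set {0..1}) (top_of_set S)) (top_of_set S) (\<lambda>p. N (g p))"
      by (auto simp: prod_topology_subtopology_eu)
    then show ?thesis unfolding homotopic_with_def by (intro exI[of _ "\<lambda>p. N (g p)"]) auto
  qed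
  have SD: "(\<lambda>i. t * s i) \<in> D" if "t \<in> {0..1}" "s \<in> S" for s t
  proof -
    have "(\<Sum>i\<le>n. (t * s i)\<^sup>2) = t\<^sup>2 * (\<Sum>i\<le>n. (s i)\<^sup>2)"
      by (simp add: power_mult_distrib sum_distrib_left)
    also have "(\<Sum>i\<le>n. (s i)\<^sup>2) = 1" using that by (simp add: S_def)
    finally have "(\<Sum>i\<le>n. (t * s i)\<^sup>2) = t\<^sup>2 * 1" .
    moreover have "t\<^sup>2 \<le> 1" using that by (simp add: power_le_one)
    moreover have "t * s i = 0" if "i > n" for i using \<open>s \<in> S\<close> that by (simp add: S_def)
    ultimately show ?thesis by (simp add: D_def)
  qed
  have "S \<subseteq> D" by (auto simp: S_def D_def)
  have coord: "continuous_on A (\<lambda>p. snd p i)" for A :: "(real \<times> (nat \<Rightarrow> real)) set" and i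
    by (rule continuous_on_product_then_coordinatewise[OF continuous_on_snd[OF continuous_on_id]])
  have fS: "continuous_on ({0..1} \<times> S) (\<lambda>p. f (snd p) i)" if "i \<le> n" for i :: nat
    using \<open>S \<subseteq> D\<close> by (intro continuous_on_compose2[OF cont[OF that] continuous_on_snd[OF continuous_on_id]]) auto
  \<comment> \<open>Straight from \<open>s\<close> to \<open>f s\<close>: a zero on the way would
    give \<open>s = - t (f s - s)\<close>, whose left side has norm 1 and whose right side has norm
    below 1.\<close>
  have h1: "homotopic_with_canon (\<lambda>x. True) S S (\<lambda>s. N (\<lambda>i. s i + 0 * (f s i - s i))) (\<lambda>s. N (\<lambda>i. s i + 1 * (f s i - s i)))"
  proof -
    have "\<exists>i\<le>n. s i + t * (f s i - s i) \<noteq> 0" if ts: "t \<in> {0..1}" "s \<in> S" for t s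
    proof (rule ccontr)
      assume "\<not> ?thesis"
      then have *: "s i = - (t * (f s i - s i))" if "i \<le> n" for i using that by force
      have "1 = (\<Sum>i\<le>n. (s i)\<^sup>2)" using ts by (simp add: S_def)
      also have "\<dots> = (\<Sum>i\<le>n. t\<^sup>2 * (f s i - s i)\<^sup>2)"
      proof (rule sum.cong)
        fix i assume "i \<in> {..n}"
        then have "(s i)\<^sup>2 = (- (t * (f s i - s i)))\<^sup>2" using *[of i] by (metis atMost_iff)
        then show "(s i)\<^sup>2 = t\<^sup>2 * (f s i - s i)\<^sup>2" by (simp add: power_mult_distrib)
      qed simp
      also have "\<dots> = t\<^sup>2 * (\<Sum>i\<le>n. (f s i - s i)\<^sup>2)" by (simp add: sum_distrib_left)
      also have "\<dots> \<le> 1 * (\<Sum>i\<le>n. (f s i - s i)\<^sup>2)"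
        using ts by (intro mult_right_mono sum_nonneg) (auto simp: power_le_one)
      also have "\<dots> < 1" using close[of s] ts \<open>S \<subseteq> D\<close> by auto
      finally show False by simp
    qed
    moreover have "continuous_on ({0..1} \<times> S) (\<lambda>p. snd p i + fst p * (f (snd p) i - snd p i))" if "i \<le> n" for i
      by (intro continuous_intros coord fS that)
    ultimately show ?thesis
      using hom[of "\<lambda>p i. snd p i + fst p * (f (snd p) i - snd p i)"] by auto
  qed
  \<comment> \<open>Shrinking the argument of \<open>f\<close> to the centre of the ball;
    normalisation is possible because \<open>f\<close> is supposed to have no zero there.\<close>
  have h2: "homotopic_with_canon (\<lambda>x. True) S S (\<lambda>s. N (f (\<lambda>i. (1 - 0) * s i))) (\<lambda>s. N (f (\<lambda>i. (1 - 1) * s i)))"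
  proof -
    have "continuous_on ({0..1} \<times> S) (\<lambda>p. f (\<lambda>i. (1 - fst p) * snd p i) i)" if "i \<le> n" for i
    proof (rule continuous_on_compose2[OF cont[OF that]])
      show "continuous_on ({0..1} \<times> S) (\<lambda>p i. (1 - fst p) * snd p i)"
        by (intro continuous_on_coordinatewise_then_product continuous_intros coord)
      show "(\<lambda>p i. (1 - fst p) * snd p i) ` ({0..1} \<times> S) \<subseteq> D" using SD[of "1 - _"] by auto
    qed
    moreover have "\<exists>i\<le>n. f (\<lambda>i. (1 - t) * s i) i \<noteq> 0" if "t \<in> {0..1}" "s \<in> S" for t s
      using nz SD[of "1 - t" s] that by auto
    ultimately show ?thesis
      using hom[of "\<lambda>p. f (\<lambda>i. (1 - fst p) * snd p i)"] by auto
  qed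
  have "homotopic_with_canon (\<lambda>x. True) S S (\<lambda>s. N (\<lambda>i. s i + 0 * (f s i - s i))) (\<lambda>s. N (f (\<lambda>i. (1 - 1) * s i)))"
    using homotopic_with_trans[OF h1] h2 by simp
  then have "homotopic_with_canon (\<lambda>x. True) S S id (\<lambda>s. N (f (\<lambda>i. 0)))"
  proof (rule homotopic_with_eq)
    fix s assume "s \<in> topspace (top_of_set S)"
    then have "(\<Sum>i\<le>n. (s i)\<^sup>2) = 1" "\<forall>i>n. s i = 0" by (auto simp: S_def)
    then show "id s = N (\<lambda>i. s i + 0 * (f s i - s i))" by (auto simp: N_def)
  qed auto
  then have "contractible_space (nsphere n)" unfolding nsphere contractible_space_def by blast
  then show False using non_contractible_space_nsphere by blast
qed

text \<open>Removing one of the points turns the sphere into a plane by stereographic projection,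
  and a plane minus countably many points is path connected.\<close>

lemma connected_sphere_diff_finite:
  assumes "finite A"
  shows "connected (S2 - A)"
proof (cases "S2 \<inter> A = {}")
  case True
  then have "S2 - A = S2" by blast
  then show ?thesis by (simp add: connected_sphere)
next
  case False
  then obtain a where a: "a \<in> S2" "a \<in> A" by blast
  have "(S2 \<inter> UNIV) - {a} homeomorphic (UNIV :: (real ^ 2) set)"
    by (rule homeomorphic_punctured_affine_sphere_affine) (use a in auto)
  then obtain h k where hk: "homeomorphism (S2 - {a}) (UNIV :: (real ^ 2) set) h k"
    unfolding homeomorphic_def by auto
  note hk1 = homeomorphism_apply1[OF hk] and hk2 = homeomorphism_apply2[OF hk]
    and img = homeomorphism_image2[OF hk]
  define B where "B = h ` (S2 \<inter> A - {a})"
  have B: "finite B" using assms by (simp add: B_def)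
  have "connected (- B)"
    by (intro path_connected_imp_connected path_connected_complement_countable countable_finite B) simp
  moreover have "continuous_on (- B) k" by (rule continuous_on_subset[OF homeomorphism_cont2[OF hk]]) simp
  ultimately have "connected (k ` (- B))" by (rule connected_continuous_image[rotated])
  moreover have "k ` (- B) = S2 - A"
  proof (intro equalityI subsetI)
    fix x assume "x \<in> k ` (- B)"
    then obtain y where y: "x = k y" "y \<notin> B" by auto
    have "x \<in> S2 - {a}" unfolding y(1) img[symmetric] by (rule imageI) (rule UNIV_I)
    moreover have "h x = y" unfolding y(1) by (simp add: hk2)
    moreover have "x \<notin> A"
    proof
      assume "x \<in> A"
      then have "h x \<in> B" using \<open>x \<in> S2 - {a}\<close> by (auto simp: B_def)
      then show False using y \<open>h x = y\<close> by simp
    qed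
    ultimately show "x \<in> S2 - A" by simp
  next
    fix x assume x: "x \<in> S2 - A"
    then have xa: "x \<in> S2 - {a}" using a by auto
    then have k: "k (h x) = x" by (rule hk1)
    have "h x \<notin> B"
    proof
      assume "h x \<in> B"
      then obtain z where z: "h x = h z" "z \<in> S2 \<inter> A - {a}" unfolding B_def by (rule imageE)
      then have "k (h z) = z" by (intro hk1) auto
      then have "x = z" using k z(1) by simp
      then show False using z(2) x by simp
    qed
    then show "x \<in> k ` (- B)" using k by (intro image_eqI[of _ _ "h x"]) auto
  qed
  ultimately show ?thesis by simp
qed

text \<open>The last clause is what steering uses: two scalar equations detect that a vector has no
  tangential part. The frame is a unit vector \<open>a\<close> orthogonal to \<open>p\<close>
  together with \<open>p \<times> a\<close>.\<close>

lemma tangent_frame: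
  assumes "p \<in> S2"
  shows "\<exists>\<tau>\<^sub>0 \<tau>\<^sub>1. norm \<tau>\<^sub>0 = 1 \<and> norm \<tau>\<^sub>1 = 1 \<and> \<tau>\<^sub>0 \<bullet> p = 0 \<and> \<tau>\<^sub>1 \<bullet> p = 0 \<and> \<tau>\<^sub>0 \<bullet> \<tau>\<^sub>1 = 0 \<and>
    (\<forall>v. v \<bullet> \<tau>\<^sub>0 = 0 \<longrightarrow> v \<bullet> \<tau>\<^sub>1 = 0 \<longrightarrow> v = (v \<bullet> p) *\<^sub>R p)"
proof -
  obtain m where m: "m \<noteq> 0" "orthogonal p m" using orthogonal_to_vector_exists[of p] by auto
  define a where "a = sgn m"
  have a: "norm a = 1" "a \<bullet> p = 0"
    using m by (simp_all add: a_def norm_sgn sgn_div_norm orthogonal_def inner_commute)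
  have p: "norm p = 1" "p \<bullet> p = 1" using assms by (simp_all add: dot_square_norm)
  define b where "b = p \<^bold>\<times> a"
  have "(norm b)\<^sup>2 = 1" using norm_cross_dot[of p a] a p by (simp add: b_def inner_commute)
  then have b: "norm b = 1" using norm_ge_zero[of b] unfolding power2_eq_1_iff by linarith
  have "v = (v \<bullet> p) *\<^sub>R p" if v: "v \<bullet> a = 0" "v \<bullet> b = 0" for v
  proof -
    define u where "u = v - (v \<bullet> p) *\<^sub>R p"
    have u: "u \<bullet> a = 0" "u \<bullet> b = 0" "u \<bullet> p = 0"
    proof -
      have "p \<bullet> a = 0" using a(2) by (simp add: inner_commute)
      then show "u \<bullet> a = 0" using v(1) by (simp add: u_def inner_diff_left)
      have "p \<bullet> b = 0" by (simp add: b_def dot_cross_self)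
      then show "u \<bullet> b = 0" using v(2) by (simp add: u_def inner_diff_left)
      show "u \<bullet> p = 0" using p(2) by (simp add: u_def inner_diff_left)
    qed
    have "u \<^bold>\<times> b = 0" using u by (simp add: b_def cross3_triple)
    then have "(norm u)\<^sup>2 = 0" using norm_cross_dot[of u b] u b by simp
    then show ?thesis by (simp add: u_def)
  qed
  then show ?thesis
    using a b by (intro exI[of _ a] exI[of _ b]) (auto simp: b_def dot_cross_self)
qed

text \<open>Orthogonal projection along \<open>p\<close> is injective on the open hemisphere around
  \<open>p\<close>: comparing the norms of \<open>x\<close> and \<open>y\<close> gives
  \<open>c * (x \<bullet> p + y \<bullet> p) = 0\<close>.\<close>

lemma sphere_point_determined:
  assumes "p \<in> S2" "x \<in> S2" "y \<in> S2" and c: "x - y = c *\<^sub>R p" and pos: "x \<bullet> p > 0" "y \<bullet> p > 0"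
  shows "x = y"
proof -
  have "x = y + c *\<^sub>R p" using c by (simp add: algebra_simps)
  moreover have "x \<bullet> x = 1" "y \<bullet> y = 1" "p \<bullet> p = 1" using assms by (simp_all add: dot_square_norm)
  ultimately have "c * (x \<bullet> p + y \<bullet> p) = 0"
    by (simp add: inner_add_left inner_add_right inner_commute algebra_simps)
  then have "c = 0" using pos by auto
  then show ?thesis using c by simp
qed

context rich_sphere_monoid begin

text \<open>The error is measured against a common bound \<open>\<rho>\<close> of all parameters, so
  that after rescaling them to the unit ball the map is uniformly close to its linear part.\<close>

lemma accessible_multi_family:
  fixes m :: nat
  assumes V: "\<And>i. i < m \<Longrightarrow> accessible (V i)" and "\<eta> > 0"
  shows "\<exists>\<Psi> \<rho>0. \<rho>0 > 0 \<and> (\<forall>s. \<Psi> s \<in> M) \<and> (\<forall>x\<in>S2. continuous_on UNIV (\<lambda>s. \<Psi> s x)) \<and>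
    (\<forall>\<rho> s x. 0 < \<rho> \<longrightarrow> \<rho> \<le> \<rho>0 \<longrightarrow> (\<forall>i<m. \<bar>s i\<bar> \<le> \<rho>) \<longrightarrow> x \<in> S2 \<longrightarrow>
       norm (\<Psi> s x - x - (\<Sum>i<m. s i *\<^sub>R V i x)) \<le> \<eta> * \<rho>)"
  using assms
proof (induction m arbitrary: \<eta>)
  case 0
  have "continuous_on UNIV (\<lambda>s :: nat \<Rightarrow> real. id x)" for x :: "real ^ 3" by simp
  then show ?case using 0 by (intro exI[of _ "\<lambda>s. id"] exI[of _ 1]) (auto simp: id_mem[unfolded id_def])
next
  case (Suc m)
  then have tV: "accessible (V m)" and cV: "continuous_on S2 (V m)" by (auto simp: accessible_def)
  have IH: "\<And>i. i < m \<Longrightarrow> accessible (V i)" "\<eta>/3 > 0" using Suc.prems by auto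
  from Suc.IH[OF IH]
  obtain \<Psi> \<rho>1 where \<Psi>: "\<rho>1 > 0" "\<And>s. \<Psi> s \<in> M" "\<And>x. x \<in> S2 \<Longrightarrow> continuous_on UNIV (\<lambda>s. \<Psi> s x)"
    "\<And>\<rho> s x. 0 < \<rho> \<Longrightarrow> \<rho> \<le> \<rho>1 \<Longrightarrow> (\<forall>i<m. \<bar>s i\<bar> \<le> \<rho>) \<Longrightarrow> x \<in> S2 \<Longrightarrow>
       norm (\<Psi> s x - x - (\<Sum>i<m. s i *\<^sub>R V i x)) \<le> (\<eta>/3) * \<rho>"
    by blast
  have "accessible_within (\<eta>/3) (V m)" using tV Suc.prems by (auto simp: accessible_def)
  from accessible_withinE[OF this] obtain \<psi> \<rho>2 where \<psi>: "family \<psi>" "\<rho>2 > 0"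
    "\<And>h x. \<bar>h\<bar> \<le> \<rho>2 \<Longrightarrow> x \<in> S2 \<Longrightarrow> norm (\<psi> h x - x - h *\<^sub>R V m x) \<le> (\<eta>/3) * \<bar>h\<bar>" by blast
  have "\<exists>B>0. \<forall>i<m. \<forall>x\<in>S2. norm (V i x) \<le> B"
  proof -
    have "\<exists>B. \<forall>x\<in>S2. norm (V i x) \<le> B" if "i < m" for i
    proof -
      have "continuous_on S2 (V i)" using Suc.prems(1)[of i] that by (auto simp: accessible_def)
      then have "bounded (V i ` S2)" by (intro compact_imp_bounded compact_continuous_image) auto
      then show ?thesis by (auto simp: bounded_iff)
    qed
    then obtain B where B: "\<And>i x. i < m \<Longrightarrow> x \<in> S2 \<Longrightarrow> norm (V i x) \<le> B i" by metis
    have "norm (V i x) \<le> 1 + (\<Sum>i<m. \<bar>B i\<bar>)" if "i < m" "x \<in> S2" for i x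
      using B[OF that] member_le_sum[of i "{..<m}" "\<lambda>i. \<bar>B i\<bar>"] that by auto
    then show ?thesis by (intro exI[of _ "1 + (\<Sum>i<m. \<bar>B i\<bar>)"]) (auto simp: add_pos_nonneg sum_nonneg)
  qed
  then obtain B where B: "B > 0" "\<And>i x. i < m \<Longrightarrow> x \<in> S2 \<Longrightarrow> norm (V i x) \<le> B" by blast
  have "uniformly_continuous_on S2 (V m)" by (rule compact_uniformly_continuous[OF cV]) simp
  moreover have "\<eta>/3 > 0" using Suc.prems by simp
  ultimately obtain d where d: "d > 0" "\<And>x y. x \<in> S2 \<Longrightarrow> y \<in> S2 \<Longrightarrow> dist y x < d \<Longrightarrow> dist (V m y) (V m x) < \<eta>/3"
    unfolding uniformly_continuous_on_def by metis
  \<comment> \<open>The first \<open>m\<close> families move a point by at most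
    \<open>\<rho> * E\<close>, which \<open>\<rho>0\<close> keeps below the modulus of continuity
    \<open>d\<close> of \<open>V m\<close>.\<close>
  define E where "E = real m * B + \<eta>"
  have E: "E > 0" using B Suc.prems by (auto simp: E_def intro: add_nonneg_pos)
  define \<rho>0 where "\<rho>0 = min (min \<rho>1 \<rho>2) (d / (2 * E))"
  have \<rho>0: "\<rho>0 > 0" using \<Psi> \<psi> d E by (simp add: \<rho>0_def)
  have "norm ((\<psi> (s m) \<circ> \<Psi> s) x - x - (\<Sum>i<Suc m. s i *\<^sub>R V i x)) \<le> \<eta> * \<rho>"
    if \<rho>: "0 < \<rho>" "\<rho> \<le> \<rho>0" and s: "\<forall>i<Suc m. \<bar>s i\<bar> \<le> \<rho>" and x: "x \<in> S2" for \<rho> s x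
  proof -
    let ?y = "\<Psi> s x" and ?S = "\<Sum>i<m. s i *\<^sub>R V i x"
    have y: "?y \<in> S2" by (rule maps_S2[OF \<Psi>(2) x])
    have 1: "norm (?y - x - ?S) \<le> (\<eta>/3) * \<rho>" using \<Psi>(4)[of \<rho> s x] \<rho> s x by (auto simp: \<rho>0_def)
    have sm: "\<bar>s m\<bar> \<le> \<rho>" using s by auto
    have "norm (\<psi> (s m) ?y - ?y - s m *\<^sub>R V m ?y) \<le> (\<eta>/3) * \<bar>s m\<bar>"
      using \<psi>(3)[of "s m" ?y] sm \<rho> y by (auto simp: \<rho>0_def)
    also have "\<dots> \<le> (\<eta>/3) * \<rho>" using sm Suc.prems by (intro mult_left_mono) auto
    finally have 2: "norm (\<psi> (s m) ?y - ?y - s m *\<^sub>R V m ?y) \<le> (\<eta>/3) * \<rho>" .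
    have "norm ?S \<le> (\<Sum>i<m. \<rho> * B)"
      using s B(2)[OF _ x] \<rho> by (intro sum_norm_le) (auto intro!: mult_mono)
    then have "norm (?y - x) \<le> (\<eta>/3) * \<rho> + real m * (\<rho> * B)"
      using 1 norm_triangle_ineq[of "?y - x - ?S" ?S] by simp
    also have "\<dots> \<le> \<eta> * \<rho> + real m * (\<rho> * B)" using \<rho> Suc.prems B(1) by (intro add_mono mult_right_mono) auto
    also have "\<dots> = \<rho> * E" by (simp add: E_def algebra_simps)
    also have "\<dots> \<le> (d / (2 * E)) * E" using \<rho> E by (intro mult_right_mono) (auto simp: \<rho>0_def)
    also have "\<dots> < d" using E d by simp
    finally have "norm (V m ?y - V m x) \<le> \<eta>/3" using d(2)[OF x y] by (simp add: dist_norm)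
    then have 3: "norm (s m *\<^sub>R (V m ?y - V m x)) \<le> \<rho> * (\<eta>/3)"
      using sm \<rho> unfolding norm_scaleR by (intro mult_mono) auto
    have "(\<psi> (s m) \<circ> \<Psi> s) x - x - (\<Sum>i<Suc m. s i *\<^sub>R V i x)
       = (\<psi> (s m) ?y - ?y - s m *\<^sub>R V m ?y) + (?y - x - ?S) + s m *\<^sub>R (V m ?y - V m x)"
      by (simp add: algebra_simps)
    also have "norm \<dots> \<le> (\<eta>/3) * \<rho> + (\<eta>/3) * \<rho> + \<rho> * (\<eta>/3)"
      by (intro norm_triangle_mono 1 2 3)
    also have "\<dots> = \<eta> * \<rho>" by simp
    finally show ?thesis .
  qed
  moreover have "\<psi> (s m) \<circ> \<Psi> s \<in> M" for s using comp_mem \<psi>(1) \<Psi>(2) by (auto simp: family_def)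
  moreover have "continuous_on UNIV (\<lambda>s. (\<psi> (s m) \<circ> \<Psi> s) x)" if x: "x \<in> S2" for x
  proof -
    have c: "continuous_on (UNIV \<times> S2) (\<lambda>(h, x). \<psi> h x)" using \<psi>(1) by (simp add: family_def)
    have "continuous_on UNIV (\<lambda>s. (s m, \<Psi> s x))"
      by (intro continuous_on_Pair \<Psi>(3)[OF x] continuous_on_product_then_coordinatewise[OF continuous_on_id])
    then have "continuous_on UNIV (\<lambda>s. (\<lambda>(h, x). \<psi> h x) (s m, \<Psi> s x))"
      by (rule continuous_on_compose2[OF c]) (use maps_S2[OF \<Psi>(2) x] in auto)
    then show ?thesis by simp
  qed
  ultimately show ?case
    using \<rho>0 by (intro exI[of _ "\<lambda>s. \<psi> (s m) \<circ> \<Psi> s"] exI[of _ \<rho>0]) blast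
qed

text \<open>Field \<open>i\<close> belongs to the point \<open>i div 2\<close>, and the parity of
  \<open>i\<close> selects one of its two frame vectors. At the given points the tangential
  components of the fields form an identity matrix.\<close>

lemma interpolating_fields:
  fixes \<omega> :: "nat \<Rightarrow> real ^ 3" and N :: nat
  assumes sub: "\<omega> ` {..<N} \<subseteq> S2" and inj: "inj_on \<omega> {..<N}"
  shows "\<exists>V \<tau>. (\<forall>i<2 * N. accessible (V i) \<and> norm (\<tau> i) = 1) \<and>
    (\<forall>i<2 * N. \<forall>j<2 * N. V j (\<omega> (i div 2)) \<bullet> \<tau> i = (if j = i then 1 else 0) \<and> norm (V j (\<omega> (i div 2))) \<le> 1) \<and>
    (\<forall>k<N. \<forall>v. v \<bullet> \<tau> (2 * k) = 0 \<longrightarrow> v \<bullet> \<tau> (2 * k + 1) = 0 \<longrightarrow> v = (v \<bullet> \<omega> k) *\<^sub>R \<omega> k)"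
proof -
  have \<omega>: "\<omega> k \<in> S2" if "k < N" for k using sub that by blast
  have "\<forall>k. \<exists>\<tau>\<^sub>0 \<tau>\<^sub>1. k < N \<longrightarrow> norm \<tau>\<^sub>0 = 1 \<and> norm \<tau>\<^sub>1 = 1 \<and> \<tau>\<^sub>0 \<bullet> \<omega> k = 0 \<and> \<tau>\<^sub>1 \<bullet> \<omega> k = 0 \<and> \<tau>\<^sub>0 \<bullet> \<tau>\<^sub>1 = 0 \<and>
    (\<forall>v. v \<bullet> \<tau>\<^sub>0 = 0 \<longrightarrow> v \<bullet> \<tau>\<^sub>1 = 0 \<longrightarrow> v = (v \<bullet> \<omega> k) *\<^sub>R \<omega> k)"
    using tangent_frame[OF \<omega>] by blast
  then obtain t0 t1 where t: "\<And>k. k < N \<Longrightarrow> norm (t0 k) = 1 \<and> norm (t1 k) = 1 \<and> t0 k \<bullet> \<omega> k = 0 \<and> t1 k \<bullet> \<omega> k = 0 \<and> t0 k \<bullet> t1 k = 0 \<and>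
    (\<forall>v. v \<bullet> t0 k = 0 \<longrightarrow> v \<bullet> t1 k = 0 \<longrightarrow> v = (v \<bullet> \<omega> k) *\<^sub>R \<omega> k)"
    by metis
  define \<tau> where "\<tau> i = (if even i then t0 (i div 2) else t1 (i div 2))" for i
  have n\<tau>: "norm (\<tau> i) = 1" "\<tau> i \<bullet> \<omega> (i div 2) = 0" if "i < 2 * N" for i
    using t[of "i div 2"] that by (auto simp: \<tau>_def)
  have o\<tau>: "\<tau> j \<bullet> \<tau> i = (if j = i then 1 else 0)" if ij: "i < 2 * N" "j div 2 = i div 2" for i j
  proof (cases "j = i")
    case True
    then show ?thesis using n\<tau>(1)[OF ij(1)] by (simp add: dot_square_norm)
  next
    case False
    then have "even j \<noteq> even i" using ij(2) by (metis dvd_mult_div_cancel odd_two_times_div_two_succ)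
    then show ?thesis using t[of "i div 2"] ij False by (auto simp: \<tau>_def inner_commute)
  qed
  define \<beta> where "\<beta> k x = (\<Prod>j\<in>{..<N} - {k}. (norm (x - \<omega> j))\<^sup>2 / (norm (\<omega> k - \<omega> j))\<^sup>2)" for k x
  have \<beta>1: "\<beta> k (\<omega> k) = 1" if "k < N" for k
    unfolding \<beta>_def using inj that by (intro prod.neutral) (auto simp: inj_on_def)
  have \<beta>0: "\<beta> k (\<omega> l) = 0" if "l < N" "l \<noteq> k" for k l
    unfolding \<beta>_def using that by (intro prod_zero) auto
  define V where "V i x = \<beta> (i div 2) x *\<^sub>R (\<tau> i - (\<tau> i \<bullet> x) *\<^sub>R x)" for i x
  have "accessible (V i)" for i
  proof (rule accessible_continuous)
    show "continuous_on S2 (V i)" unfolding V_def \<beta>_def divide_inverse by (intro continuous_intros)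
    show "x \<bullet> V i x = 0" if "x \<in> S2" for x
      using that by (simp add: V_def inner_diff_right dot_square_norm inner_commute)
  qed
  moreover have "V j (\<omega> (i div 2)) \<bullet> \<tau> i = (if j = i then 1 else 0) \<and> norm (V j (\<omega> (i div 2))) \<le> 1"
    if ij: "i < 2 * N" "j < 2 * N" for i j
  proof (cases "j div 2 = i div 2")
    case True
    have "i div 2 < N" using ij by auto
    then have "V j (\<omega> (i div 2)) = \<tau> j" using \<beta>1 n\<tau>(2)[OF ij(2)] True by (simp add: V_def)
    then show ?thesis using o\<tau>[OF ij(1) True] n\<tau>(1)[OF ij(2)] by simp
  next
    case False
    have "i div 2 < N" using ij by auto
    then have "V j (\<omega> (i div 2)) = 0" using \<beta>0 False by (simp add: V_def)
    then show ?thesis using False by auto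
  qed
  moreover have "v = (v \<bullet> \<omega> k) *\<^sub>R \<omega> k" if "k < N" "v \<bullet> \<tau> (2 * k) = 0" "v \<bullet> \<tau> (2 * k + 1) = 0" for k v
    using t[OF that(1)] that(2,3) by (auto simp: \<tau>_def)
  ultimately show ?thesis using n\<tau>(1) by (intro exI[of _ V] exI[of _ \<tau>]) blast
qed

lemma finite_uniform_modulus:
  fixes V :: "nat \<Rightarrow> real ^ 3 \<Rightarrow> real ^ 3"
  assumes "\<And>i. i < m \<Longrightarrow> continuous_on S2 (V i)" "\<eta> > 0"
  shows "\<exists>d>0. \<forall>i<m. \<forall>x\<in>S2. \<forall>y\<in>S2. norm (x - y) < d \<longrightarrow> norm (V i x - V i y) \<le> \<eta>"
  using assms(1)
proof (induction m)
  case 0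
  show ?case by (intro exI[of _ 1]) auto
next
  case (Suc m)
  then obtain d where d: "d > 0" "\<forall>i<m. \<forall>x\<in>S2. \<forall>y\<in>S2. norm (x - y) < d \<longrightarrow> norm (V i x - V i y) \<le> \<eta>"
    by (metis less_SucI)
  have "uniformly_continuous_on S2 (V m)" by (rule compact_uniformly_continuous[OF Suc.prems]) auto
  then obtain e where e: "e > 0" "\<forall>x\<in>S2. \<forall>y\<in>S2. dist y x < e \<longrightarrow> dist (V m y) (V m x) < \<eta>"
    unfolding uniformly_continuous_on_def using \<open>\<eta> > 0\<close> by blast
  have "norm (V i x - V i y) \<le> \<eta>" if "i < Suc m" "x \<in> S2" "y \<in> S2" "norm (x - y) < min d e" for i x y
  proof (cases "i = m")
    case True
    then have "dist (V m x) (V m y) < \<eta>" using e(2) that by (simp add: dist_norm)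
    then show ?thesis using True by (simp add: dist_norm)
  next
    case False
    then show ?thesis using d(2) that by simp
  qed
  then show ?case using d(1) e(1) by (intro exI[of _ "min d e"]) auto
qed

text \<open>The tangential mismatch with the target, divided by \<open>\<rho>\<close>, is a map of
  the unit ball close to the identity. A zero of it makes all tangential mismatches vanish at the
  same time, and the radial ones then vanish because the points lie on the sphere.\<close>

lemma local_exact_steering:
  fixes \<omega> :: "nat \<Rightarrow> real ^ 3" and N :: nat
  assumes N: "N \<ge> 1" and sub: "\<omega> ` {..<N} \<subseteq> S2" and inj: "inj_on \<omega> {..<N}"
  shows "\<exists>\<delta>>0. \<forall>y z. (\<forall>k<N. y k \<in> S2 \<and> z k \<in> S2 \<and> norm (y k - \<omega> k) < \<delta> \<and> norm (z k - \<omega> k) < \<delta>) \<longrightarrow>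
    (\<exists>g\<in>M. \<forall>k<N. g (y k) = z k)"
proof -
  have \<omega>: "\<omega> k \<in> S2" if "k < N" for k using sub that by blast
  define m where "m = 2 * N"
  have m: "real m \<ge> 1" "m \<ge> 1" using N by (auto simp: m_def)
  from interpolating_fields[OF sub inj] obtain V \<tau> where
    I: "\<forall>i<2 * N. accessible (V i) \<and> norm (\<tau> i) = 1"
      "\<forall>i<2 * N. \<forall>j<2 * N. V j (\<omega> (i div 2)) \<bullet> \<tau> i = (if j = i then 1 else 0) \<and> norm (V j (\<omega> (i div 2))) \<le> 1"
      "\<forall>k<N. \<forall>v. v \<bullet> \<tau> (2 * k) = 0 \<longrightarrow> v \<bullet> \<tau> (2 * k + 1) = 0 \<longrightarrow> v = (v \<bullet> \<omega> k) *\<^sub>R \<omega> k"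
    by (elim exE conjE)
  have tV: "\<And>i. i < m \<Longrightarrow> accessible (V i)" and n\<tau>: "\<And>i. i < m \<Longrightarrow> norm (\<tau> i) = 1"
    and V\<tau>: "\<And>i j. i < m \<Longrightarrow> j < m \<Longrightarrow> V j (\<omega> (i div 2)) \<bullet> \<tau> i = (if j = i then 1 else 0)"
      "\<And>i j. i < m \<Longrightarrow> j < m \<Longrightarrow> norm (V j (\<omega> (i div 2))) \<le> 1"
    and frame: "\<And>k v. k < N \<Longrightarrow> v \<bullet> \<tau> (2 * k) = 0 \<Longrightarrow> v \<bullet> \<tau> (2 * k + 1) = 0 \<Longrightarrow> v = (v \<bullet> \<omega> k) *\<^sub>R \<omega> k"
    using I unfolding m_def by blast+
  \<comment> \<open>Each coordinate of the rescaled map is to differ from the identity by at most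
    \<open>1 / (2 * real m)\<close>: one quarter of it for the family, one for the variation of the
    fields and two for the distance from start to target. The squares then sum to less than
    1.\<close>
  define \<eta> where "\<eta> = 1 / (8 * (real m)\<^sup>2)"
  have \<eta>: "\<eta> > 0" "\<eta> \<le> 1" "real m * \<eta> \<le> 1 / (8 * real m)" "\<eta> \<le> 1 / (8 * real m)"
  proof -
    show "\<eta> > 0" using m by (simp add: \<eta>_def)
    show e: "real m * \<eta> \<le> 1 / (8 * real m)" using m by (simp add: \<eta>_def power2_eq_square)
    have "1 * \<eta> \<le> real m * \<eta>" using m \<open>\<eta> > 0\<close> by (intro mult_right_mono) auto
    then show "\<eta> \<le> 1 / (8 * real m)" using e by linarith
    also have "\<dots> \<le> 1" using m by (simp add: divide_le_eq)
    finally show "\<eta> \<le> 1" .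
  qed
  obtain \<Psi> \<rho>0 where \<Psi>: "\<rho>0 > 0" "\<And>s. \<Psi> s \<in> M" "\<And>x. x \<in> S2 \<Longrightarrow> continuous_on UNIV (\<lambda>s. \<Psi> s x)"
    "\<And>\<rho> s x. 0 < \<rho> \<Longrightarrow> \<rho> \<le> \<rho>0 \<Longrightarrow> (\<forall>i<m. \<bar>s i\<bar> \<le> \<rho>) \<Longrightarrow> x \<in> S2 \<Longrightarrow>
       norm (\<Psi> s x - x - (\<Sum>i<m. s i *\<^sub>R V i x)) \<le> \<eta> * \<rho>"
    using accessible_multi_family[of m V, OF tV \<eta>(1)] by blast
  have "continuous_on S2 (V i)" if "i < m" for i using tV[OF that] by (simp add: accessible_def)
  then obtain d where d: "d > 0" "\<And>i x y. i < m \<Longrightarrow> x \<in> S2 \<Longrightarrow> y \<in> S2 \<Longrightarrow> norm (x - y) < d \<Longrightarrow> norm (V i x - V i y) \<le> \<eta>"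
    using finite_uniform_modulus[of m V \<eta>] \<eta>(1) by blast
  \<comment> \<open>The bound \<open>1 / (12 * real m)\<close> keeps the displacement at most
    \<open>1/6 + 1/12\<close>, so endpoints stay in the hemisphere around
    \<open>\<omega> k\<close>.\<close>
  define \<rho> where "\<rho> = min \<rho>0 (1 / (12 * real m))"
  have \<rho>: "\<rho> > 0" "\<rho> \<le> \<rho>0" "\<rho> * real m \<le> 1 / 12" using \<Psi>(1) m by (auto simp: \<rho>_def min_def field_simps)
  define \<delta> where "\<delta> = min (min d (1/4)) (\<rho> / (8 * real m))"
  have \<delta>: "\<delta> > 0" "\<delta> \<le> d" "\<delta> \<le> 1/4" "\<delta> \<le> \<rho> / (8 * real m)" using d(1) \<rho> m by (auto simp: \<delta>_def)
  have "\<exists>g\<in>M. \<forall>k<N. g (y k) = z k"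
    if yz: "\<And>k. k < N \<Longrightarrow> y k \<in> S2 \<and> z k \<in> S2 \<and> norm (y k - \<omega> k) < \<delta> \<and> norm (z k - \<omega> k) < \<delta>" for y z
  proof -
    define f where "f \<sigma> i = ((\<Psi> (\<lambda>j. \<rho> * \<sigma> j) (y (i div 2)) - z (i div 2)) \<bullet> \<tau> i) / \<rho>" for \<sigma> :: "nat \<Rightarrow> real" and i
    let ?D = "{s. (\<Sum>i\<le>m - 1. (s i)\<^sup>2) \<le> 1 \<and> (\<forall>i>m - 1. s i = (0::real))}"
    have le_m: "i \<le> m - 1 \<longleftrightarrow> i < m" for i using m by auto
    have set_m: "{..m - 1} = {..<m}" using m by auto
    have D1: "\<bar>\<sigma> j\<bar> \<le> 1" if "\<sigma> \<in> ?D" "j < m" for \<sigma> j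
    proof -
      have "(\<sigma> j)\<^sup>2 \<le> (\<Sum>i\<le>m - 1. (\<sigma> i)\<^sup>2)" using that by (intro member_le_sum) (auto simp: le_m)
      then have "(\<sigma> j)\<^sup>2 \<le> 1" using that by simp
      then show ?thesis by (simp add: abs_square_le_1)
    qed
    have small: "\<forall>j<m. \<bar>\<rho> * \<sigma> j\<bar> \<le> \<rho>" if "\<sigma> \<in> ?D" for \<sigma>
      using D1[OF that] \<rho>(1) by (simp add: abs_mult mult_left_le)
    have cont: "continuous_on ?D (\<lambda>\<sigma>. f \<sigma> i)" if "i \<le> m - 1" for i
    proof -
      have "i div 2 < N" using that le_m by (simp add: m_def)
      then have yS: "y (i div 2) \<in> S2" using yz by blast
      have "continuous_on ?D (\<lambda>\<sigma> j. \<rho> * \<sigma> j)"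
        by (intro continuous_on_coordinatewise_then_product continuous_on_mult_left
            continuous_on_product_then_coordinatewise[OF continuous_on_id])
      then have "continuous_on ?D (\<lambda>\<sigma>. \<Psi> (\<lambda>j. \<rho> * \<sigma> j) (y (i div 2)))"
        by (rule continuous_on_compose2[OF \<Psi>(3)[OF yS]]) simp
      then show ?thesis unfolding f_def using \<rho>(1) by (intro continuous_intros) auto
    qed
    have close: "(\<Sum>i\<le>m - 1. (f \<sigma> i - \<sigma> i)\<^sup>2) < 1" if \<sigma>: "\<sigma> \<in> ?D" for \<sigma>
    proof -
      have "\<bar>f \<sigma> i - \<sigma> i\<bar> \<le> 1 / (2 * real m)" if i: "i < m" for i
      proof -
        define k where "k = i div 2"
        have k: "k < N" using i by (simp add: k_def m_def)
        let ?s = "\<lambda>j. \<rho> * \<sigma> j" and ?y = "y k"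
        have y: "?y \<in> S2" "norm (?y - \<omega> k) < d" "norm (?y - z k) \<le> 2 * \<delta>"
          using yz[OF k] \<delta> norm_triangle_ineq4[of "?y - \<omega> k" "z k - \<omega> k"] by auto
        define e1 where "e1 = \<Psi> ?s ?y - ?y - (\<Sum>j<m. ?s j *\<^sub>R V j ?y)"
        have e1: "\<bar>e1 \<bullet> \<tau> i\<bar> \<le> \<eta> * \<rho>"
          using \<Psi>(4)[OF \<rho>(1,2) small[OF \<sigma>] y(1)] Cauchy_Schwarz_ineq2[of e1 "\<tau> i"] n\<tau>[OF i] by (simp add: e1_def)
        have e2: "\<bar>(?y - z k) \<bullet> \<tau> i\<bar> \<le> 2 * \<delta>"
          using Cauchy_Schwarz_ineq2[of "?y - z k" "\<tau> i"] n\<tau>[OF i] y(3) by simp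
        define e3 where "e3 j = (V j ?y - V j (\<omega> k)) \<bullet> \<tau> i" for j
        have e3: "\<bar>e3 j\<bar> \<le> \<eta>" if "j < m" for j
          using Cauchy_Schwarz_ineq2[of "V j ?y - V j (\<omega> k)" "\<tau> i"] n\<tau>[OF i] d(2)[OF that y(1) \<omega>[OF k] y(2)]
          by (simp add: e3_def)
        have Vj: "V j ?y \<bullet> \<tau> i = (if j = i then 1 else 0) + e3 j" if "j < m" for j
          using V\<tau>(1)[OF i that] by (simp add: e3_def inner_diff_left k_def)
        have "(\<Sum>j<m. ?s j *\<^sub>R V j ?y) \<bullet> \<tau> i = (\<Sum>j<m. ?s j * ((if j = i then 1 else 0) + e3 j))"
          unfolding inner_sum_left by (intro sum.cong) (auto simp: Vj)
        also have "\<dots> = (\<Sum>j<m. if j = i then ?s j else 0) + (\<Sum>j<m. ?s j * e3 j)"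
          unfolding sum.distrib[symmetric] by (intro sum.cong) (auto simp: algebra_simps)
        also have "\<dots> = \<rho> * \<sigma> i + (\<Sum>j<m. ?s j * e3 j)" using i by simp
        finally have S: "(\<Sum>j<m. ?s j *\<^sub>R V j ?y) \<bullet> \<tau> i = \<rho> * \<sigma> i + (\<Sum>j<m. ?s j * e3 j)" .
        have "\<Psi> ?s ?y - z k = e1 + (?y - z k) + (\<Sum>j<m. ?s j *\<^sub>R V j ?y)" by (simp add: e1_def)
        then have "(\<Psi> ?s ?y - z k) \<bullet> \<tau> i = e1 \<bullet> \<tau> i + (?y - z k) \<bullet> \<tau> i + (\<rho> * \<sigma> i + (\<Sum>j<m. ?s j * e3 j))"
          by (simp only: inner_add_left S)
        moreover have "f \<sigma> i = ((\<Psi> ?s ?y - z k) \<bullet> \<tau> i) / \<rho>" by (simp add: f_def k_def)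
        ultimately have "f \<sigma> i = (e1 \<bullet> \<tau> i + (?y - z k) \<bullet> \<tau> i + (\<rho> * \<sigma> i + (\<Sum>j<m. ?s j * e3 j))) / \<rho>"
          by simp
        also have "\<dots> = (e1 \<bullet> \<tau> i + (?y - z k) \<bullet> \<tau> i + (\<Sum>j<m. ?s j * e3 j)) / \<rho> + \<sigma> i"
          using \<rho>(1) by (simp add: add_divide_distrib)
        finally have "f \<sigma> i - \<sigma> i = (e1 \<bullet> \<tau> i + (?y - z k) \<bullet> \<tau> i + (\<Sum>j<m. ?s j * e3 j)) / \<rho>" by simp
        moreover have "\<bar>e1 \<bullet> \<tau> i + (?y - z k) \<bullet> \<tau> i + (\<Sum>j<m. ?s j * e3 j)\<bar> \<le> (1 / (2 * real m)) * \<rho>"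
        proof -
          have "\<bar>\<Sum>j<m. ?s j * e3 j\<bar> \<le> (\<Sum>j<m. \<rho> * \<eta>)"
          proof (intro order_trans[OF sum_abs] sum_mono)
            fix j assume "j \<in> {..<m}"
            then show "\<bar>?s j * e3 j\<bar> \<le> \<rho> * \<eta>"
              using small[OF \<sigma>] e3[of j] \<rho>(1) unfolding abs_mult[of "?s j" "e3 j"] by (intro mult_mono) auto
          qed
          also have "\<dots> = (real m * \<eta>) * \<rho>" by simp
          also have "\<dots> \<le> (1 / (8 * real m)) * \<rho>" using \<eta>(3) \<rho>(1) by (intro mult_right_mono) auto
          finally have 3: "\<bar>\<Sum>j<m. ?s j * e3 j\<bar> \<le> (1 / (8 * real m)) * \<rho>" .
          have 1: "\<bar>e1 \<bullet> \<tau> i\<bar> \<le> (1 / (8 * real m)) * \<rho>"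
            using e1 mult_right_mono[OF \<eta>(4), of \<rho>] \<rho>(1) by linarith
          have 2: "\<bar>(?y - z k) \<bullet> \<tau> i\<bar> \<le> 2 * ((1 / (8 * real m)) * \<rho>)" using e2 \<delta>(4) by simp
          have "(1 / (2 * real m)) * \<rho> = 4 * ((1 / (8 * real m)) * \<rho>)" by simp
          then show ?thesis using 1 2 3 by linarith
        qed
        ultimately show ?thesis using \<rho>(1) by (simp add: pos_divide_le_eq)
      qed
      then have "(\<Sum>i\<le>m - 1. (f \<sigma> i - \<sigma> i)\<^sup>2) \<le> (\<Sum>i\<le>m - 1. (1 / (2 * real m))\<^sup>2)"
        unfolding set_m by (intro sum_mono abs_le_square_iff[THEN iffD1]) auto
      also have "\<dots> = real m * (1 / (2 * real m))\<^sup>2" unfolding set_m by simp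
      also have "\<dots> < 1" using m by (simp add: power2_eq_square field_simps)
      finally show ?thesis .
    qed
    obtain \<sigma> where \<sigma>: "\<sigma> \<in> ?D" "\<forall>i\<le>m - 1. f \<sigma> i = 0"
      using near_identity_has_zero[of "m - 1" f, OF cont close] by blast
    let ?s = "\<lambda>j. \<rho> * \<sigma> j"
    have "\<Psi> ?s (y k) = z k" if k: "k < N" for k
    proof -
      let ?x = "\<Psi> ?s (y k)"
      have i: "2 * k < m" "2 * k + 1 < m" using k by (auto simp: m_def)
      have "(?x - z k) \<bullet> \<tau> (2 * k) = 0" "(?x - z k) \<bullet> \<tau> (2 * k + 1) = 0"
        using \<sigma>(2)[rule_format, of "2 * k"] \<sigma>(2)[rule_format, of "2 * k + 1"] i \<rho>(1) by (simp_all add: f_def le_m)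
      \<comment> \<open>The residual is purely radial, so \<open>sphere_point_determined\<close>
        applies once both points are in the hemisphere.\<close>
      then have c: "?x - z k = ((?x - z k) \<bullet> \<omega> k) *\<^sub>R \<omega> k" by (rule frame[OF k])
      have xS: "?x \<in> S2" using maps_S2[OF \<Psi>(2)] yz[OF k] by blast
      have pos: "p \<bullet> \<omega> k > 0" if "p \<in> S2" "norm (p - \<omega> k) < 1" for p
      proof -
        have "(norm (p - \<omega> k))\<^sup>2 = 2 - 2 * (p \<bullet> \<omega> k)"
        proof -
          have "p \<bullet> p = 1" "\<omega> k \<bullet> \<omega> k = 1" using that(1) \<omega>[OF k] by (simp_all add: dot_square_norm)
          then show ?thesis
            by (simp add: power2_norm_eq_inner inner_diff_left inner_diff_right inner_commute[of "\<omega> k" p])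
        qed
        moreover have "(norm (p - \<omega> k))\<^sup>2 < 1" using that(2) by (simp add: power_less_one_iff)
        ultimately show ?thesis by simp
      qed
      have "norm (\<Sum>j<m. ?s j *\<^sub>R V j (y k)) \<le> (\<Sum>j<m. \<rho> * 2)"
      proof (intro sum_norm_le)
        fix j assume j: "j \<in> {..<m}"
        have "norm (V j (y k)) \<le> norm (V j (y k) - V j (\<omega> k)) + norm (V j (\<omega> k))"
          using norm_triangle_ineq[of "V j (y k) - V j (\<omega> k)" "V j (\<omega> k)"] by simp
        also have "\<dots> \<le> 1 + 1"
        proof (rule add_mono)
          show "norm (V j (y k) - V j (\<omega> k)) \<le> 1"
            using d(2)[of j "y k" "\<omega> k"] j yz[OF k] \<omega>[OF k] \<delta>(2) \<eta>(2) by force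
          show "norm (V j (\<omega> k)) \<le> 1" using V\<tau>(2)[OF i(1), of j] j by simp
        qed
        finally show "norm (?s j *\<^sub>R V j (y k)) \<le> \<rho> * 2"
          using small[OF \<sigma>(1)] j \<rho>(1) unfolding norm_scaleR by (intro mult_mono) auto
      qed
      also have "\<dots> = 2 * (\<rho> * real m)" by simp
      also have "\<dots> \<le> 1/6" using \<rho>(3) by simp
      finally have "norm (?x - y k) \<le> \<eta> * \<rho> + 1/6"
        using \<Psi>(4)[OF \<rho>(1,2) small[OF \<sigma>(1)], of "y k"] yz[OF k]
          norm_triangle_ineq[of "?x - y k - (\<Sum>j<m. ?s j *\<^sub>R V j (y k))" "\<Sum>j<m. ?s j *\<^sub>R V j (y k)"] by simp
      moreover have "\<eta> * \<rho> \<le> 1/12"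
      proof -
        have "\<rho> * 1 \<le> \<rho> * real m" using m \<rho>(1) by (intro mult_left_mono) auto
        moreover have "\<eta> * \<rho> \<le> 1 * \<rho>" using \<eta> \<rho>(1) by (intro mult_right_mono) auto
        ultimately show ?thesis using \<rho>(3) by linarith
      qed
      moreover have "norm (y k - \<omega> k) < 1/4" "norm (z k - \<omega> k) < 1/4" using yz[OF k] \<delta>(3) by auto
      moreover have "norm (?x - \<omega> k) \<le> norm (?x - y k) + norm (y k - \<omega> k)"
        using norm_triangle_ineq[of "?x - y k" "y k - \<omega> k"] by simp
      ultimately have "norm (?x - \<omega> k) < 1" "norm (z k - \<omega> k) < 1" by linarith+
      then show ?thesis
        using sphere_point_determined[OF \<omega>[OF k] xS _ c] pos xS yz[OF k] by blast
    qed
    then show ?thesis using \<Psi>(2) by blast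
  qed
  then show ?thesis using \<delta>(1) by blast
qed

section \<open>From local to global steering of ensembles\<close>

definition steerable :: "nat \<Rightarrow> (nat \<Rightarrow> real ^ 3) \<Rightarrow> (nat \<Rightarrow> real ^ 3) \<Rightarrow> bool" where
  "steerable N x y \<longleftrightarrow> (\<exists>g\<in>M. \<forall>k<N. g (x k) = y k)"

lemma steerable_refl: "steerable N x x"
  unfolding steerable_def using id_mem by (intro bexI[of _ id]) auto

lemma steerable_trans:
  assumes "steerable N x y" "steerable N y z"
  shows "steerable N x z"
proof -
  obtain g h where "g \<in> M" "h \<in> M" "\<forall>k<N. g (x k) = y k" "\<forall>k<N. h (y k) = z k"
    using assms unfolding steerable_def by blast
  then show ?thesis unfolding steerable_def by (intro bexI[of _ "h \<circ> g"] comp_mem) auto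
qed

text \<open>Local steering works in both directions near any configuration, so steerability is
  locally constant in the moving point, whose domain, the sphere without the other points, is
  connected. No inverses in \<open>M\<close> are involved.\<close>

lemma steerable_one_point:
  assumes N: "N \<ge> 1" and x: "x ` {..<N} \<subseteq> S2" "inj_on x {..<N}" and i: "i < N"
    and p: "p \<in> S2" "p \<notin> x ` ({..<N} - {i})"
  shows "steerable N x (x(i := p))"
proof -
  define A where "A = S2 - x ` ({..<N} - {i})"
  have "connected A" unfolding A_def by (intro connected_sphere_diff_finite) simp
  moreover have "x i \<in> A" using x i by (auto simp: A_def inj_on_def)
  moreover have "p \<in> A" using p by (simp add: A_def)
  moreover have "\<forall>a\<in>A. eventually (\<lambda>b. steerable N x (x(i := a)) = steerable N x (x(i := b))) (at a within A)"
  proof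
    fix a assume a: "a \<in> A"
    have sub: "(x(i := a)) ` {..<N} \<subseteq> S2" using x(1) a by (auto simp: A_def)
    have inj: "inj_on (x(i := a)) {..<N}" using x(2) a by (auto simp: A_def inj_on_def)
    obtain \<delta> where \<delta>: "\<delta> > 0" "\<And>y z. (\<forall>k<N. y k \<in> S2 \<and> z k \<in> S2 \<and> norm (y k - (x(i := a)) k) < \<delta> \<and> norm (z k - (x(i := a)) k) < \<delta>) \<Longrightarrow>
      (\<exists>g\<in>M. \<forall>k<N. g (y k) = z k)"
      using local_exact_steering[OF N sub inj] by blast
    have "steerable N x (x(i := a)) = steerable N x (x(i := b))" if b: "b \<in> A" "dist b a < \<delta>" for b
    proof -
      have S: "\<forall>k<N. (x(i := a)) k \<in> S2 \<and> (x(i := b)) k \<in> S2" using x(1) a b by (auto simp: A_def)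
      have "steerable N (x(i := a)) (x(i := b))" "steerable N (x(i := b)) (x(i := a))"
        unfolding steerable_def using S b \<delta>(1) by (intro \<delta>(2); simp add: dist_norm)+
      then show ?thesis using steerable_trans by blast
    qed
    then show "eventually (\<lambda>b. steerable N x (x(i := a)) = steerable N x (x(i := b))) (at a within A)"
      unfolding eventually_at using \<delta>(1) by blast
  qed
  ultimately have "steerable N x (x(i := x i)) = steerable N x (x(i := p))"
    by (rule connected_local_const)
  then show ?thesis using steerable_refl by simp
qed

text \<open>The points are moved one after another; disjointness prevents a target from being
  occupied by a point that has not moved yet.\<close>

lemma steerable_disjoint:
  assumes N: "N \<ge> 1" and x: "x ` {..<N} \<subseteq> S2" "inj_on x {..<N}"
    and y: "y ` {..<N} \<subseteq> S2" "inj_on y {..<N}" and disj: "x ` {..<N} \<inter> y ` {..<N} = {}"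
  shows "steerable N x y"
proof -
  define c where "c n k = (if k < n then y k else x k)" for n k :: nat
  have "steerable N x (c n)" if "n \<le> N" for n
    using that
  proof (induction n)
    case 0
    show ?case using steerable_refl by (simp add: c_def)
  next
    case (Suc n)
    have "c n ` {..<N} \<subseteq> S2" using x(1) y(1) Suc.prems by (auto simp: c_def)
    moreover have "inj_on (c n) {..<N}"
      unfolding inj_on_def
    proof (intro ballI impI)
      fix j k assume jk: "j \<in> {..<N}" "k \<in> {..<N}" "c n j = c n k"
      have "x j \<noteq> y k" "y j \<noteq> x k" using disj jk by blast+
      then show "j = k" using jk x(2) y(2) by (auto simp: c_def inj_on_def split: if_splits)
    qed
    moreover have "y n \<in> S2" using y(1) Suc_le_lessD[OF Suc.prems] by blast
    moreover have "y n \<notin> c n ` ({..<N} - {n})"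
    proof
      assume "y n \<in> c n ` ({..<N} - {n})"
      then obtain k where k: "k < N" "k \<noteq> n" "y n = c n k" by auto
      have "x k \<in> x ` {..<N}" "y n \<in> y ` {..<N}" using k(1) Suc.prems by auto
      then have "y n \<noteq> x k" using disj by force
      then show False using k y(2) Suc.prems by (auto simp: c_def inj_on_def split: if_splits)
    qed
    ultimately have "steerable N (c n) ((c n)(n := y n))"
      using Suc.prems by (intro steerable_one_point[OF N]) auto
    moreover have "(c n)(n := y n) = c (Suc n)" by (auto simp: c_def fun_eq_iff)
    ultimately show ?case using steerable_trans[OF Suc.IH] Suc.prems by simp
  qed
  from this[of N] obtain g where "g \<in> M" "\<forall>k<N. g (x k) = c N k" by (auto simp: steerable_def)
  then show ?thesis unfolding steerable_def by (intro bexI[of _ g]) (auto simp: c_def)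
qed

text \<open>When the two ensembles overlap, a target may be occupied. The detour through a third
  ensemble avoiding both reduces to the disjoint case.\<close>

theorem steerable_distinct:
  assumes N: "N \<ge> 1" and x: "x ` {..<N} \<subseteq> S2" "inj_on x {..<N}"
    and y: "y ` {..<N} \<subseteq> S2" "inj_on y {..<N}"
  shows "steerable N x y"
proof -
  have "axis 1 1 \<in> S2" "axis 2 1 \<in> S2" "axis 1 (1 :: real) \<noteq> (axis 2 1 :: real ^ 3)"
    by (auto simp: axis_eq_axis)
  then have "infinite S2" using connected_finite_iff_sing[of "S2"] connected_sphere[of "0 :: real ^ 3" 1]
    by fastforce
  then have "infinite (S2 - (x ` {..<N} \<union> y ` {..<N}))" by (intro Diff_infinite_finite) auto
  then obtain z :: "nat \<Rightarrow> real ^ 3" where z: "inj z" "range z \<subseteq> S2 - (x ` {..<N} \<union> y ` {..<N})"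
    using infinite_countable_subset by blast
  have "z ` {..<N} \<subseteq> S2" using z(2) by blast
  moreover have "inj_on z {..<N}" using z(1) by (rule inj_on_subset) simp
  moreover have "x ` {..<N} \<inter> z ` {..<N} = {}" "z ` {..<N} \<inter> y ` {..<N} = {}" using z(2) by blast+
  ultimately show ?thesis using x y by (intro steerable_trans[of N x z y] steerable_disjoint[OF N]) auto
qed

end

lemma finite_ensemble_controllable_rich:
  assumes "rich_sphere_monoid {g. reaches F g} A e k"
  shows "finite_ensemble_controllable F"
  unfolding finite_ensemble_controllable_def
proof (intro allI impI)
  interpret rich_sphere_monoid "{g. reaches F g}" A e k by fact
  fix N :: nat and T :: real and x y :: "nat \<Rightarrow> real ^ 3"
  assume a: "N \<ge> 1" "T > 0" "x ` {1..N} \<subseteq> S2" "inj_on x {1..N}" "y ` {1..N} \<subseteq> S2" "inj_on y {1..N}"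
  have im: "{1..N} = Suc ` {..<N}" by (simp add: image_Suc_lessThan)
  have "(x \<circ> Suc) ` {..<N} \<subseteq> S2" "inj_on (x \<circ> Suc) {..<N}" "(y \<circ> Suc) ` {..<N} \<subseteq> S2" "inj_on (y \<circ> Suc) {..<N}"
    using a unfolding im by (auto simp: inj_on_def)
  then have "steerable N (x \<circ> Suc) (y \<circ> Suc)" by (intro steerable_distinct a)
  then obtain g where g: "reaches F g" "\<And>k. k < N \<Longrightarrow> g (x (Suc k)) = y (Suc k)"
    by (auto simp: steerable_def)
  obtain u P where P: "u absolutely_integrable_on {0..T}"
    "\<And>x. x \<in> S2 \<Longrightarrow> P 0 x = x \<and> trajectory F T u (\<lambda>t. P t x) \<and> P T x = g x"
    using g(1)[unfolded reaches_def, rule_format, OF a(2)] by blast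
  have "\<exists>\<gamma>. trajectory F T u \<gamma> \<and> \<gamma> 0 = x k \<and> \<gamma> T = y k" if k: "k \<in> {1..N}" for k
  proof -
    have "x k \<in> S2" using a(3) k by blast
    moreover have "g (x k) = y k" using g(2)[of "k - 1"] k by auto
    ultimately show ?thesis using P(2)[of "x k"] by (intro exI[of _ "\<lambda>t. P t (x k)"]) simp
  qed
  then show "\<exists>u. u absolutely_integrable_on {0..T} \<and>
     (\<forall>k\<in>{1..N}. \<exists>\<gamma>. trajectory F T u \<gamma> \<and> \<gamma> 0 = x k \<and> \<gamma> T = y k)" using P(1) by blast
qed

section \<open>Diffeomorphisms\<close>

text \<open>A contraction in the whole space: \<open>z\<close> solves \<open>z + k' z = y\<close>
  for the homogeneous extension \<open>k'\<close> of \<open>k\<close>, with constant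
  \<open>1/4 + 2 * (1/8) = 1/2\<close>. Homogeneity and the assumption that the sphere is preserved
  force \<open>norm z = 1\<close>.\<close>

lemma sphere_perturbation_surjective:
  fixes k :: "'a::euclidean_space \<Rightarrow> 'a"
  assumes L: "\<And>x y. x \<in> sphere 0 1 \<Longrightarrow> y \<in> sphere 0 1 \<Longrightarrow> norm (k x - k y) \<le> (1/8) * norm (x - y)"
    and M: "\<And>x. x \<in> sphere 0 1 \<Longrightarrow> norm (k x) \<le> 1/4"
    and S: "\<And>x. x \<in> sphere 0 1 \<Longrightarrow> x + k x \<in> sphere 0 1" and y: "y \<in> sphere 0 1"
  shows "\<exists>x\<in>sphere 0 1. x + k x = y"
proof -
  have "dist (y - homogeneous_extension k z) (y - homogeneous_extension k w) \<le> (1/2) * dist z w" for z w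
    using homogeneous_extension_lipschitz[OF L M, of w z] by (simp add: dist_norm norm_minus_commute)
  then obtain z where z: "y - homogeneous_extension k z = z"
    using banach_fix_type[of "1/2" "\<lambda>z. y - homogeneous_extension k z"] by auto
  have z0: "z \<noteq> 0" using z y by (auto simp: homogeneous_extension_def)
  then have s: "sgn z \<in> sphere 0 1" by (simp add: norm_sgn)
  have "y = z + homogeneous_extension k z" using z by (metis diff_add_cancel)
  also have "\<dots> = norm z *\<^sub>R (sgn z + k (sgn z))"
    using z0 by (simp add: homogeneous_extension_def scaleR_add_right sgn_div_norm)
  finally have eq: "y = norm z *\<^sub>R (sgn z + k (sgn z))" .
  then have "norm y = norm z * norm (sgn z + k (sgn z))" by (metis norm_scaleR abs_norm_cancel)
  then have "norm z = 1" using y S[OF s] by simp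
  then show ?thesis using eq s by (intro bexI[of _ "sgn z"]) simp_all
qed

text \<open>
  \<open>p t\<close> joins the identity to \<open>R\<close> and \<open>Y t\<close> is its velocity.
\<close>

locale sphere_near_identity =
  fixes R :: "real ^ 3 \<Rightarrow> real ^ 3"
  assumes R_S2: "x \<in> S2 \<Longrightarrow> R x \<in> S2"
    and small_displacement: "x \<in> S2 \<Longrightarrow> norm (R x - x) \<le> 1/64"
    and lipschitz_displacement: "x \<in> S2 \<Longrightarrow> y \<in> S2 \<Longrightarrow> norm ((R x - x) - (R y - y)) \<le> (1/64) * norm (x - y)"
begin

definition g :: "real ^ 3 \<Rightarrow> real ^ 3" where "g x = R x - x"

lemma small: "x \<in> S2 \<Longrightarrow> norm (g x) \<le> 1/64"
  unfolding g_def by (rule small_displacement)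

lemma lipschitz: "x \<in> S2 \<Longrightarrow> y \<in> S2 \<Longrightarrow> norm (g x - g y) \<le> (1/64) * norm (x - y)"
  unfolding g_def by (rule lipschitz_displacement)

definition v :: "real \<Rightarrow> real ^ 3 \<Rightarrow> real ^ 3" where "v t x = x + t *\<^sub>R g x"
definition p :: "real \<Rightarrow> real ^ 3 \<Rightarrow> real ^ 3" where "p t x = sgn (v t x)"
definition Y :: "real \<Rightarrow> real ^ 3 \<Rightarrow> real ^ 3" where
  "Y t x = (1 / norm (v t x)) *\<^sub>R (g x - ((v t x \<bullet> g x) / (norm (v t x))\<^sup>2) *\<^sub>R v t x)"

lemma v_bounds:
  assumes "t \<in> {0..1}" "x \<in> S2"
  shows "norm (v t x - x) \<le> 1/64" "norm (v t x) \<ge> 63/64" "norm (v t x) \<le> 65/64" "v t x \<noteq> 0"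
proof -
  have "\<bar>t\<bar> * norm (g x) \<le> 1 * (1/64)" using assms small[of x] by (intro mult_mono) auto
  then show 1: "norm (v t x - x) \<le> 1/64" by (simp add: v_def)
  have x: "norm x = 1" using assms by simp
  show "norm (v t x) \<ge> 63/64" using norm_triangle_ineq3[of "v t x" x] 1 x by linarith
  then show "v t x \<noteq> 0" by auto
  show "norm (v t x) \<le> 65/64" using norm_triangle_ineq3[of "v t x" x] 1 x by linarith
qed

lemma v_lipschitz:
  assumes "t \<in> {0..1}" "x \<in> S2" "y \<in> S2"
  shows "norm (v t x - v t y) \<le> (65/64) * norm (x - y)"
proof -
  have "v t x - v t y = (x - y) + t *\<^sub>R (g x - g y)" by (simp add: v_def algebra_simps)
  also have "norm \<dots> \<le> norm (x - y) + 1 * ((1/64) * norm (x - y))"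
  proof (intro norm_triangle_mono order_refl)
    show "norm (t *\<^sub>R (g x - g y)) \<le> 1 * ((1/64) * norm (x - y))"
      unfolding norm_scaleR using assms lipschitz[of x y] by (intro mult_mono) auto
  qed
  finally show ?thesis by simp
qed

text \<open>The Lipschitz constant of \<open>v t\<close> alone would only give about 1. Since
  \<open>norm x\<close> is constant on the sphere, the squared norm varies only through terms
  containing \<open>g\<close>, which are small.\<close>

lemma norm_v_lipschitz:
  assumes t: "t \<in> {0..1}" and xy: "x \<in> S2" "y \<in> S2"
  shows "\<bar>norm (v t x) - norm (v t y)\<bar> \<le> (3/64) * norm (x - y)"
proof -
  have sq: "(norm (v t x))\<^sup>2 = 1 + 2 * t * (x \<bullet> g x) + t\<^sup>2 * (g x \<bullet> g x)" if "x \<in> S2" for x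
  proof -
    have "x \<bullet> x = 1" using that by (simp add: dot_square_norm)
    then show ?thesis
      unfolding power2_norm_eq_inner
      by (simp add: v_def inner_add_left inner_add_right inner_commute[of "g x" x]
          power2_eq_square algebra_simps)
  qed
  let ?n = "norm (x - y)"
  have 1: "\<bar>x \<bullet> g x - y \<bullet> g y\<bar> \<le> (1/32) * ?n"
  proof -
    have "x \<bullet> g x - y \<bullet> g y = (x - y) \<bullet> g x + y \<bullet> (g x - g y)" by (simp add: inner_diff_left inner_diff_right)
    moreover have "\<bar>(x - y) \<bullet> g x\<bar> \<le> ?n * (1/64)"
      using small[OF xy(1)] by (intro order_trans[OF Cauchy_Schwarz_ineq2] mult_left_mono) auto
    moreover have "\<bar>y \<bullet> (g x - g y)\<bar> \<le> 1 * ((1/64) * ?n)"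
      using lipschitz[OF xy] xy by (intro order_trans[OF Cauchy_Schwarz_ineq2] mult_mono) auto
    ultimately show ?thesis by linarith
  qed
  have 2: "\<bar>g x \<bullet> g x - g y \<bullet> g y\<bar> \<le> (1/64) * ?n"
  proof -
    have "g x \<bullet> g x - g y \<bullet> g y = (g x - g y) \<bullet> (g x + g y)" by (simp add: inner_diff_left inner_add_right inner_commute[of "g y" "g x"])
    also have "\<bar>\<dots>\<bar> \<le> ((1/64) * ?n) * 1"
      using lipschitz[OF xy] norm_triangle_ineq[of "g x" "g y"] small[OF xy(1)] small[OF xy(2)]
      by (intro order_trans[OF Cauchy_Schwarz_ineq2] mult_mono) auto
    finally show ?thesis by simp
  qed
  have "\<bar>(norm (v t x))\<^sup>2 - (norm (v t y))\<^sup>2\<bar> \<le> 2 * ((1/32) * ?n) + (1/64) * ?n"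
  proof -
    have "(norm (v t x))\<^sup>2 - (norm (v t y))\<^sup>2 = 2 * t * (x \<bullet> g x - y \<bullet> g y) + t\<^sup>2 * (g x \<bullet> g x - g y \<bullet> g y)"
      unfolding sq[OF xy(1)] sq[OF xy(2)] by (simp add: algebra_simps)
    moreover have "\<bar>2 * t * (x \<bullet> g x - y \<bullet> g y)\<bar> \<le> 2 * ((1/32) * ?n)"
      using t 1 unfolding abs_mult by (intro mult_mono) auto
    moreover have "\<bar>t\<^sup>2 * (g x \<bullet> g x - g y \<bullet> g y)\<bar> \<le> 1 * ((1/64) * ?n)"
      using t 2 unfolding abs_mult by (intro mult_mono) (auto simp: power_le_one)
    ultimately show ?thesis by linarith
  qed
  moreover have "(norm (v t x))\<^sup>2 - (norm (v t y))\<^sup>2 = (norm (v t x) - norm (v t y)) * (norm (v t x) + norm (v t y))"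
    by (simp add: power2_eq_square algebra_simps)
  ultimately have "\<bar>norm (v t x) - norm (v t y)\<bar> * \<bar>norm (v t x) + norm (v t y)\<bar> \<le> (5/64) * ?n"
    by (simp add: abs_mult)
  moreover have "\<bar>norm (v t x) - norm (v t y)\<bar> * (126/64) \<le> \<bar>norm (v t x) - norm (v t y)\<bar> * \<bar>norm (v t x) + norm (v t y)\<bar>"
    using v_bounds(2)[OF t xy(1)] v_bounds(2)[OF t xy(2)] by (intro mult_left_mono) auto
  ultimately have "\<bar>norm (v t x) - norm (v t y)\<bar> * (126/64) \<le> (5/64) * ?n" by linarith
  then have "\<bar>norm (v t x) - norm (v t y)\<bar> \<le> ((5/64) * ?n) / (126/64)" by (simp add: pos_le_divide_eq)
  also have "\<dots> \<le> (3/64) * ?n" using norm_ge_zero[of "x - y"] by simp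
  finally show ?thesis .
qed

lemma p_S2: "t \<in> {0..1} \<Longrightarrow> x \<in> S2 \<Longrightarrow> p t x \<in> S2"
  using v_bounds(4) by (simp add: p_def norm_sgn)

lemma p_near_identity:
  assumes "t \<in> {0..1}" "x \<in> S2"
  shows "norm (p t x - x) \<le> 1/4"
proof -
  note b = v_bounds[OF assms]
  have "p t x - x = (1 - norm (v t x)) *\<^sub>R p t x + (v t x - x)"
    using b(4) by (simp add: p_def sgn_div_norm algebra_simps)
  also have "norm \<dots> \<le> (1/64) * 1 + 1/64"
  proof (intro norm_triangle_mono b(1))
    have "\<bar>1 - norm (v t x)\<bar> \<le> 1/64" using b(2,3) by linarith
    then show "norm ((1 - norm (v t x)) *\<^sub>R p t x) \<le> (1/64) * 1"
      using p_S2[OF assms] unfolding norm_scaleR by (intro mult_mono) auto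
  qed
  finally show ?thesis by simp
qed

text \<open>The displacement is \<open>t g + (1 / norm v - 1) v\<close>, and every factor that
  varies or multiplies a variation is small. This makes every \<open>p t\<close> bi-Lipschitz with
  constant 2 and, with the perturbation argument, onto.\<close>

lemma p_lipschitz_identity:
  assumes t: "t \<in> {0..1}" and xy: "x \<in> S2" "y \<in> S2"
  shows "norm ((p t x - x) - (p t y - y)) \<le> (1/8) * norm (x - y)"
proof -
  let ?n = "norm (x - y)" and ?a = "\<lambda>x. 1 / norm (v t x) - 1"
  note bx = v_bounds[OF t xy(1)] and byy = v_bounds[OF t xy(2)]
  have ax: "\<bar>?a x\<bar> \<le> 1/63"
  proof -
    have "1 / norm (v t x) \<le> 64/63" "1 / norm (v t x) \<ge> 64/65" using bx by (auto simp: divide_le_eq le_divide_eq)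
    then show ?thesis unfolding abs_le_iff by (intro conjI) linarith+
  qed
  have "\<bar>?a x - ?a y\<bar> * norm (v t y) = \<bar>norm (v t y) - norm (v t x)\<bar> / norm (v t x)"
    using bx byy by (simp add: field_simps abs_divide abs_mult)
  also have "\<dots> \<le> ((3/64) * ?n) / (63/64)"
    using bx norm_v_lipschitz[OF t xy] by (intro frac_le) (auto simp: abs_minus_commute)
  finally have da: "\<bar>?a x - ?a y\<bar> * norm (v t y) \<le> (1/21) * ?n" by simp
  have pv: "p t z - z = t *\<^sub>R g z + ?a z *\<^sub>R v t z" for z
    by (simp add: p_def sgn_eq_scaleR v_def algebra_simps)
  have "(p t x - x) - (p t y - y) = t *\<^sub>R (g x - g y) + ?a x *\<^sub>R (v t x - v t y) + (?a x - ?a y) *\<^sub>R v t y"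
    unfolding pv by (simp add: scaleR_diff_right scaleR_diff_left)
  also have "norm \<dots> \<le> 1 * ((1/64) * ?n) + (1/63) * ((65/64) * ?n) + (1/21) * ?n"
  proof (intro norm_triangle_mono)
    show "norm (t *\<^sub>R (g x - g y)) \<le> 1 * ((1/64) * ?n)"
      unfolding norm_scaleR using t lipschitz[OF xy] by (intro mult_mono) auto
    show "norm (?a x *\<^sub>R (v t x - v t y)) \<le> (1/63) * ((65/64) * ?n)"
      unfolding norm_scaleR using ax v_lipschitz[OF t xy] by (intro mult_mono) auto
    show "norm ((?a x - ?a y) *\<^sub>R v t y) \<le> (1/21) * ?n" using da by simp
  qed
  also have "\<dots> \<le> (1/8) * ?n" using norm_ge_zero[of "x - y"] by simp
  finally show ?thesis .
qed

lemma p_lower: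
  assumes "t \<in> {0..1}" "x \<in> S2" "y \<in> S2"
  shows "norm (x - y) \<le> 2 * norm (p t x - p t y)"
proof -
  have "norm (x - y) \<le> norm (p t x - p t y) + norm ((p t x - x) - (p t y - y))"
    using norm_triangle_ineq4[of "p t x - p t y" "(p t x - x) - (p t y - y)"] by (simp add: algebra_simps)
  then show ?thesis using p_lipschitz_identity[OF assms] norm_ge_zero[of "x - y"] by linarith
qed

lemma p_upper:
  assumes "t \<in> {0..1}" "x \<in> S2" "y \<in> S2"
  shows "norm (p t x - p t y) \<le> 2 * norm (x - y)"
proof -
  have "norm (p t x - p t y) \<le> norm (x - y) + norm ((p t x - x) - (p t y - y))"
    using norm_triangle_ineq[of "x - y" "(p t x - x) - (p t y - y)"] by (simp add: algebra_simps)
  then show ?thesis using p_lipschitz_identity[OF assms] norm_ge_zero[of "x - y"] by linarith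
qed

lemma p_surjective:
  assumes t: "t \<in> {0..1}" and y: "y \<in> S2"
  shows "\<exists>x\<in>S2. p t x = y"
proof -
  have "\<exists>x\<in>S2. x + (p t x - x) = y"
    by (rule sphere_perturbation_surjective)
      (use p_lipschitz_identity[OF t] p_near_identity[OF t] p_S2[OF t] y in simp_all)
  then show ?thesis by simp
qed

lemma p_0: "x \<in> S2 \<Longrightarrow> p 0 x = x"
  by (simp add: p_def v_def sgn_div_norm)

lemma p_1: "x \<in> S2 \<Longrightarrow> p 1 x = R x"
  using R_S2[of x] by (simp add: p_def v_def g_def sgn_div_norm)

lemma Y_tangent: "t \<in> {0..1} \<Longrightarrow> x \<in> S2 \<Longrightarrow> p t x \<bullet> Y t x = 0"
  using v_bounds(4)[of t x]
  by (simp add: p_def Y_def sgn_div_norm inner_diff_right power2_norm_eq_inner)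

lemma p_derivative:
  assumes t: "t \<in> {0..1}" and x: "x \<in> S2"
  shows "((\<lambda>s. p s x) has_vector_derivative Y t x) (at t within {0..1})"
proof -
  have v0: "v t x \<noteq> 0" by (rule v_bounds(4)[OF t x])
  have D: "((\<lambda>s. v s x) has_derivative (\<lambda>h. h *\<^sub>R g x)) (at t within {0..1})"
    unfolding v_def by (auto intro!: derivative_eq_intros)
  have DN: "((\<lambda>s. v s x \<bullet> v s x) has_derivative (\<lambda>h. h * (2 * (v t x \<bullet> g x)))) (at t within {0..1})"
    using has_derivative_inner[OF D D] by (simp add: inner_commute algebra_simps)
  then have "((\<lambda>s. v s x \<bullet> v s x) has_real_derivative 2 * (v t x \<bullet> g x)) (at t within {0..1})"
    unfolding has_field_derivative_def by (rule has_derivative_eq_rhs) (simp add: fun_eq_iff)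
  then have "((\<lambda>s. sqrt (v s x \<bullet> v s x)) has_real_derivative (inverse (sqrt (v t x \<bullet> v t x)) / 2) * (2 * (v t x \<bullet> g x))) (at t within {0..1})"
    by (rule DERIV_chain2[OF DERIV_real_sqrt, rotated]) (use v0 in simp)
  then have "((\<lambda>s. norm (v s x)) has_real_derivative (v t x \<bullet> g x) / norm (v t x)) (at t within {0..1})"
    by (simp add: norm_eq_sqrt_inner field_simps)
  then have "((\<lambda>s. 1 / norm (v s x)) has_real_derivative - ((v t x \<bullet> g x) / norm (v t x)) / (norm (v t x) * norm (v t x))) (at t within {0..1})"
    using DERIV_inverse_fun v0 by (fastforce simp: divide_inverse)
  from has_vector_derivative_scaleR[OF this, of "\<lambda>s. v s x" "g x"] D
  have "((\<lambda>s. (1 / norm (v s x)) *\<^sub>R v s x) has_vector_derivative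
     (1 / norm (v t x)) *\<^sub>R g x + (- ((v t x \<bullet> g x) / norm (v t x)) / (norm (v t x) * norm (v t x))) *\<^sub>R v t x) (at t within {0..1})"
    by (simp add: has_vector_derivative_def)
  moreover have "(1 / norm (v t x)) *\<^sub>R g x + (- ((v t x \<bullet> g x) / norm (v t x)) / (norm (v t x) * norm (v t x))) *\<^sub>R v t x = Y t x"
    by (simp add: Y_def scaleR_diff_right power2_eq_square mult.commute)
  ultimately show ?thesis unfolding p_def sgn_eq_scaleR by simp
qed

lemma g_continuous: "continuous_on S2 g"
  by (rule lipschitz_on_continuous_on[of "1/64"]) (use lipschitz in \<open>auto simp: lipschitz_on_def dist_norm\<close>)

lemma Y_continuous: "continuous_on ({0..1} \<times> S2) (\<lambda>(t, x). Y t x)"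
proof -
  have g: "continuous_on ({0..1} \<times> S2) (\<lambda>z :: real \<times> (real ^ 3). g (snd z))"
    by (rule continuous_on_compose2[OF g_continuous continuous_on_snd[OF continuous_on_id]]) auto
  have v: "continuous_on ({0..1} \<times> S2) (\<lambda>z. v (fst z) (snd z))"
    unfolding v_def by (intro continuous_on_add continuous_on_scaleR continuous_on_fst continuous_on_snd continuous_on_id g)
  have n: "continuous_on ({0..1} \<times> S2) (\<lambda>z. norm (v (fst z) (snd z)))" by (rule continuous_on_norm[OF v])
  have nz: "\<forall>z\<in>{0..1} \<times> S2. norm (v (fst z) (snd z)) \<noteq> 0" using v_bounds(4) by auto
  have "continuous_on ({0..1} \<times> S2) (\<lambda>z. Y (fst z) (snd z))"
    unfolding Y_def
    by (intro continuous_on_scaleR continuous_on_divide continuous_on_diff continuous_on_inner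
        continuous_on_power continuous_on_const g v n) (use nz in auto)
  then show ?thesis by (simp add: case_prod_unfold)
qed

end

section \<open>First-order control of sphere maps through the radial extension\<close>

text \<open>Three partial derivatives bound the derivative on the sphere by \<open>3 * e\<close>.
  For points at distance at most 1 the segment between them stays at distance at least
  \<open>1/2\<close> from the origin, which doubles the bound; for distant points the size of
  \<open>f\<close> suffices.\<close>

lemma radial_extension_lipschitz:
  fixes f :: "real ^ 3 \<Rightarrow> real ^ 3"
  assumes diff: "\<And>z. z \<noteq> 0 \<Longrightarrow> radial_extension f differentiable (at z)"
    and f: "\<And>x. x \<in> S2 \<Longrightarrow> norm (f x) \<le> e"
    and Df: "\<And>b x. b \<in> Basis \<Longrightarrow> x \<in> S2 \<Longrightarrow> norm (partial_deriv b (radial_extension f) x) \<le> e"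
    and xy: "x \<in> S2" "y \<in> S2"
  shows "norm (f x - f y) \<le> 6 * e * norm (x - y)"
proof -
  let ?F = "radial_extension f"
  have e: "e \<ge> 0" using order_trans[OF norm_ge_zero f[OF xy(1)]] .
  have F: "?F x = f x" if "x \<in> S2" for x using that by (simp add: radial_extension_def sgn_div_norm)
  define D where "D z = frechet_derivative ?F (at z)" for z
  have D: "(?F has_derivative D z) (at z)" if "z \<noteq> 0" for z
    unfolding D_def using frechet_derivative_works[THEN iffD1, OF diff[OF that]] .
  have Dbound: "norm (D x h) \<le> 3 * e * norm h" if x: "x \<in> S2" for x h
  proof -
    have "x \<noteq> 0" using x by auto
    then interpret bounded_linear "D x" using D has_derivative_bounded_linear by blast
    have "D x h = D x (\<Sum>b\<in>Basis. (h \<bullet> b) *\<^sub>R b)" by (simp add: euclidean_representation)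
    also have "\<dots> = (\<Sum>b\<in>Basis. (h \<bullet> b) *\<^sub>R D x b)" by (simp add: sum scaleR)
    also have "norm \<dots> \<le> (\<Sum>b\<in>(Basis :: (real ^ 3) set). norm h * e)"
    proof (rule sum_norm_le)
      fix b :: "real ^ 3" assume b: "b \<in> Basis"
      show "norm ((h \<bullet> b) *\<^sub>R D x b) \<le> norm h * e"
        unfolding norm_scaleR using Basis_le_norm[OF b, of h] Df[OF b x]
        by (intro mult_mono) (auto simp: partial_deriv_def D_def)
    qed
    finally show ?thesis by (simp add: mult_ac)
  qed
  \<comment> \<open>The extension is constant along rays, so its derivative at \<open>z\<close> is
    \<open>1 / norm z\<close> times the one at \<open>sgn z\<close>.\<close>
  have Dscaled: "norm (D z h) \<le> 6 * e * norm h" if z: "norm z \<ge> 1/2" for z h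
  proof -
    have z0: "z \<noteq> 0" "norm z > 0" using z by auto
    let ?x = "sgn z"
    have x: "?x \<in> S2" using z0 by (simp add: norm_sgn)
    have zx: "norm z *\<^sub>R ?x = z" using z0 by (simp add: sgn_div_norm)
    have "(?F has_derivative D z) (at (norm z *\<^sub>R ?x))" unfolding zx by (rule D[OF z0(1)])
    then have "((\<lambda>w. ?F (norm z *\<^sub>R w)) has_derivative (\<lambda>h. D z (norm z *\<^sub>R h))) (at ?x)"
      by (rule has_derivative_compose[rotated]) (auto intro!: derivative_eq_intros)
    moreover have "(\<lambda>w. ?F (norm z *\<^sub>R w)) = ?F"
      using z0 by (simp add: radial_extension_def sgn_scaleR fun_eq_iff)
    ultimately have "(?F has_derivative (\<lambda>h. D z (norm z *\<^sub>R h))) (at ?x)" by simp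
    moreover have "?x \<noteq> 0" using z0 by (simp add: sgn_zero_iff)
    ultimately have "D ?x = (\<lambda>h. D z (norm z *\<^sub>R h))" using D has_derivative_unique by blast
    then have "D ?x ((1 / norm z) *\<^sub>R h) = D z h" using z0 by simp
    then have "norm (D z h) \<le> 3 * e * norm ((1 / norm z) *\<^sub>R h)" using Dbound[OF x] by metis
    also have "\<dots> = (3 * e * norm h) * (1 / norm z)" by simp
    also have "\<dots> \<le> (3 * e * norm h) * 2" using z z0 e by (intro mult_left_mono) (auto simp: divide_le_eq)
    finally show ?thesis by simp
  qed
  show ?thesis
  proof (cases "norm (x - y) \<le> 1")
    case True
    have seg: "norm z \<ge> 1/2" if "z \<in> closed_segment x y" for z
    proof -
      have "norm (x - z) + norm (z - y) = norm (x - y)"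
        using that between_mem_segment between unfolding dist_norm[symmetric] by metis
      then have "norm (x - z) \<le> 1/2 \<or> norm (z - y) \<le> 1/2" using True by linarith
      then show ?thesis
        using norm_triangle_ineq2[of x z] norm_triangle_ineq2[of y z] xy by (auto simp: norm_minus_commute)
    qed
    have "norm (?F x - ?F y) \<le> (6 * e) * norm (x - y)"
    proof (rule differentiable_bound[of "closed_segment x y" ?F D])
      fix z assume z: "z \<in> closed_segment x y"
      then have "z \<noteq> 0" using seg[of z] by auto
      then show "(?F has_derivative D z) (at z within closed_segment x y)"
        using D has_derivative_at_withinI by blast
      show "onorm (D z) \<le> 6 * e" using Dscaled[OF seg[OF z]] e by (intro onorm_bound) auto
    qed auto
    then show ?thesis using F xy by simp
  next
    case False
    have "norm (f x - f y) \<le> e + e" using f[OF xy(1)] f[OF xy(2)] norm_triangle_ineq4[of "f x" "f y"] by linarith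
    also have "\<dots> \<le> 6 * e * 1" using e by simp
    also have "\<dots> \<le> 6 * e * norm (x - y)" using False e by (intro mult_left_mono) auto
    finally show ?thesis .
  qed
qed

lemma smooth_on_sphereD:
  assumes "smooth_on_sphere f" "bs \<in> lists Basis"
  shows "z \<noteq> 0 \<Longrightarrow> iterated_partial bs (radial_extension f) differentiable (at z)"
    "continuous_on S2 (iterated_partial bs (radial_extension f))"
proof -
  show d: "iterated_partial bs (radial_extension f) differentiable (at z)" if "z \<noteq> 0" for z
    using assms that unfolding smooth_on_sphere_def smooth_on_def by auto
  show "continuous_on S2 (iterated_partial bs (radial_extension f))"
  proof (rule continuous_at_imp_continuous_on, rule ballI)
    fix x :: "real ^ 3" assume "x \<in> S2"
    then have "x \<noteq> 0" by auto
    then show "isCont (iterated_partial bs (radial_extension f)) x" using d differentiable_imp_continuous_within by blast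
  qed
qed

lemma smooth_on_sphere_continuous:
  assumes "smooth_on_sphere f"
  shows "continuous_on S2 f"
proof -
  have "continuous_on S2 (radial_extension f)" using smooth_on_sphereD(2)[OF assms, of "[]"] by simp
  then show ?thesis
    by (rule continuous_on_cong[THEN iffD1, rotated 2]) (auto simp: radial_extension_def sgn_div_norm)
qed

lemma smooth_on_sphere_lipschitz:
  assumes f: "smooth_on_sphere f"
  shows "\<exists>K\<ge>0. \<forall>x\<in>S2. \<forall>y\<in>S2. norm (f x - f y) \<le> K * norm (x - y)"
proof -
  have bnd: "\<exists>B. \<forall>x\<in>S2. norm (iterated_partial bs (radial_extension f) x) \<le> B" if "bs \<in> lists Basis" for bs
  proof -
    have "bounded (iterated_partial bs (radial_extension f) ` S2)"
      by (intro compact_imp_bounded compact_continuous_image smooth_on_sphereD(2)[OF f that]) simp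
    then show ?thesis by (auto simp: bounded_iff)
  qed
  have "\<forall>b. \<exists>B. b \<in> Basis \<longrightarrow> (\<forall>x\<in>S2. norm (partial_deriv b (radial_extension f) x) \<le> B)"
    using bnd[of "[_]"] by auto
  then obtain B where B: "\<And>b x. b \<in> Basis \<Longrightarrow> x \<in> S2 \<Longrightarrow> norm (partial_deriv b (radial_extension f) x) \<le> B b" by metis
  obtain B0 where "\<forall>x\<in>S2. norm (radial_extension f x) \<le> B0" using bnd[of "[]"] by auto
  then have B0: "\<And>x. x \<in> S2 \<Longrightarrow> norm (radial_extension f x) \<le> B0" by blast
  define e where "e = \<bar>B0\<bar> + (\<Sum>b\<in>Basis. \<bar>B b\<bar>)"
  have "norm (f x - f y) \<le> 6 * e * norm (x - y)" if "x \<in> S2" "y \<in> S2" for x y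
  proof (rule radial_extension_lipschitz[OF _ _ _ that])
    show "radial_extension f differentiable (at z)" if "z \<noteq> 0" for z
      using smooth_on_sphereD(1)[OF f, of "[]" z] that by simp
    show "norm (f x) \<le> e" if "x \<in> S2" for x
    proof -
      have "norm (f x) \<le> B0" using B0[OF that] that by (simp add: radial_extension_def sgn_div_norm)
      moreover have "(\<Sum>b\<in>Basis. \<bar>B b\<bar>) \<ge> 0" by (intro sum_nonneg) auto
      ultimately show ?thesis unfolding e_def using abs_ge_self[of B0] by linarith
    qed
    show "norm (partial_deriv b (radial_extension f) x) \<le> e" if "b \<in> Basis" "x \<in> S2" for b x
      using B[OF that] member_le_sum[of b Basis "\<lambda>b. \<bar>B b\<bar>"] that by (simp add: e_def)
  qed
  moreover have "6 * e \<ge> 0" by (simp add: e_def sum_nonneg)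
  ultimately show ?thesis by blast
qed

lemma dist_less_Diff_dist:
  assumes P: "smooth_on_sphere P" and Q: "smooth_on_sphere Q" and bs: "bs \<in> lists Basis"
    and less: "Diff_dist bs P Q < e" and x: "x \<in> S2"
  shows "dist (iterated_partial bs (radial_extension P) x) (iterated_partial bs (radial_extension Q) x) < e"
proof -
  let ?d = "\<lambda>x. dist (iterated_partial bs (radial_extension P) x) (iterated_partial bs (radial_extension Q) x)"
  have "compact (?d ` S2)"
    by (intro compact_continuous_image continuous_on_dist smooth_on_sphereD(2)[OF P bs] smooth_on_sphereD(2)[OF Q bs]) simp
  then have "bdd_above (?d ` S2)" by (intro bounded_imp_bdd_above compact_imp_bounded)
  then have "?d x \<le> Diff_dist bs P Q" unfolding Diff_dist_def using x by (intro cSUP_upper)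
  then show ?thesis using less by simp
qed

lemma Diff_dist_self: "Diff_dist bs P P = 0"
proof -
  have "S2 \<noteq> {}" by (metis empty_iff norm_axis_1 mem_sphere_0)
  then show ?thesis by (simp add: Diff_dist_def)
qed

lemma Diff_dist_ball_openin:
  assumes "P \<in> Diff" "bs \<in> lists Basis" "e > 0"
  shows "openin Diff_topology {Q \<in> Diff. Diff_dist bs P Q < e}"
  unfolding Diff_topology_def by (rule topology_generated_by_Basis) (use assms in blast)

lemma topspace_Diff_topology: "topspace Diff_topology \<subseteq> Diff"
  unfolding Diff_topology_def by auto

section \<open>Approximable diffeomorphisms form an open and closed set\<close>

context rich_sphere_monoid begin

definition approximable :: "(real ^ 3 \<Rightarrow> real ^ 3) \<Rightarrow> bool" where
  "approximable P \<longleftrightarrow> (\<forall>\<epsilon>>0. \<exists>g\<in>M. \<forall>x\<in>S2. norm (P x - g x) < \<epsilon>)"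

lemma approximable_comp:
  assumes R: "approximable R" "continuous_on S2 R" and P: "approximable P" "\<And>x. x \<in> S2 \<Longrightarrow> P x \<in> S2"
  shows "approximable (R \<circ> P)"
  unfolding approximable_def
proof (intro allI impI)
  fix \<epsilon> :: real assume "\<epsilon> > 0"
  then have e2: "\<epsilon>/2 > 0" by simp
  have "uniformly_continuous_on S2 R" by (rule compact_uniformly_continuous[OF R(2)]) simp
  then obtain d where d: "d > 0" "\<forall>x\<in>S2. \<forall>y\<in>S2. dist y x < d \<longrightarrow> dist (R y) (R x) < \<epsilon>/2"
    unfolding uniformly_continuous_on_def using e2 by blast
  obtain g where g: "g \<in> M" "\<And>x. x \<in> S2 \<Longrightarrow> norm (P x - g x) < d" using P(1) d(1) unfolding approximable_def by blast
  obtain r where r: "r \<in> M" "\<And>x. x \<in> S2 \<Longrightarrow> norm (R x - r x) < \<epsilon>/2" using R(1) e2 unfolding approximable_def by blast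
  have "norm ((R \<circ> P) x - (r \<circ> g) x) < \<epsilon>" if x: "x \<in> S2" for x
  proof -
    have gx: "g x \<in> S2" by (rule maps_S2[OF g(1) x])
    have "norm (R (P x) - R (g x)) < \<epsilon>/2" using d(2) gx P(2)[OF x] g(2)[OF x] by (simp add: dist_norm)
    moreover have "norm (R (g x) - r (g x)) < \<epsilon>/2" by (rule r(2)[OF gx])
    ultimately show ?thesis
      using norm_triangle_ineq[of "R (P x) - R (g x)" "R (g x) - r (g x)"] by simp
  qed
  then show "\<exists>h\<in>M. \<forall>x\<in>S2. norm ((R \<circ> P) x - h x) < \<epsilon>" using comp_mem[OF r(1) g(1)] by blast
qed

text \<open>
  \<open>A s \<eta>\<close> says that \<open>p s\<close> is approximated by a reachable map up to an error \<open>\<eta>\<close> measured at the source. One step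
  along the velocity field of \<open>p\<close> increases \<open>\<eta>\<close> by at most \<open>6 \<epsilon>\<close> times the length of the step, so errors add up.
\<close>

lemma near_identity_approximable:
  assumes "sphere_near_identity R"
  shows "approximable R"
proof -
  interpret N: sphere_near_identity R by fact
  define A where "A s \<eta> \<longleftrightarrow> (\<exists>G\<in>M. \<exists>\<zeta>. \<forall>x\<in>S2. \<zeta> x \<in> S2 \<and> N.p s (\<zeta> x) = G x \<and> norm (\<zeta> x - x) \<le> \<eta>)" for s \<eta>
  have uY: "uniformly_continuous_on ({0..1} \<times> S2) (\<lambda>(t, x). N.Y t x)"
    by (intro compact_uniformly_continuous N.Y_continuous compact_Times) auto
  have "bounded ((\<lambda>(t, x). N.Y t x) ` ({0..1} \<times> S2))"
    by (intro compact_imp_bounded compact_continuous_image N.Y_continuous compact_Times) auto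
  then obtain B where "B > 0" and "\<forall>w\<in>(\<lambda>(t, x). N.Y t x) ` ({0..1} \<times> S2). norm w \<le> B"
    unfolding bounded_pos by blast
  then have B: "B > 0" "norm (N.Y t x) \<le> B" if "t \<in> {0..1}" "x \<in> S2" for t x
    using that by auto
  have speed: "norm (N.p b z - N.p a z) \<le> B * \<bar>b - a\<bar>" if "z \<in> S2" "a \<in> {0..1}" "b \<in> {0..1}" for a b z
    by (rule vector_derivative_bound[OF N.p_derivative B(2)]) (use that in auto)
  \<comment> \<open>The form required by interval induction: around each \<open>t\<close> there is a
    length below which single steps across \<open>t\<close> are allowed.\<close>
  have step: "\<exists>d>0. \<forall>a b. a \<le> t \<and> t \<le> b \<and> b - a < d \<longrightarrow>
      (0 \<le> a \<longrightarrow> b \<le> 1 \<longrightarrow> (\<forall>\<eta>. A a \<eta> \<longrightarrow> A b (\<eta> + 6 * \<epsilon> * (b - a))))"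
    if t: "t \<in> {0..1}" and \<epsilon>: "\<epsilon> > 0" for t \<epsilon>
  proof -
    have "\<forall>y\<in>S2. \<exists>x. x \<in> S2 \<and> N.p t x = y" using N.p_surjective[OF t] by blast
    from bchoice[OF this] obtain q where q: "\<And>y. y \<in> S2 \<Longrightarrow> q y \<in> S2" "\<And>y. y \<in> S2 \<Longrightarrow> N.p t (q y) = y" by blast
    have qp: "q (N.p t z) = z" if z: "z \<in> S2" for z
      using N.p_lower[OF t q(1)[OF N.p_S2[OF t z]] z] q(2)[OF N.p_S2[OF t z]] by simp
    \<comment> \<open>The velocity of the path at time \<open>t\<close>, moved from source to target
      points by the inverse \<open>q\<close> of \<open>p t\<close>. It is an autonomous continuous
      tangent field, hence accessible.\<close>
    define X where "X y = N.Y t (q y)" for y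
    have "continuous_on S2 q"
      by (rule lipschitz_on_continuous_on[of 2])
        (use N.p_lower[OF t q(1) q(1)] q(2) in \<open>auto simp: lipschitz_on_def dist_norm\<close>)
    then have "continuous_on S2 (\<lambda>y. (t, q y))" by (intro continuous_on_Pair continuous_on_const)
    then have "continuous_on S2 (\<lambda>y. (\<lambda>(t, x). N.Y t x) (t, q y))"
      by (rule continuous_on_compose2[OF N.Y_continuous]) (use q t in auto)
    then have cX: "continuous_on S2 X" by (simp add: X_def)
    have "y \<bullet> X y = 0" if "y \<in> S2" for y
      using N.Y_tangent[OF t q(1)[OF that]] q(2)[OF that] by (simp add: X_def)
    from accessible_continuous[OF cX this] have "accessible_within \<epsilon> X" using \<epsilon> by (simp add: accessible_def)
    from accessible_withinE[OF this] obtain \<psi> \<delta> where \<psi>: "family \<psi>" "\<delta> > 0"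
      "\<And>h x. \<bar>h\<bar> \<le> \<delta> \<Longrightarrow> x \<in> S2 \<Longrightarrow> norm (\<psi> h x - x - h *\<^sub>R X x) \<le> \<epsilon> * \<bar>h\<bar>" by blast
    obtain d1 where d1: "d1 > 0" "\<forall>w\<in>{0..1} \<times> S2. \<forall>w'\<in>{0..1} \<times> S2. dist w' w < d1 \<longrightarrow>
        dist ((\<lambda>(t, x). N.Y t x) w') ((\<lambda>(t, x). N.Y t x) w) < \<epsilon>"
      using uY \<epsilon> unfolding uniformly_continuous_on_def by blast
    have Y1: "norm (N.Y s z - N.Y t z) \<le> \<epsilon>" if "s \<in> {0..1}" "z \<in> S2" "\<bar>s - t\<bar> < d1" for s z
      using d1(2)[rule_format, of "(t, z)" "(s, z)"] that t by (simp add: dist_Pair_Pair dist_norm)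
    have "uniformly_continuous_on S2 X" by (rule compact_uniformly_continuous[OF cX]) simp
    then obtain d2 where d2: "d2 > 0" "\<forall>x\<in>S2. \<forall>y\<in>S2. dist y x < d2 \<longrightarrow> dist (X y) (X x) < \<epsilon>"
      using \<epsilon> unfolding uniformly_continuous_on_def by blast
    define d where "d = min (min \<delta> d1) (d2 / B)"
    have "B > 0" using B(1)[of 0 "axis 1 1"] by simp
    then have "d > 0" using \<psi>(2) d1(1) d2(1) by (simp add: d_def)
    moreover have "A b (\<eta> + 6 * \<epsilon> * (b - a))"
      if ab: "a \<le> t" "t \<le> b" "b - a < d" "0 \<le> a" "b \<le> 1" and A: "A a \<eta>" for a b \<eta>
    proof -
      let ?h = "b - a"
      have h: "?h \<ge> 0" using ab by simp
      have ab1: "a \<in> {0..1}" "b \<in> {0..1}" using ab by auto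
      obtain G \<zeta> where G: "G \<in> M" "\<And>x. x \<in> S2 \<Longrightarrow> \<zeta> x \<in> S2 \<and> N.p a (\<zeta> x) = G x \<and> norm (\<zeta> x - x) \<le> \<eta>"
        using A unfolding A_def by blast
      \<comment> \<open>Three errors of size \<open>\<epsilon> * ?h\<close>: that of the family, the
        change of \<open>X\<close> between times \<open>a\<close> and \<open>t\<close>, and the
        change of the velocity along the path.\<close>
      have key: "norm (\<psi> ?h (N.p a z) - N.p b z) \<le> 3 * \<epsilon> * ?h" if z: "z \<in> S2" for z
      proof -
        have pa: "N.p a z \<in> S2" and pt: "N.p t z \<in> S2" using N.p_S2 ab1 t z by auto
        have 1: "norm (\<psi> ?h (N.p a z) - N.p a z - ?h *\<^sub>R X (N.p a z)) \<le> \<epsilon> * ?h"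
          using \<psi>(3)[of ?h "N.p a z"] pa h ab by (simp add: d_def)
        have "norm (N.p a z - N.p t z) \<le> B * \<bar>a - t\<bar>" by (rule speed[OF z t ab1(1)])
        also have "\<bar>a - t\<bar> < d2 / B" using ab by (auto simp: d_def)
        then have "B * \<bar>a - t\<bar> < d2" using \<open>B > 0\<close> by (simp add: less_divide_eq mult.commute)
        finally have "norm (X (N.p a z) - X (N.p t z)) \<le> \<epsilon>" using d2(2) pa pt by (simp add: dist_norm less_imp_le)
        moreover have "X (N.p t z) = N.Y t z" by (simp add: X_def qp[OF z])
        ultimately have 2: "norm (?h *\<^sub>R (X (N.p a z) - N.Y t z)) \<le> ?h * \<epsilon>"
          using h by (simp add: mult_left_mono)
        have "norm ((N.p b z - b *\<^sub>R N.Y t z) - (N.p a z - a *\<^sub>R N.Y t z)) \<le> \<epsilon> * \<bar>b - a\<bar>"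
        proof (rule vector_derivative_bound[of a b "\<lambda>s. N.p s z - s *\<^sub>R N.Y t z" "\<lambda>s. N.Y s z - N.Y t z"])
          fix s assume s: "s \<in> {a..b}"
          then have s1: "s \<in> {0..1}" using ab by auto
          have "((\<lambda>s. N.p s z - s *\<^sub>R N.Y t z) has_vector_derivative N.Y s z - 1 *\<^sub>R N.Y t z) (at s within {a..b})"
            by (intro has_vector_derivative_diff has_vector_derivative_id_scaleR
                has_vector_derivative_within_subset[OF N.p_derivative[OF s1 z]]) (use ab in auto)
          then show "((\<lambda>s. N.p s z - s *\<^sub>R N.Y t z) has_vector_derivative N.Y s z - N.Y t z) (at s within {a..b})" by simp
          show "norm (N.Y s z - N.Y t z) \<le> \<epsilon>"
            using s ab by (intro Y1 s1 z) (auto simp: d_def)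
        qed (use ab in auto)
        then have 3: "norm (N.p b z - N.p a z - ?h *\<^sub>R N.Y t z) \<le> \<epsilon> * ?h" using h by (simp add: algebra_simps)
        have "\<psi> ?h (N.p a z) - N.p b z = (\<psi> ?h (N.p a z) - N.p a z - ?h *\<^sub>R X (N.p a z))
            + ?h *\<^sub>R (X (N.p a z) - N.Y t z) - (N.p b z - N.p a z - ?h *\<^sub>R N.Y t z)"
          by (simp add: algebra_simps)
        also have "norm \<dots> \<le> (\<epsilon> * ?h + ?h * \<epsilon>) + \<epsilon> * ?h"
          by (rule order_trans[OF norm_triangle_ineq4 add_mono[OF norm_triangle_mono[OF 1 2] 3]])
        finally show ?thesis by (simp add: algebra_simps)
      qed
      \<comment> \<open>The new image point is written as \<open>N.p b z\<close>. Pulling back to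
        the source costs the factor 2 of \<open>p_lower\<close>, which turns 3 into 6.\<close>
      have "\<exists>z. z \<in> S2 \<and> N.p b z = (\<psi> ?h \<circ> G) x \<and> norm (z - x) \<le> \<eta> + 6 * \<epsilon> * ?h" if x: "x \<in> S2" for x
      proof -
        note Gx = G(2)[OF x]
        have "G x \<in> S2" by (rule maps_S2[OF G(1) x])
        then have "\<psi> ?h (G x) \<in> S2" using \<psi>(1) maps_S2 unfolding family_def by blast
        then obtain z where z: "z \<in> S2" "N.p b z = \<psi> ?h (G x)" using N.p_surjective[OF ab1(2)] by blast
        have "norm (z - \<zeta> x) \<le> 2 * norm (N.p b z - N.p b (\<zeta> x))" using N.p_lower[OF ab1(2) z(1)] Gx by blast
        also have "N.p b z = \<psi> ?h (N.p a (\<zeta> x))" using z(2) Gx by simp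
        also have "2 * norm (\<psi> ?h (N.p a (\<zeta> x)) - N.p b (\<zeta> x)) \<le> 2 * (3 * \<epsilon> * ?h)"
          using key[of "\<zeta> x"] Gx by simp
        finally have "norm (z - x) \<le> \<eta> + 6 * \<epsilon> * ?h"
          using norm_triangle_ineq[of "z - \<zeta> x" "\<zeta> x - x"] Gx by simp
        then show ?thesis using z by auto
      qed
      then have "\<forall>x\<in>S2. \<exists>z. z \<in> S2 \<and> N.p b z = (\<psi> ?h \<circ> G) x \<and> norm (z - x) \<le> \<eta> + 6 * \<epsilon> * ?h" by blast
      from bchoice[OF this] obtain \<zeta>' where "\<forall>x\<in>S2. \<zeta>' x \<in> S2 \<and> N.p b (\<zeta>' x) = (\<psi> ?h \<circ> G) x \<and> norm (\<zeta>' x - x) \<le> \<eta> + 6 * \<epsilon> * ?h" by blast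
      moreover have "\<psi> ?h \<circ> G \<in> M" using comp_mem G(1) \<psi>(1) by (auto simp: family_def)
      ultimately show ?thesis unfolding A_def by blast
    qed
    ultimately show ?thesis by blast
  qed
  show ?thesis
    unfolding approximable_def
  proof (intro allI impI)
    fix \<epsilon>0 :: real assume "\<epsilon>0 > 0"
    \<comment> \<open>The final error is at most \<open>2 * (6 * \<epsilon>)\<close>, half of
      \<open>\<epsilon>0\<close>.\<close>
    define \<epsilon> where "\<epsilon> = \<epsilon>0 / 24"
    have \<epsilon>: "\<epsilon> > 0" using \<open>\<epsilon>0 > 0\<close> by (simp add: \<epsilon>_def)
    have "0 \<le> (0::real) \<longrightarrow> (1::real) \<le> 1 \<longrightarrow> (\<forall>\<eta>. A 0 \<eta> \<longrightarrow> A 1 (\<eta> + 6 * \<epsilon> * (1 - 0)))"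
    proof (rule Bolzano[of 0 1 "\<lambda>a b. 0 \<le> a \<longrightarrow> b \<le> 1 \<longrightarrow> (\<forall>\<eta>. A a \<eta> \<longrightarrow> A b (\<eta> + 6 * \<epsilon> * (b - a)))"])
      fix a b c :: real
      assume ab: "0 \<le> a \<longrightarrow> b \<le> 1 \<longrightarrow> (\<forall>\<eta>. A a \<eta> \<longrightarrow> A b (\<eta> + 6 * \<epsilon> * (b - a)))"
        and bc: "0 \<le> b \<longrightarrow> c \<le> 1 \<longrightarrow> (\<forall>\<eta>. A b \<eta> \<longrightarrow> A c (\<eta> + 6 * \<epsilon> * (c - b)))" and le: "a \<le> b" "b \<le> c"
      show "0 \<le> a \<longrightarrow> c \<le> 1 \<longrightarrow> (\<forall>\<eta>. A a \<eta> \<longrightarrow> A c (\<eta> + 6 * \<epsilon> * (c - a)))"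
      proof (intro impI allI)
        fix \<eta> assume "0 \<le> a" "c \<le> 1" "A a \<eta>"
        then have "A c (\<eta> + 6 * \<epsilon> * (b - a) + 6 * \<epsilon> * (c - b))" using ab bc le by simp
        moreover have "\<eta> + 6 * \<epsilon> * (b - a) + 6 * \<epsilon> * (c - b) = \<eta> + 6 * \<epsilon> * (c - a)" by (simp add: algebra_simps)
        ultimately show "A c (\<eta> + 6 * \<epsilon> * (c - a))" by simp
      qed
    next
      fix t :: real assume "0 \<le> t" "t \<le> 1"
      then show "\<exists>d>0. \<forall>a b. a \<le> t \<and> t \<le> b \<and> b - a < d \<longrightarrow>
        (0 \<le> a \<longrightarrow> b \<le> 1 \<longrightarrow> (\<forall>\<eta>. A a \<eta> \<longrightarrow> A b (\<eta> + 6 * \<epsilon> * (b - a))))"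
        using step[of t \<epsilon>] \<epsilon> by simp
    qed simp
    moreover have "A 0 0" unfolding A_def using id_mem N.p_0 by (intro bexI[of _ id] exI[of _ "\<lambda>x. x"]) auto
    ultimately have "A 1 (6 * \<epsilon>)" by fastforce
    then obtain G \<zeta> where G: "G \<in> M" "\<And>x. x \<in> S2 \<Longrightarrow> \<zeta> x \<in> S2 \<and> N.p 1 (\<zeta> x) = G x \<and> norm (\<zeta> x - x) \<le> 6 * \<epsilon>"
      unfolding A_def by blast
    have "norm (R x - G x) < \<epsilon>0" if x: "x \<in> S2" for x
    proof -
      note Gx = G(2)[OF x]
      have "norm (R x - G x) = norm (N.p 1 (\<zeta> x) - N.p 1 x)" using N.p_1[OF x] Gx by (simp add: norm_minus_commute)
      also have "\<dots> \<le> 2 * norm (\<zeta> x - x)" using Gx x by (intro N.p_upper) auto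
      also have "\<dots> \<le> 2 * (6 * \<epsilon>)" using Gx by simp
      also have "\<dots> < \<epsilon>0" using \<open>\<epsilon>0 > 0\<close> by (simp add: \<epsilon>_def)
      finally show ?thesis .
    qed
    then show "\<exists>g\<in>M. \<forall>x\<in>S2. norm (R x - g x) < \<epsilon>0" using G(1) by blast
  qed
qed

text \<open>A nearby \<open>Q\<close> is written as \<open>R \<circ> P\<close> with \<open>R\<close>
  the composition of \<open>Q\<close> and the inverse of \<open>P\<close>. The displacement of
  \<open>R\<close> is the difference \<open>Q - P\<close> read through that inverse, so it is small
  together with its Lipschitz constant.\<close>

lemma approximable_neighbourhood:
  assumes P: "P \<in> Diff" "approximable P"
  shows "\<exists>U. openin Diff_topology U \<and> P \<in> U \<and> (\<forall>Q\<in>U. Q \<in> Diff \<and> approximable Q)"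
proof -
  have sP: "smooth_on_sphere P" and sI: "smooth_on_sphere (inv_into S2 P)" and bij: "bij_betw P S2 S2"
    using P(1) by (auto simp: Diff_def)
  obtain K where K: "K \<ge> 0" "\<And>x y. x \<in> S2 \<Longrightarrow> y \<in> S2 \<Longrightarrow> norm (inv_into S2 P x - inv_into S2 P y) \<le> K * norm (x - y)"
    using smooth_on_sphere_lipschitz[OF sI] by blast
  \<comment> \<open>With \<open>384 = 6 * 64\<close>, this meets the bound \<open>1/64\<close> of
    \<open>sphere_near_identity\<close> after the factor 6 of
    \<open>radial_extension_lipschitz\<close> and the Lipschitz constant \<open>K\<close> of the
    inverse.\<close>
  define e where "e = 1 / (384 * (K + 1))"
  have e: "e > 0" "e \<le> 1/64" "6 * e * K \<le> 1/64" using K(1) by (auto simp: e_def field_simps)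
  \<comment> \<open>Derivatives of order zero and one are enough, so finitely many balls are
    intersected.\<close>
  define \<B> where "\<B> = insert [] ((\<lambda>b. [b]) ` (Basis :: (real ^ 3) set))"
  have \<B>: "finite \<B>" "\<B> \<noteq> {}" "\<And>bs. bs \<in> \<B> \<Longrightarrow> bs \<in> lists Basis" by (auto simp: \<B>_def)
  define U where "U = (\<Inter>bs\<in>\<B>. {Q \<in> Diff. Diff_dist bs P Q < e})"
  have "openin Diff_topology U"
    unfolding U_def using \<B> e(1) P(1) by (intro openin_INT2) (auto intro!: Diff_dist_ball_openin)
  moreover have "P \<in> U" using P(1) e(1) by (simp add: U_def Diff_dist_self)
  moreover have "Q \<in> Diff \<and> approximable Q" if Q: "Q \<in> U" for Q
  proof -
    have QD: "Q \<in> Diff" and dQ: "\<And>bs. bs \<in> \<B> \<Longrightarrow> Diff_dist bs P Q < e" using Q \<B>(2) by (auto simp: U_def)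
    have sQ: "smooth_on_sphere Q" and bQ: "bij_betw Q S2 S2" using QD by (auto simp: Diff_def)
    let ?f = "\<lambda>x. Q x - P x"
    have rf: "radial_extension ?f = (\<lambda>x. radial_extension Q x - radial_extension P x)"
      by (simp add: radial_extension_def)
    have dP: "radial_extension P differentiable (at z)" "radial_extension Q differentiable (at z)" if "z \<noteq> 0" for z
      using smooth_on_sphereD(1)[OF sP, of "[]" z] smooth_on_sphereD(1)[OF sQ, of "[]" z] that by simp_all
    have near: "dist (iterated_partial bs (radial_extension P) x) (iterated_partial bs (radial_extension Q) x) < e"
      if "bs \<in> \<B>" "x \<in> S2" for bs x
      by (rule dist_less_Diff_dist[OF sP sQ \<B>(3)[OF that(1)] dQ[OF that(1)] that(2)])
    have f_small: "norm (?f x) \<le> e" if "x \<in> S2" for x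
      using near[of "[]" x] that by (simp add: \<B>_def radial_extension_def sgn_div_norm dist_norm norm_minus_commute)
    have f_lip: "norm (?f x - ?f y) \<le> 6 * e * norm (x - y)" if "x \<in> S2" "y \<in> S2" for x y
    proof (rule radial_extension_lipschitz[OF _ f_small _ that])
      show "radial_extension ?f differentiable (at z)" if "z \<noteq> 0" for z
        unfolding rf using dP[OF that] by (intro differentiable_diff)
      fix b x :: "real ^ 3" assume b: "b \<in> Basis" and x: "x \<in> S2"
      have x0: "x \<noteq> 0" using x by auto
      have "frechet_derivative (radial_extension ?f) (at x)
          = (\<lambda>h. frechet_derivative (radial_extension Q) (at x) h - frechet_derivative (radial_extension P) (at x) h)"
        unfolding rf
        by (rule frechet_derivative_at[symmetric], intro has_derivative_diff)
          (use dP[OF x0] in \<open>simp_all add: frechet_derivative_works\<close>)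
      then have "partial_deriv b (radial_extension ?f) x = partial_deriv b (radial_extension Q) x - partial_deriv b (radial_extension P) x"
        by (simp add: partial_deriv_def)
      then show "norm (partial_deriv b (radial_extension ?f) x) \<le> e"
        using near[of "[b]" x] b x by (simp add: \<B>_def dist_norm norm_minus_commute)
    qed
    define R where "R x = Q (inv_into S2 P x)" for x
    have inv: "inv_into S2 P x \<in> S2" "P (inv_into S2 P x) = x" if "x \<in> S2" for x
    proof -
      have "x \<in> P ` S2" using bij that by (simp add: bij_betw_def)
      then show "inv_into S2 P x \<in> S2" "P (inv_into S2 P x) = x"
        by (rule inv_into_into, rule f_inv_into_f)
    qed
    have Rf: "R x - x = ?f (inv_into S2 P x)" if "x \<in> S2" for x using inv(2)[OF that] by (simp add: R_def)
    have "sphere_near_identity R"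
    proof
      show "R x \<in> S2" if "x \<in> S2" for x
        using bQ inv(1)[OF that] unfolding R_def by (rule bij_betwE[rule_format])
      show "norm (R x - x) \<le> 1/64" if "x \<in> S2" for x
        using f_small[OF inv(1)[OF that]] e(2) Rf[OF that] by simp
      show "norm ((R x - x) - (R y - y)) \<le> (1/64) * norm (x - y)" if "x \<in> S2" "y \<in> S2" for x y
      proof -
        have "norm ((R x - x) - (R y - y)) \<le> 6 * e * norm (inv_into S2 P x - inv_into S2 P y)"
          unfolding Rf[OF that(1)] Rf[OF that(2)] by (intro f_lip inv(1) that)
        also have "\<dots> \<le> 6 * e * (K * norm (x - y))" using e(1) K(2)[OF that] by (intro mult_left_mono) auto
        also have "\<dots> = (6 * e * K) * norm (x - y)" by simp
        also have "\<dots> \<le> (1/64) * norm (x - y)" by (rule mult_right_mono[OF e(3)]) simp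
        finally show ?thesis .
      qed
    qed
    then have "approximable R" by (rule near_identity_approximable)
    moreover have "continuous_on S2 R"
      unfolding R_def using inv(1)
      by (intro continuous_on_compose2[OF smooth_on_sphere_continuous[OF sQ] smooth_on_sphere_continuous[OF sI]]) auto
    ultimately have "approximable (R \<circ> P)"
      using P(2) bij by (intro approximable_comp) (auto dest: bij_betwE)
    moreover have "(R \<circ> P) x = Q x" if "x \<in> S2" for x
      using bij that by (simp add: R_def bij_betw_def)
    ultimately show ?thesis using QD unfolding approximable_def by metis
  qed
  ultimately show ?thesis by blast
qed

text \<open>Approximability survives uniform limits, so a ball for the distance without derivatives
  separates.\<close>

lemma not_approximable_neighbourhood:
  assumes P: "P \<in> Diff" "\<not> approximable P"
  shows "\<exists>U. openin Diff_topology U \<and> P \<in> U \<and> (\<forall>Q\<in>U. Q \<in> Diff \<and> \<not> approximable Q)"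
proof -
  obtain \<epsilon> where \<epsilon>: "\<epsilon> > 0" "\<And>g. g \<in> M \<Longrightarrow> \<exists>x\<in>S2. \<not> norm (P x - g x) < \<epsilon>"
    using P(2) unfolding approximable_def by blast
  let ?U = "{Q \<in> Diff. Diff_dist [] P Q < \<epsilon>/2}"
  have "openin Diff_topology ?U" using \<epsilon>(1) by (intro Diff_dist_ball_openin P(1)) auto
  moreover have "P \<in> ?U" using P(1) \<epsilon>(1) by (simp add: Diff_dist_self)
  moreover have "\<not> approximable Q" if Q: "Q \<in> ?U" for Q
  proof
    assume "approximable Q"
    then obtain g where g: "g \<in> M" "\<And>x. x \<in> S2 \<Longrightarrow> norm (Q x - g x) < \<epsilon>/2"
      using \<epsilon>(1) unfolding approximable_def by (meson half_gt_zero)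
    obtain x where x: "x \<in> S2" "\<not> norm (P x - g x) < \<epsilon>" using \<epsilon>(2)[OF g(1)] by blast
    have "dist (iterated_partial [] (radial_extension P) x) (iterated_partial [] (radial_extension Q) x) < \<epsilon>/2"
      by (rule dist_less_Diff_dist) (use P(1) Q x in \<open>auto simp: Diff_def\<close>)
    then have "norm (P x - Q x) < \<epsilon>/2" using x(1) by (simp add: radial_extension_def sgn_div_norm dist_norm)
    then have "norm (P x - g x) < \<epsilon>"
      using norm_triangle_ineq[of "P x - Q x" "Q x - g x"] g(2)[OF x(1)] by simp
    then show False using x(2) by blast
  qed
  ultimately show ?thesis by blast
qed

text \<open>A connected set that contains the identity cannot meet both the approximable
  diffeomorphisms and the others, as both sets are open.\<close>

theorem approximable_Diff0:
  assumes "Q \<in> Diff0"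
  shows "approximable Q"
proof -
  let ?A = "{P \<in> Diff. approximable P}" and ?B = "{P \<in> Diff. \<not> approximable P}"
  have oA: "openin Diff_topology ?A"
  proof (subst openin_subopen, rule ballI)
    fix P assume "P \<in> ?A"
    then have "P \<in> Diff" "approximable P" by auto
    from approximable_neighbourhood[OF this] obtain U where
      "openin Diff_topology U" "P \<in> U" "\<forall>Q\<in>U. Q \<in> Diff \<and> approximable Q" by (elim exE conjE)
    then show "\<exists>U. openin Diff_topology U \<and> P \<in> U \<and> U \<subseteq> ?A" by (intro exI[of _ U]) auto
  qed
  have oB: "openin Diff_topology ?B"
  proof (subst openin_subopen, rule ballI)
    fix P assume "P \<in> ?B"
    then have "P \<in> Diff" "\<not> approximable P" by auto
    from not_approximable_neighbourhood[OF this] obtain U where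
      "openin Diff_topology U" "P \<in> U" "\<forall>Q\<in>U. Q \<in> Diff \<and> \<not> approximable Q" by (elim exE conjE)
    then show "\<exists>U. openin Diff_topology U \<and> P \<in> U \<and> U \<subseteq> ?B" by (intro exI[of _ U]) auto
  qed
  obtain T where T: "connectedin Diff_topology T" "restrict id S2 \<in> T" "Q \<in> T"
    using assms unfolding Diff0_def connected_component_of_def by blast
  have "T \<subseteq> ?A \<union> ?B" using connectedin_subset_topspace[OF T(1)] topspace_Diff_topology by blast
  moreover have "?A \<inter> ?B \<inter> T = {}" by blast
  ultimately have "?A \<inter> T = {} \<or> ?B \<inter> T = {}" using T(1) oA oB unfolding connectedin by blast
  moreover have "restrict id S2 \<in> ?A"
  proof -
    have "approximable (restrict id S2)" unfolding approximable_def
      using id_mem by (intro allI impI bexI[of _ id]) auto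
    then show ?thesis using T(1,2) connectedin_subset_topspace topspace_Diff_topology by blast
  qed
  ultimately have "?B \<inter> T = {}" using T(2) by auto
  then show ?thesis using T(3) \<open>T \<subseteq> ?A \<union> ?B\<close> by auto
qed

end

lemma approximately_controllable_rich:
  assumes "rich_sphere_monoid {g. reaches F g} A e k"
  shows "approximately_controllable_Diff0 F"
  unfolding approximately_controllable_Diff0_def
proof (intro ballI allI impI)
  interpret rich_sphere_monoid "{g. reaches F g}" A e k by fact
  fix Q and \<epsilon> T :: real assume Q: "Q \<in> Diff0" and \<epsilon>: "\<epsilon> > 0" and T: "T > 0"
  \<comment> \<open>Half of \<open>\<epsilon>\<close> is used because the supremum of strict bounds
    is only weakly bounded.\<close>
  have "\<exists>g\<in>{g. reaches F g}. \<forall>x\<in>S2. norm (Q x - g x) < \<epsilon>/2"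
    using approximable_Diff0[OF Q] \<epsilon> unfolding approximable_def by (meson half_gt_zero)
  then obtain g where g: "reaches F g" "\<And>x. x \<in> S2 \<Longrightarrow> norm (Q x - g x) < \<epsilon>/2" by blast
  from g(1)[unfolded reaches_def, rule_format, OF T]
  obtain u P where P: "u absolutely_integrable_on {0..T}"
    "\<And>x. x \<in> S2 \<Longrightarrow> P 0 x = x \<and> trajectory F T u (\<lambda>t. P t x) \<and> P T x = g x"
    by blast
  have "(SUP x\<in>S2. norm (Q x - P T x)) \<le> \<epsilon>/2"
  proof (rule cSUP_least)
    show "S2 \<noteq> {}" by (metis empty_iff norm_axis_1 mem_sphere_0)
    show "norm (Q x - P T x) \<le> \<epsilon>/2" if "x \<in> S2" for x using g(2)[OF that] P(2)[OF that] by simp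
  qed
  then have "(SUP x\<in>S2. norm (Q x - P T x)) < \<epsilon>" using \<epsilon> by linarith
  then show "\<exists>u P. u absolutely_integrable_on {0..T} \<and>
      (\<forall>x\<in>S2. P 0 x = x \<and> trajectory F T u (\<lambda>t. P t x)) \<and> (SUP x\<in>S2. norm (Q x - P T x)) < \<epsilon>"
    using P by blast
qed

theorem theorem6p10:
  fixes l :: "3 \<Rightarrow> real ^ 3"
    and q c :: "real ^ 3 \<Rightarrow> real"
    and l' :: "real ^ 3"
    and q' :: "real ^ 3 \<Rightarrow> real"
    and F :: "(real ^ 3) \<times> real \<times> real \<times> real \<times> real \<Rightarrow> real ^ 3 \<Rightarrow> real ^ 3"
  assumes "linearly_independent_on S2 (\<lambda>i x. l i \<bullet> x)"
    and "nonzero_spherical_harmonic 2 q"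
    and "nonzero_spherical_harmonic 3 c"
    and "nonzero_spherical_harmonic 1 (\<lambda>x. l' \<bullet> x)"
    and "nonzero_spherical_harmonic 2 q'"
    and "\<And>u v\<^sub>2 v\<^sub>3 w\<^sub>1 w\<^sub>2 x.
           F (u, v\<^sub>2, v\<^sub>3, w\<^sub>1, w\<^sub>2) x =
             (\<Sum>i\<in>UNIV. u $ i *\<^sub>R hamiltonian_field (\<lambda>y. l i \<bullet> y) x)
             + v\<^sub>2 *\<^sub>R hamiltonian_field q x
             + v\<^sub>3 *\<^sub>R hamiltonian_field c x
             + w\<^sub>1 *\<^sub>R spherical_gradient (\<lambda>y. l' \<bullet> y) x
             + w\<^sub>2 *\<^sub>R spherical_gradient q' x"
  shows "finite_ensemble_controllable F \<and> approximately_controllable_Diff0 F"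
proof -
  obtain A e k where "rich_sphere_monoid {g. reaches F g} A e k"
    using harmonic_control_system_rich[OF assms(1,2,4,6)] by blast
  then show ?thesis
    using finite_ensemble_controllable_rich approximately_controllable_rich by blast
qed

end
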